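(* Let $S$ be a compact connected oriented surface (possibly with boundary), and let $\mathcal P: B_n(S)\to \mathrm{Mod}(S,n)=\pi_0(\mathrm{Diff}(S,\partial S,X_n))$ be the point-pushing homomorphism. If $\partial S=\varnothing$, then for all $n\ge 6$ the map $\mathcal P$ is not realized by $C^1$ diffeomorphisms. If $\partial S\neq\varnothing$, then for all $n\ge 5$ the map $\mathcal P$ is not realized by $C^1$ diffeomorphisms. That is, in these ranges there is no group homomorphism $\sigma: B_n(S)\to \mathrm{Diff}(S,\partial S,X_n)$ whose composition with the quotient map $\mathrm{Diff}(S,\partial S,X_n)\to\pi_0(\mathrm{Diff}(S,\partial S,X_n))$ equals $\mathcal P$.
   Context: All diffeomorphisms are orientation-preserving and of class $C^1$, and diffeomorphism groups carry the $C^1$ topology. $\mathrm{Conf}_n(S)$ is the space of unordered $n$-tuples of distinct points in the interior of $S$, i.e. the quotient by the symmetric group $S_n$ of $\{(x_1,\dots,x_n): x_i\in\mathrm{int}(S),\ x_i\ne x_j \text{ for } i\ne j\}$. Fix a set $X_n=\{x_1,\dots,x_n\}$ of $n$ distinct points in the interior of $S$, taken as base point of $\mathrm{Conf}_n(S)$. The surface braid group is $B_n(S)=\pi_1(\mathrm{Conf}_n(S),X_n)$. $\mathrm{Diff}(S,\partial S)$ is the group of $C^1$ diffeomorphisms of $S$ restricting to the identity on $\partial S$, and $\mathrm{Diff}(S,\partial S,X_n)$ is its subgroup preserving $X_n$ setwise. $\mathrm{Mod}(S,n)=\pi_0(\mathrm{Diff}(S,\partial S,X_n))$. The point-pushing homomorphism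 $\mathcal P$ is the connecting map of the fibration $\mathrm{Diff}(S,\partial S,X_n)\to\mathrm{Diff}(S,\partial S)\to\mathrm{Conf}_n(S)$, $f\mapsto f(X_n)$ (restricted to the identity component of $\mathrm{Diff}(S,\partial S)$): a loop $\gamma$ based at $X_n$ is lifted to a path $f_t$ in $\mathrm{Diff}(S,\partial S)$ with $f_0=\mathrm{id}$ and $f_t(X_n)=\gamma(t)$, and $\mathcal P([\gamma])=[f_1]$ (products in $\pi_1$ are ordered so that $\mathcal P$ is a homomorphism). *)

theory Defs
  imports "HOL-Analysis.Analysis" "HOL-Algebra.Bij"
begin

section \<open>Oriented surfaces with boundary\<close>

text \<open>A surface is an abstract topology together with an oriented \<open>C\<^sup>1\<close> atlas. A chart is a pair of
  its domain and its coordinate map; the latter takes values in the closed upper half-plane.\<close>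

type_synonym 'a chart = "'a set \<times> ('a \<Rightarrow> real^2)"

definition half_plane :: "(real^2) set" where
  "half_plane = {v. 0 \<le> v $ 2}"

definition is_chart :: "'a topology \<Rightarrow> 'a chart \<Rightarrow> bool" where
  "is_chart X c \<longleftrightarrow>
     openin X (fst c) \<and>
     openin (top_of_set half_plane) (snd c ` fst c) \<and>
     homeomorphic_map (subtopology X (fst c)) (top_of_set (snd c ` fst c)) (snd c)"

text \<open>The map \<open>f\<close> written in the chart \<open>c\<close> at the source and the chart \<open>d\<close> at the target, and the
  part of the half-plane on which this expression makes sense. For \<open>f = id\<close> this is the change of
  charts from \<open>c\<close> to \<open>d\<close>.\<close>

definition local_rep :: "'a chart \<Rightarrow> 'a chart \<Rightarrow> ('a \<Rightarrow> 'a) \<Rightarrow> real^2 \<Rightarrow> real^2" where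
  "local_rep c d f = snd d \<circ> f \<circ> inv_into (fst c) (snd c)"

definition local_dom :: "'a chart \<Rightarrow> 'a chart \<Rightarrow> ('a \<Rightarrow> 'a) \<Rightarrow> (real^2) set" where
  "local_dom c d f = snd c ` (fst c \<inter> f -` fst d)"

text \<open>Derivatives are taken within the domain. As the domains that occur are relatively open in the
  half-plane, such a derivative is unique also at points of the boundary line, and a map is \<open>C\<^sup>1\<close>
  in this sense iff it extends locally to a \<open>C\<^sup>1\<close> map on an open subset of the plane.\<close>

definition C1_on :: "(real^2) set \<Rightarrow> (real^2 \<Rightarrow> real^2) \<Rightarrow> bool" where
  "C1_on D f \<longleftrightarrow>
     f differentiable_on D \<and> continuous_on D (\<lambda>v. jacobian f (at v within D))"

definition local_jacobian :: "'a chart \<Rightarrow> 'a chart \<Rightarrow> ('a \<Rightarrow> 'a) \<Rightarrow> 'a \<Rightarrow> real^2^2" where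
  "local_jacobian c d f p = jacobian (local_rep c d f) (at (snd c p) within local_dom c d f)"

definition orientation_preserving_in :: "'a chart \<Rightarrow> 'a chart \<Rightarrow> ('a \<Rightarrow> 'a) \<Rightarrow> bool" where
  "orientation_preserving_in c d f \<longleftrightarrow>
     (\<forall>p \<in> fst c \<inter> f -` fst d. 0 < det (local_jacobian c d f p))"

definition compact_connected_oriented_surface :: "'a topology \<Rightarrow> 'a chart set \<Rightarrow> bool" where
  "compact_connected_oriented_surface X A \<longleftrightarrow>
     compact_space X \<and> connected_space X \<and> Hausdorff_space X \<and>
     (\<forall>c\<in>A. is_chart X c) \<and>
     topspace X = (\<Union>c\<in>A. fst c) \<and>
     (\<forall>c\<in>A. \<forall>d\<in>A. C1_on (local_dom c d id) (local_rep c d id) \<and>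
                    orientation_preserving_in c d id)"

definition surface_boundary :: "'a topology \<Rightarrow> 'a chart set \<Rightarrow> 'a set" where
  "surface_boundary X A = {p \<in> topspace X. \<exists>c\<in>A. p \<in> fst c \<and> snd c p $ 2 = 0}"

definition surface_interior :: "'a topology \<Rightarrow> 'a chart set \<Rightarrow> 'a set" where
  "surface_interior X A = topspace X - surface_boundary X A"

section \<open>Diffeomorphism groups\<close>

definition C1_map :: "'a topology \<Rightarrow> 'a chart set \<Rightarrow> ('a \<Rightarrow> 'a) \<Rightarrow> bool" where
  "C1_map X A f \<longleftrightarrow>
     continuous_map X X f \<and>
     (\<forall>c\<in>A. \<forall>d\<in>A. C1_on (local_dom c d f) (local_rep c d f))"

text \<open>As in \<^const>\<open>BijGroup\<close>, diffeomorphisms are extensional functions, so that they are equal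
  iff they agree on the surface.\<close>

definition Diff :: "'a topology \<Rightarrow> 'a chart set \<Rightarrow> ('a \<Rightarrow> 'a) set" where
  "Diff X A = {f \<in> Bij (topspace X).
     C1_map X A f \<and> C1_map X A (inv_into (topspace X) f) \<and>
     (\<forall>c\<in>A. \<forall>d\<in>A. orientation_preserving_in c d f)}"

definition Diff_rel :: "'a topology \<Rightarrow> 'a chart set \<Rightarrow> ('a \<Rightarrow> 'a) set" where
  "Diff_rel X A = {f \<in> Diff X A. \<forall>p \<in> surface_boundary X A. f p = p}"

definition Diff_marked :: "'a topology \<Rightarrow> 'a chart set \<Rightarrow> 'a set \<Rightarrow> ('a \<Rightarrow> 'a) set" where
  "Diff_marked X A P = {f \<in> Diff_rel X A. f ` P = P}"

definition Diff_marked_group :: "'a topology \<Rightarrow> 'a chart set \<Rightarrow> 'a set \<Rightarrow> ('a \<Rightarrow> 'a) monoid" where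
  "Diff_marked_group X A P = BijGroup (topspace X) \<lparr>carrier := Diff_marked X A P\<rparr>"

text \<open>The \<open>C\<^sup>1\<close> topology is generated by the sets of diffeomorphisms that are \<open>\<epsilon>\<close>-close to a given
  one, in value and first derivative, over a compact set lying in the domain of one chart and
  mapped into the domain of another.\<close>

definition C1_nhd ::
  "'a topology \<Rightarrow> 'a chart set \<Rightarrow> 'a chart \<Rightarrow> 'a chart \<Rightarrow> ('a \<Rightarrow> 'a) \<Rightarrow> 'a set \<Rightarrow> real \<Rightarrow> ('a \<Rightarrow> 'a) set"
  where
  "C1_nhd X A c d f K \<epsilon> = {g \<in> Diff X A. g ` K \<subseteq> fst d \<and>
     (\<forall>p\<in>K. dist (snd d (g p)) (snd d (f p)) < \<epsilon> \<and>
            dist (local_jacobian c d g p) (local_jacobian c d f p) < \<epsilon>)}"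

definition C1_topology :: "'a topology \<Rightarrow> 'a chart set \<Rightarrow> ('a \<Rightarrow> 'a) topology" where
  "C1_topology X A = topology_generated_by
     {C1_nhd X A c d f K \<epsilon> | c d f K \<epsilon>.
        c \<in> A \<and> d \<in> A \<and> f \<in> Diff X A \<and> compactin X K \<and> K \<subseteq> fst c \<and> f ` K \<subseteq> fst d \<and> 0 < \<epsilon>}"

text \<open>The class of \<open>g\<close> in \<open>Mod(S,n) = \<pi>\<^sub>0(Diff(S,\<partial>S,X\<^sub>n))\<close>.\<close>

definition mapping_class :: "'a topology \<Rightarrow> 'a chart set \<Rightarrow> 'a set \<Rightarrow> ('a \<Rightarrow> 'a) \<Rightarrow> ('a \<Rightarrow> 'a) set" where
  "mapping_class X A P g =
     path_component_of_set (subtopology (C1_topology X A) (Diff_marked X A P)) g"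

section \<open>Configuration spaces and surface braid groups\<close>

definition quotient_topology :: "'a topology \<Rightarrow> ('a \<Rightarrow> 'b) \<Rightarrow> 'b topology" where
  "quotient_topology X q =
     topology (\<lambda>V. V \<subseteq> q ` topspace X \<and> openin X {x \<in> topspace X. q x \<in> V})"

lemma openin_quotient_topology:
  "openin (quotient_topology X q) V \<longleftrightarrow>
     V \<subseteq> q ` topspace X \<and> openin X {x \<in> topspace X. q x \<in> V}"
proof -
  let ?L = "\<lambda>V. V \<subseteq> q ` topspace X \<and> openin X {x \<in> topspace X. q x \<in> V}"
  have "istopology ?L"
    unfolding istopology_def
  proof (intro conjI allI impI)
    fix S T assume "?L S" "?L T"
    moreover have "{x \<in> topspace X. q x \<in> S \<inter> T} =
        {x \<in> topspace X. q x \<in> S} \<inter> {x \<in> topspace X. q x \<in> T}" by blast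
    ultimately show "S \<inter> T \<subseteq> q ` topspace X" "openin X {x \<in> topspace X. q x \<in> S \<inter> T}"
      by auto
  next
    fix \<K> assume K: "\<forall>K\<in>\<K>. ?L K"
    have "{x \<in> topspace X. q x \<in> \<Union>\<K>} = (\<Union>K\<in>\<K>. {x \<in> topspace X. q x \<in> K})" by blast
    with K show "\<Union>\<K> \<subseteq> q ` topspace X" "openin X {x \<in> topspace X. q x \<in> \<Union>\<K>}"
      by auto
  qed
  then show ?thesis
    by (simp add: quotient_topology_def)
qed

lemma topspace_quotient_topology [simp]: "topspace (quotient_topology X q) = q ` topspace X"
proof
  have "{x \<in> topspace X. q x \<in> q ` topspace X} = topspace X" by blast
  then show "q ` topspace X \<subseteq> topspace (quotient_topology X q)"
    by (intro openin_subset) (simp add: openin_quotient_topology)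
  show "topspace (quotient_topology X q) \<subseteq> q ` topspace X"
    by (meson openin_quotient_topology openin_topspace)
qed

lemma quotient_map_quotient_topology: "quotient_map X (quotient_topology X q) q"
  by (auto simp: quotient_map_def openin_quotient_topology)

definition ordered_conf :: "'a topology \<Rightarrow> 'a chart set \<Rightarrow> nat \<Rightarrow> (nat \<Rightarrow> 'a) topology" where
  "ordered_conf X A n =
     subtopology (product_topology (\<lambda>_. X) {..<n})
       {x. x ` {..<n} \<subseteq> surface_interior X A \<and> inj_on x {..<n}}"

text \<open>Two tuples of distinct points lie in the same orbit of the symmetric group iff they have the
  same set of entries, so an orbit is represented by that set, and the orbit map by the map sending
  a tuple to its set of entries.\<close>

definition Conf :: "'a topology \<Rightarrow> 'a chart set \<Rightarrow> nat \<Rightarrow> 'a set topology" where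
  "Conf X A n = quotient_topology (ordered_conf X A n) (\<lambda>x. x ` {..<n})"

definition loops_at :: "'b topology \<Rightarrow> 'b \<Rightarrow> (real \<Rightarrow> 'b) set" where
  "loops_at Y b = {\<gamma>. pathin Y \<gamma> \<and> \<gamma> 0 = b \<and> \<gamma> 1 = b}"

definition loop_homotopy :: "'b topology \<Rightarrow> 'b \<Rightarrow> ((real \<Rightarrow> 'b) \<times> (real \<Rightarrow> 'b)) set" where
  "loop_homotopy Y b = {(\<gamma>, \<delta>). \<gamma> \<in> loops_at Y b \<and> \<delta> \<in> loops_at Y b \<and>
     homotopic_with (\<lambda>\<eta>. \<eta> 0 = b \<and> \<eta> 1 = b) (top_of_set {0..1}) Y \<gamma> \<delta>}"

text \<open>First \<open>\<gamma>\<close>, then \<open>\<delta>\<close>; the library's \<^const>\<open>joinpaths\<close> needs a type of class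
  \<^class>\<open>topological_space\<close>.\<close>

definition path_concat :: "(real \<Rightarrow> 'b) \<Rightarrow> (real \<Rightarrow> 'b) \<Rightarrow> real \<Rightarrow> 'b" where
  "path_concat \<gamma> \<delta> = (\<lambda>t. if t \<le> 1/2 then \<gamma> (2 * t) else \<delta> (2 * t - 1))"

text \<open>Products are read from right to left: \<open>[\<gamma>] \<otimes> [\<delta>]\<close> traverses \<open>\<delta>\<close> first. This matches
  composition of functions and makes point-pushing a homomorphism rather than an
  anti-homomorphism.\<close>

definition fundamental_group :: "'b topology \<Rightarrow> 'b \<Rightarrow> (real \<Rightarrow> 'b) set monoid" where
  "fundamental_group Y b =
     \<lparr>carrier = loops_at Y b // loop_homotopy Y b,
      mult = \<lambda>C D. \<Union>\<gamma>\<in>C. \<Union>\<delta>\<in>D. loop_homotopy Y b `` {path_concat \<delta> \<gamma>},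
      one = loop_homotopy Y b `` {\<lambda>_. b}\<rparr>"

definition surface_braid_group ::
  "'a topology \<Rightarrow> 'a chart set \<Rightarrow> nat \<Rightarrow> 'a set \<Rightarrow> (real \<Rightarrow> 'a set) set monoid" where
  "surface_braid_group X A n P = fundamental_group (Conf X A n) P"

section \<open>Point-pushing\<close>

definition lifts_loop ::
  "'a topology \<Rightarrow> 'a chart set \<Rightarrow> 'a set \<Rightarrow> (real \<Rightarrow> 'a set) \<Rightarrow> (real \<Rightarrow> 'a \<Rightarrow> 'a) \<Rightarrow> bool" where
  "lifts_loop X A P \<gamma> f \<longleftrightarrow>
     pathin (subtopology (C1_topology X A) (Diff_rel X A)) f \<and>
     f 0 = (\<lambda>x\<in>topspace X. x) \<and>
     (\<forall>t\<in>{0..1}. f t ` P = \<gamma> t)"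

text \<open>Since evaluation at \<open>P\<close> is a fibration, every loop has a lift and the mapping class of the
  endpoint depends only on the homotopy class of the loop; the choice below is thus among
  descriptions of a single mapping class.\<close>

definition point_push ::
  "'a topology \<Rightarrow> 'a chart set \<Rightarrow> 'a set \<Rightarrow> (real \<Rightarrow> 'a set) set \<Rightarrow> ('a \<Rightarrow> 'a) set" where
  "point_push X A P C =
     (SOME m. \<exists>\<gamma>\<in>C. \<exists>f. lifts_loop X A P \<gamma> f \<and> m = mapping_class X A P (f 1))"

definition realized_by_C1_diffeos :: "'a topology \<Rightarrow> 'a chart set \<Rightarrow> nat \<Rightarrow> 'a set \<Rightarrow> bool" where
  "realized_by_C1_diffeos X A n P \<longleftrightarrow>
     (\<exists>\<sigma> \<in> hom (surface_braid_group X A n P) (Diff_marked_group X A P).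
        \<forall>C \<in> carrier (surface_braid_group X A n P).
          mapping_class X A P (\<sigma> C) = point_push X A P C)"

end

theory Submission imports Defs begin

text \<open>Of the point-pushing map only the permutation of the marked points matters. Five marked points
  in a disc give half twists satisfying the Artin relations. Suppose they are realized by
  diffeomorphisms; these fix a common point, namely a sixth marked point or a boundary point. Their
  derivatives there are equal, since \<open>2 \<times> 2\<close> matrices satisfying the Artin relations on five strands
  coincide. The quotients of the realizing diffeomorphisms therefore have identity derivative, so that
  near the fixed point their displacements are almost additive (as in Thurston's stability theorem),
  and the relations make them vanish. Hence the set where all quotients have a common fixed point and
  identity derivative is open and closed, so the realizing diffeomorphisms coincide, although adjacent
  half twists permute the marked points differently.\<close>

section \<open>Artin relations on five strands\<close>

text \<open>The derivative argument is what needs five strands: a non-scalar matrix has to commute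
  with both members of a braided pair. On four strands the relations also hold with
  \<open>A1 = A3\<close> braided with a different \<open>A2\<close>. Thurston's argument rescales
  displacements and takes a limit, which is a nonzero homomorphism into the plane; the perfect
  commutator subgroup of the five-strand group has none. Here the limit is replaced by an inequality
  at a single point: the largest displacement of the 25 quotients is at most 88/100 of itself. The
  fixed point may lie on the boundary, so all derivatives are taken within the closed half-plane,
  where a half-disc is still convex. Point-pushing is defined by choosing a loop and a lift. Instead
  of the fibration property, explicit lifts of the half twists are built from rotations supported in
  a chart, and monodromy over the configuration space shows that every choice permutes the marked
  points in the same way.\<close>

lemma matrix2_commute_iff:
  fixes A B :: "real^2^2"
  shows "A ** B = B ** A \<longleftrightarrow>
    A$1$2 * B$2$1 = B$1$2 * A$2$1 \<and>
    B$1$2 * (A$1$1 - A$2$2) = A$1$2 * (B$1$1 - B$2$2) \<and>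
    B$2$1 * (A$1$1 - A$2$2) = A$2$1 * (B$1$1 - B$2$2)"
  by (auto simp: vec_eq_iff forall_2 matrix_matrix_mult_def sum_2 algebra_simps)

text \<open>By \<open>matrix2_commute_iff\<close>, matrices commute exactly when the vectors
  \<open>(A$1$2, A$2$1, A$1$1 - A$2$2)\<close> recording their non-scalar parts are parallel. Two
  vectors parallel to the same nonzero vector are parallel to each other.\<close>

lemma matrix2_centralizer_commute:
  fixes A B C :: "real^2^2"
  assumes "\<And>k. A \<noteq> mat k" "A ** B = B ** A" "A ** C = C ** A"
  shows "B ** C = C ** B"
proof -
  have ns: "A$1$2 \<noteq> 0 \<or> A$2$1 \<noteq> 0 \<or> A$1$1 - A$2$2 \<noteq> 0"
    using assms(1)[of "A$1$1"] by (auto simp: vec_eq_iff forall_2 mat_def)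
  have *: "b * g' = f' * c \<Longrightarrow> b * g = f * c \<Longrightarrow> f * d = b * h \<Longrightarrow> f' * d = b * h' \<Longrightarrow>
      g * d = c * h \<Longrightarrow> g' * d = c * h' \<Longrightarrow> b \<noteq> 0 \<or> c \<noteq> 0 \<or> d \<noteq> 0 \<Longrightarrow>
      f * g' = f' * g \<and> f' * h = f * h' \<and> g' * h = g * h'"
    for b c d f g h f' g' h' :: real
    by (elim disjE; intro conjI) algebra+
  show ?thesis
    using assms(2,3) ns unfolding matrix2_commute_iff
    by (intro *[of "A$1$2" _ _ "A$2$1" _ _ "A$1$1 - A$2$2"]) auto
qed

text \<open>If the factors commute, both sides of the braid relation begin with
  \<open>A ** B\<close>, which can be cancelled.\<close>

lemma matrix_braid_commute_eq:
  fixes A B :: "real^'n^'n"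
  assumes "invertible A" "invertible B" "A ** B ** A = B ** A ** B" "A ** B = B ** A"
  shows "A = B"
proof -
  have "(A ** B) ** A = (A ** B) ** B" using assms(3,4) by simp
  moreover have "invertible (A ** B)" using assms by (simp add: invertible_mult)
  ultimately show ?thesis
    by (metis invertible_def matrix_mul_assoc matrix_mul_lid)
qed

lemma mat_mult_commute: "mat k ** A = A ** (mat k :: real^'n^'n)"
  by (simp add: matrix_matrix_mult_def mat_def vec_eq_iff if_distrib if_distribR sum.delta sum.delta'
      cong: if_cong)

text \<open>If no matrix is scalar, then \<open>A\<^sub>1\<close> commutes with \<open>A\<^sub>3\<close> and \<open>A\<^sub>4\<close>, which therefore commute with
  each other; together with the braid relation this forces \<open>A\<^sub>3 = A\<^sub>4\<close>.\<close>

lemma matrix2_braid_rep_trivial: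
  fixes A1 A2 A3 A4 :: "real^2^2"
  assumes inv: "invertible A1" "invertible A2" "invertible A3" "invertible A4"
    and b: "A1 ** A2 ** A1 = A2 ** A1 ** A2" "A2 ** A3 ** A2 = A3 ** A2 ** A3"
      "A3 ** A4 ** A3 = A4 ** A3 ** A4"
    and c: "A1 ** A3 = A3 ** A1" "A1 ** A4 = A4 ** A1" "A2 ** A4 = A4 ** A2"
  shows "A2 = A1 \<and> A3 = A1 \<and> A4 = A1"
\<comment> \<open>A scalar end of the chain commutes with its neighbour, hence equals it and makes
  it scalar as well; equality then propagates along the chain.\<close>
proof (cases "(\<exists>k. A1 = mat k) \<or> (\<exists>k. A4 = mat k)")
  case True
  then consider k where "A1 = mat k" | k where "A4 = mat k" by blast
  then show ?thesis
  proof cases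
    case 1
    then have "A1 = A2" by (metis b(1) inv(1,2) mat_mult_commute matrix_braid_commute_eq)
    moreover from this 1 have "A2 = A3" by (metis b(2) inv(2,3) mat_mult_commute matrix_braid_commute_eq)
    moreover from this calculation 1 have "A3 = A4"
      by (metis b(3) inv(3,4) mat_mult_commute matrix_braid_commute_eq)
    ultimately show ?thesis by simp
  next
    case 2
    then have "A3 = A4" by (metis b(3) inv(3,4) mat_mult_commute matrix_braid_commute_eq)
    moreover from this 2 have "A2 = A3" by (metis b(2) inv(2,3) mat_mult_commute matrix_braid_commute_eq)
    moreover from this calculation 2 have "A1 = A2"
      by (metis b(1) inv(1,2) mat_mult_commute matrix_braid_commute_eq)
    ultimately show ?thesis by simp
  qed
next
  case False
  then have "A3 ** A4 = A4 ** A3" "A1 ** A2 = A2 ** A1"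
    using matrix2_centralizer_commute[of A1 A3 A4] matrix2_centralizer_commute[of A4 A1 A2] c by auto
  then have "A3 = A4" "A1 = A2" using matrix_braid_commute_eq inv b by blast+
  \<comment> \<open>With \<open>A1 = A2\<close>, the known commutation of \<open>A1\<close> and
    \<open>A3\<close> becomes that of the middle braided pair.\<close>
  moreover from this have "A2 = A3" using matrix_braid_commute_eq inv b c by metis
  ultimately show ?thesis by simp
qed

text \<open>A triple \<open>(i, j, k)\<close> stands for generators \<open>a\<^sub>i\<close>, \<open>a\<^sub>j\<close> that satisfy the braid relation and commute
  with \<open>a\<^sub>k\<close>; \<open>a\<^sub>0\<close> is the additional element \<open>a\<^sub>5\<close> of \<open>braid_pentagon\<close>.\<close>

definition braid_edges :: "(nat \<times> nat \<times> nat) set" where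
  "braid_edges = {(0,1,3), (1,2,4), (2,3,0), (3,4,1)}"

text \<open>\<open>U i j\<close> is the action of \<open>a\<^sub>i a\<^sub>j\<^sup>-\<^sup>1\<close>. Up to an error of a few percent of their maximum \<open>M\<close>,
  displacements add under composition, so the relation of an edge makes the displacement of \<open>U i j\<close>
  small; the edges connect all indices, whence \<open>M \<le> 88/100 M\<close>.\<close>

lemma displacement_trivial:
  fixes U :: "nat \<Rightarrow> nat \<Rightarrow> 'v::real_normed_vector \<Rightarrow> 'v"
  assumes lip: "\<And>i j y z. i < 5 \<Longrightarrow> j < 5 \<Longrightarrow> y \<in> B \<Longrightarrow> z \<in> B \<Longrightarrow>
      norm ((U i j y - y) - (U i j z - z)) \<le> 1/100 * norm (y - z)"
    and B: "x \<in> B" "\<And>i j. i < 5 \<Longrightarrow> j < 5 \<Longrightarrow> U i j x \<in> B"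
      "\<And>i j k l. i < 5 \<Longrightarrow> j < 5 \<Longrightarrow> k < 5 \<Longrightarrow> l < 5 \<Longrightarrow> U i j (U k l x) \<in> B"
    and refl: "\<And>i. i < 5 \<Longrightarrow> U i i x = x"
    and trans: "\<And>i j k. i < 5 \<Longrightarrow> j < 5 \<Longrightarrow> k < 5 \<Longrightarrow> U i j (U j k x) = U i k x"
    and edge: "\<And>i j k. (i,j,k) \<in> braid_edges \<Longrightarrow>
      U i k (U j k (U i k x)) = U j k (U i k (U j k x))"
    and ij: "i < 5" "j < 5"
  shows "U i j x = x"
proof -
  define D where "D i j = U i j x - x" for i j
  define M where "M = Max ((\<lambda>(i,j). norm (D i j)) ` ({..<5} \<times> {..<5}))"
  have M: "norm (D i j) \<le> M" if "i < 5" "j < 5" for i j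
    unfolding M_def using that by (intro Max_ge) auto
  have M0: "0 \<le> M" using M[of 0 0] norm_ge_zero[of "D 0 0"] by linarith
  \<comment> \<open>By the Lipschitz bound, the displacement of \<open>U i j\<close> changes by at
    most 1/100 of \<open>norm (D k l)\<close> between \<open>x\<close> and
    \<open>U k l x\<close>.\<close>
  have two: "norm (U i j (U k l x) - U k l x - D i j) \<le> M/100"
    if "i < 5" "j < 5" "k < 5" "l < 5" for i j k l
    using lip[OF that(1,2) B(2)[OF that(3,4)] B(1)] M[OF that(3,4)] by (simp add: D_def)
  have two': "norm (U i j (U k l x) - x) \<le> 3 * M"
    if "i < 5" "j < 5" "k < 5" "l < 5" for i j k l
  proof -
    have "U i j (U k l x) - x = (U i j (U k l x) - U k l x - D i j) + D i j + D k l"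
      by (simp add: D_def)
    also have "norm \<dots> \<le> M/100 + M + M"
      by (intro order_trans[OF norm_triangle_ineq] add_mono two M that)
    finally show ?thesis using M0 by simp
  qed
  have three: "norm (U i j (U k l (U m p x)) - U k l (U m p x) - D i j) \<le> 3*M/100"
    if "i < 5" "j < 5" "k < 5" "l < 5" "m < 5" "p < 5" for i j k l m p
    using lip[OF that(1,2) B(3)[OF that(3-6)] B(1)] two'[OF that(3-6)] by (simp add: D_def)
  \<comment> \<open>Telescoping: the last letter acts at distance at most \<open>3 * M\<close> from
    \<open>x\<close>, the middle one at distance at most \<open>M\<close>, the first one at
    \<open>x\<close> itself.\<close>
  have word: "norm (U i j (U k l (U m p x)) - x - (D i j + D k l + D m p)) \<le> 4*M/100"
    if "i < 5" "j < 5" "k < 5" "l < 5" "m < 5" "p < 5" for i j k l m p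
  proof -
    have "U i j (U k l (U m p x)) - x - (D i j + D k l + D m p) =
      (U i j (U k l (U m p x)) - U k l (U m p x) - D i j) + (U k l (U m p x) - U m p x - D k l)"
      by (simp add: D_def)
    also have "norm \<dots> \<le> 3*M/100 + M/100"
      by (intro order_trans[OF norm_triangle_ineq] add_mono two three that)
    finally show ?thesis by simp
  qed
  have add: "norm (D i k - D i j - D j k) \<le> M/100" if "i < 5" "j < 5" "k < 5" for i j k
    using two[of i j j k] that trans[OF that] by (simp add: D_def algebra_simps)
  have anti: "norm (D i j + D j i) \<le> M/100" if "i < 5" "j < 5" for i j
    using add[of i j i] that refl[of i] norm_minus_cancel[of "D i j + D j i"]
    by (simp add: D_def algebra_simps)
  \<comment> \<open>Up to two word errors of 4 percent each, the braid relation says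
    \<open>2 D i k + D j k = 2 D j k + D i k\<close>, so \<open>D i k\<close> and
    \<open>D j k\<close> nearly agree. Passing from their difference to \<open>D i j\<close> costs
    one percent for \<open>add\<close> and one for \<open>anti\<close>.\<close>
  have e: "norm (D i j) \<le> 10*M/100" if "(i,j,k) \<in> braid_edges" for i j k
  proof -
    have lt: "i < 5" "j < 5" "k < 5" using that by (auto simp: braid_edges_def)
    have "D i j = (D i j - D i k - D k j) + (D k j + D j k)
      + (U j k (U i k (U j k x)) - x - (D j k + D i k + D j k))
      - (U i k (U j k (U i k x)) - x - (D i k + D j k + D i k))"
      using edge[OF that] by (simp add: algebra_simps)
    also have "norm \<dots> \<le> M/100 + M/100 + 4*M/100 + 4*M/100"
      by (intro order_trans[OF norm_triangle_ineq4] order_trans[OF norm_triangle_ineq]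
          add_mono add anti word lt)
    finally show ?thesis by simp
  qed
  have tri: "norm (D i k) \<le> norm (D i j) + norm (D j k) + M/100" if "i < 5" "j < 5" "k < 5" for i j k
  proof -
    have "D i k = D i j + D j k + (D i k - D i j - D j k)" by simp
    also have "norm \<dots> \<le> norm (D i j) + norm (D j k) + M/100"
      by (intro order_trans[OF norm_triangle_ineq] add_mono add order_refl that)
    finally show ?thesis .
  qed
  \<comment> \<open>Each edge of the path 0-1-2-3-4 contributes 10 percent, and each composition one
    more: 10, 21, 32, 43.\<close>
  have "norm (D 0 j) \<le> 43*M/100" if "j < 5" for j
  proof -
    have "norm (D 0 0) \<le> 43*M/100" using refl[of 0] M0 by (simp add: D_def)
    moreover have 1: "norm (D 0 1) \<le> 10*M/100" using e[of 0 1 3] by (simp add: braid_edges_def)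
    moreover have 2: "norm (D 0 2) \<le> 21*M/100" using e[of 1 2 4] tri[of 0 1 2] 1 by (simp add: braid_edges_def)
    moreover have 3: "norm (D 0 3) \<le> 32*M/100" using e[of 2 3 0] tri[of 0 2 3] 2 by (simp add: braid_edges_def)
    moreover have 4: "norm (D 0 4) \<le> 43*M/100" using e[of 3 4 1] tri[of 0 3 4] 3 by (simp add: braid_edges_def)
    moreover have "j = 0 \<or> j = 1 \<or> j = 2 \<or> j = 3 \<or> j = 4" using that by linarith
    ultimately show ?thesis using M0 by (elim disjE; simp)
  qed note D0 = this
  \<comment> \<open>Exchanging the indices costs one percent. Joining \<open>i\<close> to
    \<open>j\<close> through 0 then gives 44 + 43 + 1 = 88.\<close>
  have "norm (D i 0) \<le> 44*M/100" if "i < 5" for i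
  proof -
    have "norm (D i 0) \<le> norm (D 0 i) + norm (D i 0 + D 0 i)"
      using norm_triangle_ineq4[of "D i 0 + D 0 i" "D 0 i"] by simp
    then show ?thesis using D0[OF that] anti[OF that, of 0] by simp
  qed
  then have "norm (D i j) \<le> 88*M/100" if "i < 5" "j < 5" for i j
    using tri[of i 0 j] D0[of j] that by fastforce
  then have "M \<le> 88*M/100"
    unfolding M_def by (intro Max.boundedI) (auto simp: M_def lessThan_empty_iff)
  then have "M = 0" using M0 by simp
  then show ?thesis using M[OF ij] by (simp add: D_def)
qed

section \<open>Braid relations in an abstract group\<close>

context group
begin

abbreviation (input) braided where "braided a b \<equiv> a \<otimes> b \<otimes> a = b \<otimes> a \<otimes> b"
abbreviation (input) commuting where "commuting a b \<equiv> a \<otimes> b = b \<otimes> a"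

text \<open>Conjugation by \<open>w\<close> is written as
  \<open>a' \<otimes> w = w \<otimes> a\<close>, the form in which a generator is pushed through a
  word; cancelling \<open>w\<close> transports the relation.\<close>

lemma intertwine_commuting:
  assumes "a \<in> carrier G" "b \<in> carrier G" "a' \<in> carrier G" "b' \<in> carrier G" "w \<in> carrier G"
    "a' \<otimes> w = w \<otimes> a" "b' \<otimes> w = w \<otimes> b" "commuting a b"
  shows "commuting a' b'"
proof -
  have "a' \<otimes> b' \<otimes> w = w \<otimes> (a \<otimes> b)" using assms by (metis m_assoc m_closed)
  also have "\<dots> = b' \<otimes> a' \<otimes> w" using assms by (metis m_assoc m_closed)
  finally show ?thesis using assms by simp
qed

lemma intertwine_braided:
  assumes "a \<in> carrier G" "b \<in> carrier G" "a' \<in> carrier G" "b' \<in> carrier G" "w \<in> carrier G"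
    "a' \<otimes> w = w \<otimes> a" "b' \<otimes> w = w \<otimes> b" "braided a b"
  shows "braided a' b'"
proof -
  have "a' \<otimes> b' \<otimes> a' \<otimes> w = w \<otimes> (a \<otimes> b \<otimes> a)" using assms by (metis m_assoc m_closed)
  also have "\<dots> = b' \<otimes> a' \<otimes> b' \<otimes> w" using assms by (metis m_assoc m_closed)
  finally show ?thesis using assms by simp
qed

lemma commuting_inv:
  assumes "a \<in> carrier G" "b \<in> carrier G" "commuting a b"
  shows "commuting a (inv b)"
  using assms by (metis inv_closed inv_solve_left' inv_solve_right m_assoc m_closed)

text \<open>Since \<open>inv c\<close> commutes with \<open>a\<close> and \<open>b\<close>, each
  side collects into a braid word times the cube of \<open>inv c\<close>. The braid relation thus
  passes to quotients with a common denominator.\<close>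

lemma braided_quotients:
  assumes c: "a \<in> carrier G" "b \<in> carrier G" "c \<in> carrier G"
    and "braided a b" "commuting a c" "commuting b c"
  shows "(a \<otimes> inv c) \<otimes> (b \<otimes> inv c) \<otimes> (a \<otimes> inv c) = (b \<otimes> inv c) \<otimes> (a \<otimes> inv c) \<otimes> (b \<otimes> inv c)"
proof -
  have *: "(x \<otimes> inv c) \<otimes> (y \<otimes> inv c) \<otimes> (x \<otimes> inv c) = x \<otimes> y \<otimes> x \<otimes> (inv c \<otimes> inv c \<otimes> inv c)"
    if "x \<in> carrier G" "y \<in> carrier G" "commuting x (inv c)" "commuting y (inv c)" for x y
  proof -
    define d where "d = inv c"
    have d: "d \<in> carrier G" "y \<otimes> d = d \<otimes> y" "x \<otimes> d = d \<otimes> x" using that c by (auto simp: d_def)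
    have "(x \<otimes> d) \<otimes> (y \<otimes> d) \<otimes> (x \<otimes> d) = x \<otimes> (d \<otimes> y) \<otimes> (d \<otimes> x) \<otimes> d"
      using that(1,2) d(1) by (simp add: m_assoc)
    also have "\<dots> = x \<otimes> (y \<otimes> d) \<otimes> (x \<otimes> d) \<otimes> d" by (simp only: d)
    also have "\<dots> = x \<otimes> y \<otimes> (d \<otimes> x) \<otimes> d \<otimes> d" using that(1,2) d(1) by (simp add: m_assoc)
    also have "\<dots> = x \<otimes> y \<otimes> (x \<otimes> d) \<otimes> d \<otimes> d" by (simp only: d)
    also have "\<dots> = x \<otimes> y \<otimes> x \<otimes> (d \<otimes> d \<otimes> d)" using that(1,2) d(1) by (simp add: m_assoc)
    finally show ?thesis by (simp add: d_def)
  qed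
  show ?thesis using *[of a b] *[of b a] assms commuting_inv by metis
qed

text \<open>If the generators are half twists, then \<open>a\<^sub>5\<close> is the half twist along an arc joining the two ends
  of their chain of arcs. It is needed since no generator commutes with both \<open>a\<^sub>2\<close> and \<open>a\<^sub>3\<close>.\<close>

lemma braid_pentagon:
  assumes C: "a1 \<in> carrier G" "a2 \<in> carrier G" "a3 \<in> carrier G" "a4 \<in> carrier G"
    and b: "braided a1 a2" "braided a2 a3" "braided a3 a4"
    and c: "commuting a1 a3" "commuting a1 a4" "commuting a2 a4"
  defines "w \<equiv> a4 \<otimes> a3 \<otimes> a2"
  defines "a5 \<equiv> w \<otimes> a1 \<otimes> inv w"
  shows "commuting a5 a2" "commuting a5 a3" "braided a5 a1" "a5 \<in> carrier G" "a5 \<otimes> w = w \<otimes> a1"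
proof -
  have W: "w \<in> carrier G" "a5 \<in> carrier G" using C by (auto simp: w_def a5_def)
  have i1: "a5 \<otimes> w = w \<otimes> a1" unfolding a5_def using C W by (simp add: m_assoc)
  \<comment> \<open>Conjugation by \<open>w\<close> takes \<open>a3\<close> to \<open>a2\<close> and
    \<open>a4\<close> to \<open>a3\<close>. As it takes \<open>a1\<close> to \<open>a5\<close>, the
    commutation of \<open>a1\<close> with \<open>a3\<close> and \<open>a4\<close> becomes that of
    \<open>a5\<close> with \<open>a2\<close> and \<open>a3\<close>.\<close>
  have i2: "a2 \<otimes> w = w \<otimes> a3" unfolding w_def using C b c by (metis m_assoc m_closed)
  have i3: "a3 \<otimes> w = w \<otimes> a4" unfolding w_def using C b c by (metis m_assoc m_closed)
  show "commuting a5 a2" by (rule intertwine_commuting[OF _ _ _ _ W(1) i1 i2]) (use C W c in auto)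
  show "commuting a5 a3" by (rule intertwine_commuting[OF _ _ _ _ W(1) i1 i3]) (use C W c in auto)
  \<comment> \<open>Chosen so that \<open>w = a1 \<otimes> v \<otimes> a2\<close> while
    \<open>v\<close> commutes with \<open>a1\<close>. Conjugation by \<open>v\<close> fixes
    \<open>a1\<close> and takes \<open>a2\<close> to \<open>a5\<close>, which transports the braid
    relation of \<open>a1\<close> and \<open>a2\<close>.\<close>
  define v where "v = inv a1 \<otimes> a4 \<otimes> a3"
  have V: "v \<in> carrier G" using C by (simp add: v_def)
  have i4: "a1 \<otimes> v = v \<otimes> a1"
  proof -
    have "commuting a1 (a4 \<otimes> a3)" using C c by (metis m_assoc m_closed)
    then show ?thesis unfolding v_def using C
      by (metis inv_closed m_assoc m_closed r_inv l_inv l_one r_one)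
  qed
  have wv: "w \<otimes> a1 = a1 \<otimes> v \<otimes> a2 \<otimes> a1"
    unfolding v_def w_def using C by (simp add: m_assoc) (metis m_assoc m_closed inv_closed r_inv l_one)
  have "a5 \<otimes> v = v \<otimes> a2"
  proof -
    have w: "w = a1 \<otimes> v \<otimes> a2" using wv C W V by simp
    have "v \<otimes> a2 \<otimes> (a1 \<otimes> a2) = w \<otimes> a1"
      unfolding w i4 using C V b by (simp add: m_assoc)
    then have "v \<otimes> a2 \<otimes> (a1 \<otimes> a2) = a5 \<otimes> v \<otimes> (a1 \<otimes> a2)"
      using i1 C V W w i4 by (simp add: m_assoc)
    then show ?thesis using C V W by simp
  qed
  then show "braided a5 a1"
    using intertwine_braided[OF _ _ _ _ V _ i4, of a2 a5] C W b by metis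
  show "a5 \<in> carrier G" "a5 \<otimes> w = w \<otimes> a1" using W i1 by auto
qed

end

section \<open>Continuity on open covers and the tube lemma\<close>

lemma continuous_map_open_cover:
  assumes "\<And>x. x \<in> topspace X \<Longrightarrow>
    \<exists>U. openin X U \<and> x \<in> U \<and> continuous_map (subtopology X U) Y f"
  shows "continuous_map X Y f"
proof (rule pasting_lemma[where I = "{U. openin X U \<and> continuous_map (subtopology X U) Y f}"
        and T = "\<lambda>U. U" and f = "\<lambda>_. f"])
  show "\<exists>U. U \<in> {U. openin X U \<and> continuous_map (subtopology X U) Y f} \<and> x \<in> U \<and> f x = f x"
    if "x \<in> topspace X" for x
    using assms[OF that] by blast
qed simp_all

lemma continuous_map_matrix_mult:
  fixes f g :: "'b \<Rightarrow> real^2^2"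
  assumes "continuous_map X euclidean f" "continuous_map X euclidean g"
  shows "continuous_map X euclidean (\<lambda>x. f x ** g x)"
  unfolding continuous_map_atin limitin_canonical_iff
proof
  fix x assume x: "x \<in> topspace X"
  have "(f \<longlongrightarrow> f x) (atin X x)" "(g \<longlongrightarrow> g x) (atin X x)"
    using assms x unfolding continuous_map_atin by auto
  then show "((\<lambda>y. f y ** g y) \<longlongrightarrow> f x ** g x) (atin X x)"
    unfolding matrix_matrix_mult_def
    by (intro vec_tendstoI) (simp only: vec_lambda_beta, intro tendsto_sum tendsto_mult tendsto_vec_nth)
qed

lemma tube_open:
  assumes W: "openin (prod_topology T X) W" and K: "compactin X K" and t: "t \<in> topspace T"
    and sub: "\<And>p. p \<in> K \<Longrightarrow> (t, p) \<in> W"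
  shows "\<exists>U. openin T U \<and> t \<in> U \<and> U \<times> K \<subseteq> W"
proof -
  have KX: "K \<subseteq> topspace X" using K compactin_subset_topspace by blast
  let ?C = "(topspace T \<times> K) - W"
  have "closedin (prod_topology T (subtopology X K)) ?C"
  proof -
    have "openin (prod_topology T (subtopology X K)) (W \<inter> (topspace T \<times> K))"
      unfolding prod_topology_subtopology(2) by (rule openin_subtopology_Int[OF W])
    then have "closedin (prod_topology T (subtopology X K))
        (topspace (prod_topology T (subtopology X K)) - W \<inter> (topspace T \<times> K))"
      by (rule closedin_diff[OF closedin_topspace])
    moreover have "topspace (prod_topology T (subtopology X K)) - W \<inter> (topspace T \<times> K) = ?C"
      using KX by (simp add: inf_absorb2 Diff_Int_distrib) blast
    ultimately show ?thesis by simp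
  qed
  then have "closedin T (fst ` ?C)"
    using closed_map_fst[of "subtopology X K" T] K
    unfolding closed_map_def compactin_subspace by blast
  then have "openin T (topspace T - fst ` ?C)" by blast
  moreover have "t \<in> topspace T - fst ` ?C" using t sub by force
  moreover have "(topspace T - fst ` ?C) \<times> K \<subseteq> W" by force
  ultimately show ?thesis by blast
qed

section \<open>Charts and derivatives\<close>

lemma zero_in_half_plane_nhd: "v \<in> half_plane \<Longrightarrow> 0 \<le> d \<Longrightarrow> v + d *\<^sub>R axis i 1 \<in> half_plane"
  by (auto simp: half_plane_def axis_def)

text \<open>Small steps in the positive coordinate directions stay in the half-plane even at
  boundary points, and they determine the derivative.\<close>

lemma has_derivative_half_plane_unique:
  assumes "v \<in> half_plane" "(f has_derivative L) (at v within half_plane)"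
    "(f has_derivative M) (at v within half_plane)"
  shows "L = M"
proof (rule frechet_derivative_unique_within[OF assms(2,3)])
  fix i :: "real^2" and e :: real
  assume "i \<in> Basis" "0 < e"
  then show "\<exists>d. 0 < \<bar>d\<bar> \<and> \<bar>d\<bar> < e \<and> v + d *\<^sub>R i \<in> half_plane"
    using zero_in_half_plane_nhd[OF assms(1), of "e/2"]
    by (intro exI[of _ "e/2"]) (auto simp: Basis_vec_def)
qed

lemma at_within_half_plane:
  assumes "openin (top_of_set half_plane) D" "v \<in> D"
  shows "at v within D = at v within half_plane"
proof -
  obtain T where "open T" "D = half_plane \<inter> T" using assms(1) by (auto simp: openin_open)
  then show ?thesis using assms(2) by (intro at_within_nhd[of _ T]) auto
qed

lemma chart_subset: "is_chart X c \<Longrightarrow> fst c \<subseteq> topspace X"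
  by (simp add: is_chart_def openin_subset)

lemma chart_topspace: "is_chart X c \<Longrightarrow> topspace (subtopology X (fst c)) = fst c"
  using chart_subset by fastforce

lemma chart_inj: "is_chart X c \<Longrightarrow> inj_on (snd c) (fst c)"
  using homeomorphic_imp_injective_map chart_topspace unfolding is_chart_def by metis

lemma chart_image_half_plane: "is_chart X c \<Longrightarrow> snd c ` fst c \<subseteq> half_plane"
  unfolding is_chart_def by (metis openin_imp_subset)

lemma chart_in_half_plane: "is_chart X c \<Longrightarrow> p \<in> fst c \<Longrightarrow> snd c p \<in> half_plane"
  using chart_image_half_plane by blast

lemma chart_inv [simp]: "is_chart X c \<Longrightarrow> p \<in> fst c \<Longrightarrow> inv_into (fst c) (snd c) (snd c p) = p"
  by (simp add: chart_inj)

lemma chart_openin_image: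
  assumes c: "is_chart X c" and U: "openin X U" "U \<subseteq> fst c"
  shows "openin (top_of_set half_plane) (snd c ` U)"
proof -
  have "open_map (subtopology X (fst c)) (top_of_set (snd c ` fst c)) (snd c)"
    using c homeomorphic_imp_open_map by (auto simp: is_chart_def)
  moreover have "openin (subtopology X (fst c)) U"
    using U c by (simp add: is_chart_def openin_open_subtopology)
  ultimately have "openin (top_of_set (snd c ` fst c)) (snd c ` U)" by (simp add: open_map_def)
  then show ?thesis using c unfolding is_chart_def by (meson openin_trans)
qed

lemma chart_continuous: "is_chart X c \<Longrightarrow> continuous_map (subtopology X (fst c)) euclidean (snd c)"
  unfolding is_chart_def using homeomorphic_imp_continuous_map continuous_map_in_subtopology by blast

lemma chart_inv_continuous:
  assumes c: "is_chart X c"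
  shows "continuous_map (top_of_set (snd c ` fst c)) X (inv_into (fst c) (snd c))"
proof -
  obtain g where g: "homeomorphic_maps (subtopology X (fst c)) (top_of_set (snd c ` fst c)) (snd c) g"
    using c unfolding is_chart_def homeomorphic_map_maps by blast
  have "g v = inv_into (fst c) (snd c) v" if v: "v \<in> snd c ` fst c" for v
  proof -
    obtain p where p: "p \<in> fst c" "v = snd c p" using v by blast
    moreover have "g (snd c p) = p"
      using g p(1) unfolding homeomorphic_maps_def chart_topspace[OF c] by blast
    ultimately show ?thesis using chart_inv[OF c] by metis
  qed
  moreover have "continuous_map (top_of_set (snd c ` fst c)) X g"
    using g unfolding homeomorphic_maps_def continuous_map_in_subtopology by blast
  ultimately show ?thesis
    using continuous_map_eq[of "top_of_set (snd c ` fst c)" X g "inv_into (fst c) (snd c)"] by simp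
qed

lemma chart_openin: "is_chart X c \<Longrightarrow> openin X (fst c)" by (simp add: is_chart_def)

lemma chart_openin_preimage:
  assumes c: "is_chart X c" and V: "open V"
  shows "openin X {p \<in> fst c. snd c p \<in> V}"
proof -
  have "openin (subtopology X (fst c)) {p \<in> fst c. snd c p \<in> V}"
    using openin_continuous_map_preimage[OF chart_continuous[OF c], of V] V
    unfolding chart_topspace[OF c] by simp
  then show ?thesis using chart_openin[OF c] by (simp add: openin_open_subtopology)
qed

lemma openin_overlap:
  assumes "continuous_map X X f" "openin X U" "openin X V"
  shows "openin X (U \<inter> f -` V)"
  using openin_continuous_map_preimage_gen[OF assms] by (simp add: vimage_def Int_def)

text \<open>Derivatives within the whole half-plane use a filter that does not depend on
  \<open>f\<close>; by \<open>at_local_dom\<close> it agrees with the one within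
  \<open>local_dom\<close>. The matrix is an argument, so that explicit formulas can be verified and
  then identified with \<open>local_jacobian\<close> by uniqueness.\<close>

definition chart_deriv ::
  "'a chart \<Rightarrow> 'a chart \<Rightarrow> ('a \<Rightarrow> 'a) \<Rightarrow> 'a \<Rightarrow> real^2^2 \<Rightarrow> bool" where
  "chart_deriv c d f p J \<longleftrightarrow>
     (local_rep c d f has_derivative (\<lambda>h. J *v h)) (at (snd c p) within half_plane)"

lemma local_rep_apply: "is_chart X c \<Longrightarrow> p \<in> fst c \<Longrightarrow> local_rep c d f (snd c p) = snd d (f p)"
  by (simp add: local_rep_def)

lemma at_local_dom:
  assumes "is_chart X c" "is_chart X d" "continuous_map X X f" "p \<in> fst c \<inter> f -` fst d"
  shows "at (snd c p) within local_dom c d f = at (snd c p) within half_plane"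
proof (rule at_within_half_plane)
  show "openin (top_of_set half_plane) (local_dom c d f)"
    unfolding local_dom_def
    by (rule chart_openin_image[OF assms(1) openin_overlap[OF assms(3)]]) (simp_all add: assms(1,2) chart_openin)
  show "snd c p \<in> local_dom c d f" using assms(4) by (simp add: local_dom_def)
qed

lemma chart_deriv_unique:
  assumes "is_chart X c" "p \<in> fst c" "chart_deriv c d f p J" "chart_deriv c d f p K"
  shows "J = K"
proof -
  have "(\<lambda>h. J *v h) = (\<lambda>h. K *v h)"
    using has_derivative_half_plane_unique[OF chart_in_half_plane[OF assms(1,2)]] assms(3,4)
    unfolding chart_deriv_def by blast
  then show ?thesis by (metis matrix_of_matrix_vector_mul)
qed

lemma local_jacobian_eq:
  assumes "is_chart X c" "is_chart X d" "continuous_map X X f" "p \<in> fst c \<inter> f -` fst d"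
    "chart_deriv c d f p J"
  shows "local_jacobian c d f p = J"
proof -
  have "chart_deriv c d f p (local_jacobian c d f p)"
    using assms(5) jacobian_works[of "local_rep c d f" "at (snd c p) within half_plane"]
    unfolding chart_deriv_def local_jacobian_def at_local_dom[OF assms(1-4)] differentiable_def by blast
  then show ?thesis using chart_deriv_unique[OF assms(1)] assms(4,5) by blast
qed

text \<open>Moves the definition from subsets of the plane to points of the surface: the chart and
  its inverse carry continuity of the Jacobian in both directions.\<close>

lemma C1_on_iff:
  assumes c: "is_chart X c" and d: "is_chart X d" and f: "continuous_map X X f"
  shows "C1_on (local_dom c d f) (local_rep c d f) \<longleftrightarrow>
     (\<forall>p\<in>fst c \<inter> f -` fst d. chart_deriv c d f p (local_jacobian c d f p)) \<and>
     continuous_map (subtopology X (fst c \<inter> f -` fst d)) euclidean (local_jacobian c d f)"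
proof -
  let ?D = "fst c \<inter> f -` fst d"
  have D: "local_dom c d f = snd c ` ?D" by (simp add: local_dom_def)
  have 1: "local_rep c d f differentiable_on local_dom c d f \<longleftrightarrow>
      (\<forall>p\<in>?D. chart_deriv c d f p (local_jacobian c d f p))"
  proof -
    have "local_rep c d f differentiable (at (snd c p) within local_dom c d f) \<longleftrightarrow>
      chart_deriv c d f p (local_jacobian c d f p)" if "p \<in> ?D" for p
      using at_local_dom[OF c d f that] jacobian_works[of "local_rep c d f" "at (snd c p) within half_plane"]
      by (simp only: chart_deriv_def local_jacobian_def)
    then show ?thesis unfolding differentiable_on_def unfolding D by blast
  qed
  have sub: "topspace (subtopology X ?D) = ?D" using chart_subset[OF c] by auto
  let ?J = "\<lambda>v. jacobian (local_rep c d f) (at v within local_dom c d f)"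
  have 2: "continuous_map (subtopology X ?D) euclidean (local_jacobian c d f)"
    if "continuous_on (local_dom c d f) ?J"
  proof -
    have "continuous_map (subtopology X ?D) (top_of_set (local_dom c d f)) (snd c)"
      using continuous_map_from_subtopology_mono[OF chart_continuous[OF c], of ?D] sub
      unfolding continuous_map_in_subtopology D by blast
    moreover have "continuous_map (top_of_set (local_dom c d f)) euclidean ?J" using that by simp
    ultimately have "continuous_map (subtopology X ?D) euclidean (?J \<circ> snd c)"
      by (rule continuous_map_compose)
    moreover have "?J \<circ> snd c = local_jacobian c d f" by (auto simp: local_jacobian_def)
    ultimately show ?thesis by simp
  qed
  have 3: "continuous_on (local_dom c d f) ?J"
    if "continuous_map (subtopology X ?D) euclidean (local_jacobian c d f)"
  proof -
    have "continuous_map (top_of_set (local_dom c d f)) (subtopology X ?D) (inv_into (fst c) (snd c))"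
      unfolding continuous_map_in_subtopology
    proof
      show "continuous_map (top_of_set (local_dom c d f)) X (inv_into (fst c) (snd c))"
        by (rule continuous_map_from_subtopology_mono[OF chart_inv_continuous[OF c]]) (auto simp: D)
      show "inv_into (fst c) (snd c) \<in> topspace (top_of_set (local_dom c d f)) \<rightarrow> ?D"
        using c by (auto simp: D)
    qed
    from continuous_map_compose[OF this that]
    have "continuous_on (local_dom c d f) (local_jacobian c d f \<circ> inv_into (fst c) (snd c))" by simp
    then show ?thesis
      by (rule continuous_on_eq) (auto simp: D local_jacobian_def chart_inv[OF c])
  qed
  show ?thesis unfolding C1_on_def using 1 2 3 by blast
qed

lemma chart_deriv_compose:
  assumes c: "is_chart X c" and d: "is_chart X d" and f: "continuous_map X X f"
    and p: "p \<in> fst c" "f p \<in> fst d"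
    and J: "chart_deriv c d f p J" and K: "chart_deriv d e g (f p) K"
  shows "chart_deriv c e (g \<circ> f) p (K ** J)"
proof -
  let ?D = "local_dom c d f"
  \<comment> \<open>The outer derivative is given within the half-plane; the chain rule needs it
    within the image of the inner map.\<close>
  have img: "local_rep c d f ` ?D \<subseteq> half_plane"
    using c d chart_in_half_plane[OF d] by (auto simp: local_dom_def local_rep_def)
  have at: "at (snd c p) within ?D = at (snd c p) within half_plane"
    using at_local_dom[OF c d f] p by simp
  have "(local_rep d e g has_derivative (\<lambda>h. K *v h)) (at (local_rep c d f (snd c p)) within half_plane)"
    using K by (simp add: chart_deriv_def local_rep_apply[OF c p(1)])
  then have "((\<lambda>v. local_rep d e g (local_rep c d f v)) has_derivative (\<lambda>h. K *v (J *v h)))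
      (at (snd c p) within ?D)"
  proof -
    assume "(local_rep d e g has_derivative (\<lambda>h. K *v h)) (at (local_rep c d f (snd c p)) within half_plane)"
    then have g: "(local_rep d e g has_derivative (\<lambda>h. K *v h))
        (at (local_rep c d f (snd c p)) within local_rep c d f ` ?D)"
      using img by (rule has_derivative_subset)
    have "(local_rep c d f has_derivative (\<lambda>h. J *v h)) (at (snd c p) within ?D)"
      using J by (simp add: chart_deriv_def at)
    from has_derivative_in_compose[OF this g] show ?thesis .
  qed
  then have "(local_rep c e (g \<circ> f) has_derivative (\<lambda>h. K *v (J *v h))) (at (snd c p) within ?D)"
    by (rule has_derivative_transform[rotated 2])
      (use p c d in \<open>auto simp: local_dom_def local_rep_def\<close>)
  then show ?thesis by (simp add: chart_deriv_def at matrix_vector_mul_assoc)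
qed

lemma chart_deriv_cong:
  assumes c: "is_chart X c" and U: "openin X U" "p \<in> U" "p \<in> fst c"
    and eq: "\<And>q. q \<in> U \<Longrightarrow> q \<in> fst c \<Longrightarrow> f q = g q"
    and f: "chart_deriv c d f p J"
  shows "chart_deriv c d g p J"
proof -
  let ?D = "snd c ` (fst c \<inter> U)"
  have at: "at (snd c p) within ?D = at (snd c p) within half_plane"
    by (rule at_within_half_plane[OF chart_openin_image[OF c openin_Int[OF chart_openin[OF c] U(1)]]])
      (use U in auto)
  show ?thesis
    using f unfolding chart_deriv_def at[symmetric]
    by (rule has_derivative_transform[rotated 2]) (use U c eq in \<open>auto simp: local_rep_def\<close>)
qed

lemma chart_deriv_id:
  assumes c: "is_chart X c" and p: "p \<in> fst c"
  shows "chart_deriv c c id p (mat 1)"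
proof -
  have at: "at (snd c p) within snd c ` fst c = at (snd c p) within half_plane"
    using c p by (intro at_within_half_plane) (auto simp: is_chart_def)
  show ?thesis
    unfolding chart_deriv_def at[symmetric]
    by (rule has_derivative_transform[OF _ _ has_derivative_ident[THEN has_derivative_eq_rhs]])
      (use p c in \<open>auto simp: local_rep_def\<close>)
qed

section \<open>Families of diffeomorphisms\<close>

definition overlap_family :: "'a chart \<Rightarrow> 'a chart \<Rightarrow> (real \<Rightarrow> 'a \<Rightarrow> 'a) \<Rightarrow> (real \<times> 'a) set" where
  "overlap_family c d F = {z. snd z \<in> fst c \<and> F (fst z) (snd z) \<in> fst d}"

text \<open>Value and first derivative depend jointly continuously on parameter and point. This is
  easier to compose and to glue than a path in the \<open>C1_topology\<close>, and it yields such a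
  path by \<open>C1_family_continuous_path\<close>. A single diffeomorphism is treated as a constant
  family, so that one calculus serves both.\<close>

definition C1_family :: "'a topology \<Rightarrow> 'a chart set \<Rightarrow> (real \<Rightarrow> 'a \<Rightarrow> 'a) \<Rightarrow> bool" where
  "C1_family X A F \<longleftrightarrow>
     continuous_map (prod_topology euclideanreal X) X (\<lambda>z. F (fst z) (snd z)) \<and>
     (\<forall>c\<in>A. \<forall>d\<in>A.
       (\<forall>t p. (t, p) \<in> overlap_family c d F \<longrightarrow>
          chart_deriv c d (F t) p (local_jacobian c d (F t) p) \<and>
          0 < det (local_jacobian c d (F t) p)) \<and>
       continuous_map (subtopology (prod_topology euclideanreal X) (overlap_family c d F))
         euclidean (\<lambda>z. local_jacobian c d (F (fst z)) (snd z)))"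

lemma C1_family_continuous:
  "C1_family X A F \<Longrightarrow> continuous_map (prod_topology euclideanreal X) X (\<lambda>z. F (fst z) (snd z))"
  by (simp add: C1_family_def)

lemma joint_continuous_slice:
  assumes "continuous_map (prod_topology euclideanreal X) X (\<lambda>z. F (fst z) (snd z))"
  shows "continuous_map X X (F t)"
proof -
  have "continuous_map X (prod_topology euclideanreal X) (\<lambda>p. (t, p))"
    by (simp add: continuous_map_paired)
  from continuous_map_compose[OF this assms] show ?thesis by (simp add: comp_def)
qed

lemma C1_family_slice: "C1_family X A F \<Longrightarrow> continuous_map X X (F t)"
  using joint_continuous_slice C1_family_continuous by blast

locale oriented_surface =
  fixes X :: "'a topology" and A :: "'a chart set"
  assumes surface: "compact_connected_oriented_surface X A"
begin

lemma atlas_chart: "c \<in> A \<Longrightarrow> is_chart X c"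
  using surface by (simp add: compact_connected_oriented_surface_def)

lemma chart_at: "p \<in> topspace X \<Longrightarrow> \<exists>c\<in>A. p \<in> fst c"
  using surface by (auto simp: compact_connected_oriented_surface_def)

lemma compact: "compact_space X" and connected: "connected_space X" and Hausdorff: "Hausdorff_space X"
  using surface by (auto simp: compact_connected_oriented_surface_def)

lemma transition:
  assumes "c \<in> A" "d \<in> A"
  shows "p \<in> fst c \<Longrightarrow> p \<in> fst d \<Longrightarrow> chart_deriv c d id p (local_jacobian c d id p)"
    "p \<in> fst c \<Longrightarrow> p \<in> fst d \<Longrightarrow> 0 < det (local_jacobian c d id p)"
    "continuous_map (subtopology X (fst c \<inter> fst d)) euclidean (local_jacobian c d id)"
  using surface assms
    C1_on_iff[OF atlas_chart[OF assms(1)] atlas_chart[OF assms(2)] continuous_map_id]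
  unfolding compact_connected_oriented_surface_def orientation_preserving_in_def by simp_all

lemma openin_overlap_family:
  assumes "continuous_map (prod_topology euclideanreal X) X (\<lambda>z. F (fst z) (snd z))" "c \<in> A" "d \<in> A"
  shows "openin (prod_topology euclideanreal X) (overlap_family c d F)"
proof -
  have 1: "openin (prod_topology euclideanreal X)
      {z \<in> topspace (prod_topology euclideanreal X). snd z \<in> fst c}"
    by (rule openin_continuous_map_preimage[OF continuous_map_snd chart_openin[OF atlas_chart[OF assms(2)]]])
  have 2: "openin (prod_topology euclideanreal X)
      {z \<in> topspace (prod_topology euclideanreal X). F (fst z) (snd z) \<in> fst d}"
    by (rule openin_continuous_map_preimage[OF assms(1) chart_openin[OF atlas_chart[OF assms(3)]]])
  have "overlap_family c d F = {z \<in> topspace (prod_topology euclideanreal X). snd z \<in> fst c} \<inter>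
      {z \<in> topspace (prod_topology euclideanreal X). F (fst z) (snd z) \<in> fst d}"
    using chart_subset[OF atlas_chart[OF assms(2)]] by (auto simp: overlap_family_def)
  then show ?thesis using openin_Int[OF 1 2] by simp
qed

text \<open>The derivative may be given by a different formula near each point. By uniqueness every
  formula agrees with \<open>local_jacobian\<close>, so continuity glues over an open cover.\<close>

lemma C1_familyI:
  assumes cont: "continuous_map (prod_topology euclideanreal X) X (\<lambda>z. F (fst z) (snd z))"
    and loc: "\<And>c d t p. c \<in> A \<Longrightarrow> d \<in> A \<Longrightarrow> p \<in> fst c \<Longrightarrow> F t p \<in> fst d \<Longrightarrow>
      \<exists>W J. openin (prod_topology euclideanreal X) W \<and> (t, p) \<in> W \<and>
        (\<forall>s q. (s, q) \<in> W \<inter> overlap_family c d F \<longrightarrow>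
          chart_deriv c d (F s) q (J (s, q)) \<and> 0 < det (J (s, q))) \<and>
        continuous_map (subtopology (prod_topology euclideanreal X) (W \<inter> overlap_family c d F))
          euclidean J"
  shows "C1_family X A F"
  unfolding C1_family_def
proof (intro conjI cont ballI)
  fix c d assume cd: "c \<in> A" "d \<in> A"
  let ?P = "prod_topology euclideanreal X"
  have eq: "local_jacobian c d (F s) q = J" if "(s, q) \<in> overlap_family c d F" "chart_deriv c d (F s) q J"
    for s q J
    using local_jacobian_eq[OF atlas_chart[OF cd(1)] atlas_chart[OF cd(2)] joint_continuous_slice[OF cont]]
      that by (auto simp: overlap_family_def)
  show "\<forall>t p. (t, p) \<in> overlap_family c d F \<longrightarrow>
          chart_deriv c d (F t) p (local_jacobian c d (F t) p) \<and>
          0 < det (local_jacobian c d (F t) p)"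
  proof (intro allI impI)
    fix t p assume tp: "(t, p) \<in> overlap_family c d F"
    then have "p \<in> fst c" "F t p \<in> fst d" by (auto simp: overlap_family_def)
    from loc[OF cd this] obtain J where "chart_deriv c d (F t) p J \<and> 0 < det J"
      using tp by blast
    then show "chart_deriv c d (F t) p (local_jacobian c d (F t) p) \<and> 0 < det (local_jacobian c d (F t) p)"
      using eq[OF tp, of J] by simp
  qed
  show "continuous_map (subtopology ?P (overlap_family c d F)) euclidean
      (\<lambda>z. local_jacobian c d (F (fst z)) (snd z))"
  proof (rule continuous_map_open_cover)
    fix z assume "z \<in> topspace (subtopology ?P (overlap_family c d F))"
    then have z: "(fst z, snd z) \<in> overlap_family c d F" by simp
    then have "snd z \<in> fst c" "F (fst z) (snd z) \<in> fst d" by (auto simp: overlap_family_def)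
    from loc[OF cd this] obtain W J where W: "openin ?P W" "z \<in> W"
      and J: "\<And>s q. (s, q) \<in> W \<inter> overlap_family c d F \<Longrightarrow> chart_deriv c d (F s) q (J (s, q))"
      and JC: "continuous_map (subtopology ?P (W \<inter> overlap_family c d F)) euclidean J"
      unfolding prod.collapse by blast
    have "continuous_map (subtopology (subtopology ?P (overlap_family c d F)) W) euclidean
      (\<lambda>z. local_jacobian c d (F (fst z)) (snd z))"
    proof (rule continuous_map_eq)
      show "continuous_map (subtopology (subtopology ?P (overlap_family c d F)) W) euclidean J"
        using JC by (simp add: subtopology_subtopology inf_commute)
      fix y assume "y \<in> topspace (subtopology (subtopology ?P (overlap_family c d F)) W)"
      then have "(fst y, snd y) \<in> W \<inter> overlap_family c d F" by simp
      from eq[OF _ J[OF this]] this show "J y = local_jacobian c d (F (fst y)) (snd y)" by simp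
    qed
    moreover have "openin (subtopology ?P (overlap_family c d F)) (overlap_family c d F \<inter> W)"
      using openin_subtopology_Int2[OF W(1)] by blast
    moreover have "z \<in> overlap_family c d F \<inter> W" using z W by simp
    moreover have "subtopology (subtopology ?P (overlap_family c d F)) (overlap_family c d F \<inter> W) =
      subtopology (subtopology ?P (overlap_family c d F)) W"
      by (simp add: subtopology_subtopology)
    ultimately show "\<exists>U. openin (subtopology ?P (overlap_family c d F)) U \<and> z \<in> U \<and>
      continuous_map (subtopology (subtopology ?P (overlap_family c d F)) U) euclidean
        (\<lambda>z. local_jacobian c d (F (fst z)) (snd z))"
      by (metis (no_types, lifting))
  qed
qed

lemma C1_familyD:
  assumes "C1_family X A F" "c \<in> A" "d \<in> A"
  shows "p \<in> fst c \<Longrightarrow> F t p \<in> fst d \<Longrightarrow> chart_deriv c d (F t) p (local_jacobian c d (F t) p)"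
    "p \<in> fst c \<Longrightarrow> F t p \<in> fst d \<Longrightarrow> 0 < det (local_jacobian c d (F t) p)"
    "continuous_map (subtopology (prod_topology euclideanreal X) (overlap_family c d F))
         euclidean (\<lambda>z. local_jacobian c d (F (fst z)) (snd z))"
  using assms unfolding C1_family_def overlap_family_def by auto

lemma C1_family_compose:
  assumes F: "C1_family X A F" and G: "C1_family X A G"
  shows "C1_family X A (\<lambda>t. G t \<circ> F t)"
proof (rule C1_familyI)
  let ?P = "prod_topology euclideanreal X"
  have FF: "continuous_map ?P ?P (\<lambda>z. (fst z, F (fst z) (snd z)))"
    using C1_family_continuous[OF F] by (simp add: continuous_map_paired continuous_map_fst)
  from continuous_map_compose[OF FF C1_family_continuous[OF G]]
  show "continuous_map ?P X (\<lambda>z. (G (fst z) \<circ> F (fst z)) (snd z))" by (simp add: comp_def)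
  fix c e t p assume c: "c \<in> A" and e: "e \<in> A" and p: "p \<in> fst c" "(G t \<circ> F t) p \<in> fst e"
  have pX: "p \<in> topspace X" using chart_subset[OF atlas_chart[OF c]] p by blast
  then have "F t p \<in> topspace X"
    using C1_family_slice[OF F] continuous_map_image_subset_topspace by blast
  then obtain d where d: "d \<in> A" "F t p \<in> fst d" using chart_at by blast
  \<comment> \<open>As long as \<open>F\<close> stays in the domain of \<open>d\<close>, this one
    intermediate chart serves for the chain rule.\<close>
  let ?W = "{z \<in> topspace ?P. F (fst z) (snd z) \<in> fst d}"
  let ?O = "overlap_family c e (\<lambda>t. G t \<circ> F t)"
  let ?JF = "\<lambda>z. local_jacobian c d (F (fst z)) (snd z)"
  let ?JG = "\<lambda>z. local_jacobian d e (G (fst z)) (snd z)"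
  let ?J = "\<lambda>z. ?JG (fst z, F (fst z) (snd z)) ** ?JF z"
  have "openin ?P ?W"
    by (rule openin_continuous_map_preimage[OF C1_family_continuous[OF F] chart_openin[OF atlas_chart[OF d(1)]]])
  moreover have "(t, p) \<in> ?W" using d pX by simp
  moreover have "chart_deriv c e (G s \<circ> F s) q (?J (s, q)) \<and> 0 < det (?J (s, q))"
    if "(s, q) \<in> ?W \<inter> ?O" for s q
  proof -
    have q: "q \<in> fst c" "F s q \<in> fst d" "G s (F s q) \<in> fst e"
      using that by (auto simp: overlap_family_def)
    show ?thesis
      using chart_deriv_compose[OF atlas_chart[OF c] atlas_chart[OF d(1)] C1_family_slice[OF F] q(1,2)
          C1_familyD(1)[OF F c d(1) q(1,2)] C1_familyD(1)[OF G d(1) e q(2,3)]]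
        C1_familyD(2)[OF F c d(1) q(1,2)] C1_familyD(2)[OF G d(1) e q(2,3)]
      by (simp add: det_mul)
  qed
  moreover have "continuous_map (subtopology ?P (?W \<inter> ?O)) euclidean ?J"
  proof (rule continuous_map_matrix_mult)
    show "continuous_map (subtopology ?P (?W \<inter> ?O)) euclidean ?JF"
      by (rule continuous_map_from_subtopology_mono[OF C1_familyD(3)[OF F c d(1)]])
        (auto simp: overlap_family_def)
    have "continuous_map (subtopology ?P (?W \<inter> ?O)) (subtopology ?P (overlap_family d e G))
      (\<lambda>z. (fst z, F (fst z) (snd z)))"
      unfolding continuous_map_in_subtopology
      using continuous_map_from_subtopology[OF FF, of "?W \<inter> ?O"]
      by (auto simp: overlap_family_def)
    from continuous_map_compose[OF this C1_familyD(3)[OF G d(1) e]]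
    show "continuous_map (subtopology ?P (?W \<inter> ?O)) euclidean (\<lambda>z. ?JG (fst z, F (fst z) (snd z)))"
      by (simp add: comp_def)
  qed
  ultimately show "\<exists>W J. openin ?P W \<and> (t, p) \<in> W \<and>
        (\<forall>s q. (s, q) \<in> W \<inter> ?O \<longrightarrow> chart_deriv c e (G s \<circ> F s) q (J (s, q)) \<and> 0 < det (J (s, q))) \<and>
        continuous_map (subtopology ?P (W \<inter> ?O)) euclidean J"
    by (intro exI[of _ ?W] exI[of _ ?J]) blast
qed

text \<open>Needed because \<open>compose\<close> and \<open>restrict\<close> agree with the
  unrestricted functions only on the surface.\<close>

lemma C1_family_cong:
  assumes F: "C1_family X A F" and eq: "\<And>t p. p \<in> topspace X \<Longrightarrow> F t p = G t p"
  shows "C1_family X A G"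
proof (rule C1_familyI)
  let ?P = "prod_topology euclideanreal X"
  show "continuous_map ?P X (\<lambda>z. G (fst z) (snd z))"
    by (rule continuous_map_eq[OF C1_family_continuous[OF F]]) (auto simp: eq)
  fix c d t p assume c: "c \<in> A" and d: "d \<in> A" and p: "p \<in> fst c" "G t p \<in> fst d"
  have sub: "fst c \<subseteq> topspace X" using chart_subset[OF atlas_chart[OF c]] .
  have O: "overlap_family c d G = overlap_family c d F"
    using eq sub by (force simp: overlap_family_def)
  have "chart_deriv c d (G s) q (local_jacobian c d (F s) q) \<and> 0 < det (local_jacobian c d (F s) q)"
    if "(s, q) \<in> overlap_family c d F" for s q
  proof -
    have q: "q \<in> fst c" "F s q \<in> fst d" using that by (auto simp: overlap_family_def)
    show ?thesis
      using chart_deriv_cong[OF atlas_chart[OF c] chart_openin[OF atlas_chart[OF c]] q(1) q(1) _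
          C1_familyD(1)[OF F c d q], of "G s"] eq sub C1_familyD(2)[OF F c d q] by blast
  qed
  moreover have "openin ?P (UNIV \<times> topspace X)" using openin_topspace[of ?P] by simp
  moreover have "(t, p) \<in> UNIV \<times> topspace X" using p sub by auto
  ultimately show "\<exists>W J. openin ?P W \<and> (t, p) \<in> W \<and>
      (\<forall>s q. (s, q) \<in> W \<inter> overlap_family c d G \<longrightarrow>
        chart_deriv c d (G s) q (J (s, q)) \<and> 0 < det (J (s, q))) \<and>
      continuous_map (subtopology ?P (W \<inter> overlap_family c d G)) euclidean J"
    unfolding O
    using continuous_map_from_subtopology_mono[OF C1_familyD(3)[OF F c d] Int_lower2, of "UNIV \<times> topspace X"]
    by (intro exI[of _ "UNIV \<times> topspace X"] exI[of _ "\<lambda>z. local_jacobian c d (F (fst z)) (snd z)"])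
      simp
qed

lemma continuous_const_family:
  "continuous_map X X f \<Longrightarrow> continuous_map (prod_topology euclideanreal X) X (\<lambda>z. f (snd z))"
  using continuous_map_compose[OF continuous_map_snd, of X X f euclideanreal] by (simp add: comp_def)

lemma C1_family_const:
  assumes f: "continuous_map X X f"
    and C1: "\<And>c d. c \<in> A \<Longrightarrow> d \<in> A \<Longrightarrow> C1_on (local_dom c d f) (local_rep c d f)"
    and det: "\<And>c d p. c \<in> A \<Longrightarrow> d \<in> A \<Longrightarrow> p \<in> fst c \<Longrightarrow> f p \<in> fst d \<Longrightarrow> 0 < det (local_jacobian c d f p)"
  shows "C1_family X A (\<lambda>_. f)"
  unfolding C1_family_def
proof (intro conjI ballI allI impI)
  show "continuous_map (prod_topology euclideanreal X) X (\<lambda>z. f (snd z))"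
    by (rule continuous_const_family[OF f])
  fix c d assume cd: "c \<in> A" "d \<in> A"
  note * = C1_on_iff[OF atlas_chart[OF cd(1)] atlas_chart[OF cd(2)] f, THEN iffD1, OF C1[OF cd]]
  show "chart_deriv c d f p (local_jacobian c d f p)" if "(t, p) \<in> overlap_family c d (\<lambda>_. f)" for t :: real and p
    using * that by (simp add: overlap_family_def)
  show "0 < det (local_jacobian c d f p)" if "(t, p) \<in> overlap_family c d (\<lambda>_. f)" for t :: real and p
    using det[OF cd] that by (simp add: overlap_family_def)
  have "continuous_map (subtopology (prod_topology euclideanreal X) (overlap_family c d (\<lambda>_. f)))
      (subtopology X (fst c \<inter> f -` fst d)) snd"
    unfolding continuous_map_in_subtopology
    using continuous_map_from_subtopology[OF continuous_map_snd] by (auto simp: overlap_family_def)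
  from continuous_map_compose[OF this *[THEN conjunct2]]
  show "continuous_map (subtopology (prod_topology euclideanreal X) (overlap_family c d (\<lambda>_. f)))
      euclidean (\<lambda>z. local_jacobian c d f (snd z))" by (simp add: comp_def)
qed

lemma C1_family_id: "C1_family X A (\<lambda>_. id)"
  using surface
  by (intro C1_family_const) (auto simp: compact_connected_oriented_surface_def orientation_preserving_in_def)

lemma C1_map_of_family:
  assumes F: "C1_family X A (\<lambda>_. f)"
  shows "C1_map X A f"
  unfolding C1_map_def
proof (intro conjI ballI)
  show f: "continuous_map X X f" using C1_family_slice[OF F] .
  fix c d assume cd: "c \<in> A" "d \<in> A"
  have "continuous_map (subtopology X (fst c \<inter> f -` fst d))
    (subtopology (prod_topology euclideanreal X) (overlap_family c d (\<lambda>_. f))) (\<lambda>p. (0, p))"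
    unfolding continuous_map_in_subtopology
    by (auto simp: overlap_family_def continuous_map_paired continuous_map_from_subtopology)
  from continuous_map_compose[OF this C1_familyD(3)[OF F cd]]
  have "continuous_map (subtopology X (fst c \<inter> f -` fst d)) euclidean (local_jacobian c d f)"
    by (simp add: comp_def)
  then show "C1_on (local_dom c d f) (local_rep c d f)"
    unfolding C1_on_iff[OF atlas_chart[OF cd(1)] atlas_chart[OF cd(2)] f]
    using C1_familyD(1)[OF F cd] by blast
qed

section \<open>Closure properties of the diffeomorphism groups\<close>

lemma Bij_apply: "f \<in> Bij S \<Longrightarrow> p \<in> S \<Longrightarrow> f p \<in> S"
  by (auto simp: Bij_def bij_betw_def)

lemma Bij_inv:
  assumes "f \<in> Bij S" "p \<in> S"
  shows "inv_into S f (f p) = p" "f (inv_into S f p) = p" "inv_into S f p \<in> S"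
  using assms by (auto simp: Bij_def bij_betw_def f_inv_into_f inv_into_into)

lemma Diff_Bij: "f \<in> Diff X A \<Longrightarrow> f \<in> Bij (topspace X)" by (simp add: Diff_def)

text \<open>A left inverse of a bijection agrees on the surface with \<open>inv_into\<close>, so
  regularity of the explicit \<open>g\<close> is enough.\<close>

lemma DiffI:
  assumes f: "f \<in> Bij (topspace X)" and F: "C1_family X A (\<lambda>_. f)" and G: "C1_family X A (\<lambda>_. g)"
    and gf: "\<And>p. p \<in> topspace X \<Longrightarrow> g (f p) = p"
  shows "f \<in> Diff X A"
proof -
  have "g p = inv_into (topspace X) f p" if "p \<in> topspace X" for p
    using gf[of "inv_into (topspace X) f p"] Bij_inv[OF f that] by simp
  then have "C1_family X A (\<lambda>_. inv_into (topspace X) f)" by (rule C1_family_cong[OF G])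
  then show ?thesis
    using f C1_map_of_family[OF F] C1_map_of_family[of "inv_into (topspace X) f"] C1_familyD(2)[OF F]
    unfolding Diff_def orientation_preserving_in_def by blast
qed

lemma Diff_family: "f \<in> Diff X A \<Longrightarrow> C1_family X A (\<lambda>_. f)"
  by (intro C1_family_const) (auto simp: Diff_def C1_map_def orientation_preserving_in_def)

text \<open>\<open>Diff\<close> demands regularity of the inverse but states the sign of the
  determinant for \<open>f\<close> alone. The chain rule at \<open>p\<close> shows that the two
  determinants multiply to 1.\<close>

lemma Diff_inv_family:
  assumes f: "f \<in> Diff X A"
  shows "C1_family X A (\<lambda>_. inv_into (topspace X) f)"
proof (rule C1_family_const)
  let ?g = "inv_into (topspace X) f"
  have g: "C1_map X A ?g" using f by (simp add: Diff_def)
  then show gc: "continuous_map X X ?g" by (simp add: C1_map_def)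
  have C1: "C1_on (local_dom c d ?g) (local_rep c d ?g)" if "c \<in> A" "d \<in> A" for c d
    using g that by (simp add: C1_map_def)
  then show "\<And>c d. c \<in> A \<Longrightarrow> d \<in> A \<Longrightarrow> C1_on (local_dom c d ?g) (local_rep c d ?g)" .
  fix c d p assume c: "c \<in> A" and d: "d \<in> A" and p: "p \<in> fst c" "?g p \<in> fst d"
  have sub: "fst c \<subseteq> topspace X" using chart_subset[OF atlas_chart[OF c]] .
  have fg: "f (?g q) = q" if "q \<in> fst c" for q using Bij_inv(2)[OF Diff_Bij[OF f]] sub that by blast
  have K: "chart_deriv c d ?g p (local_jacobian c d ?g p)"
    using C1_on_iff[OF atlas_chart[OF c] atlas_chart[OF d] gc] C1[OF c d] p by blast
  have "f (?g p) \<in> fst c" using fg p by simp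
  then have J: "chart_deriv d c f (?g p) (local_jacobian d c f (?g p))"
    "0 < det (local_jacobian d c f (?g p))"
    using C1_familyD(1,2)[OF Diff_family[OF f] d c p(2)] by auto
  have "chart_deriv c c (f \<circ> ?g) p (local_jacobian d c f (?g p) ** local_jacobian c d ?g p)"
    by (rule chart_deriv_compose[OF atlas_chart[OF c] atlas_chart[OF d] gc p K J(1)])
  then have "chart_deriv c c id p (local_jacobian d c f (?g p) ** local_jacobian c d ?g p)"
    by (rule chart_deriv_cong[OF atlas_chart[OF c] chart_openin[OF atlas_chart[OF c]] p(1) p(1), rotated])
      (simp add: fg)
  then have "local_jacobian d c f (?g p) ** local_jacobian c d ?g p = mat 1"
    by (rule chart_deriv_unique[OF atlas_chart[OF c] p(1) _ chart_deriv_id[OF atlas_chart[OF c] p(1)]])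
  then have "det (local_jacobian d c f (?g p)) * det (local_jacobian c d ?g p) = 1"
    by (metis det_mul det_I)
  then show "0 < det (local_jacobian c d ?g p)"
    using J(2) by (metis zero_less_mult_pos zero_less_one)
qed

lemma Diff_compose:
  assumes f: "f \<in> Diff X A" and g: "g \<in> Diff X A"
  shows "compose (topspace X) g f \<in> Diff X A"
proof (rule DiffI)
  let ?i = "inv_into (topspace X)"
  show "compose (topspace X) g f \<in> Bij (topspace X)"
    using compose_Bij[OF Diff_Bij[OF g] Diff_Bij[OF f]] .
  show "C1_family X A (\<lambda>_. compose (topspace X) g f)"
    by (rule C1_family_cong[OF C1_family_compose[OF Diff_family[OF f] Diff_family[OF g]]])
      (simp add: compose_def)
  show "C1_family X A (\<lambda>_. ?i f \<circ> ?i g)"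
    by (rule C1_family_compose[OF Diff_inv_family[OF g] Diff_inv_family[OF f]])
  show "(?i f \<circ> ?i g) (compose (topspace X) g f p) = p" if "p \<in> topspace X" for p
    using that Bij_inv(1)[OF Diff_Bij[OF g] Bij_apply[OF Diff_Bij[OF f] that]]
      Bij_inv(1)[OF Diff_Bij[OF f] that] by (simp add: compose_def)
qed

lemma Diff_inverse:
  assumes f: "f \<in> Diff X A"
  shows "restrict (inv_into (topspace X) f) (topspace X) \<in> Diff X A"
proof (rule DiffI)
  show "restrict (inv_into (topspace X) f) (topspace X) \<in> Bij (topspace X)"
    by (rule restrict_inv_into_Bij[OF Diff_Bij[OF f]])
  show "C1_family X A (\<lambda>_. restrict (inv_into (topspace X) f) (topspace X))"
    by (rule C1_family_cong[OF Diff_inv_family[OF f]]) simp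
  show "C1_family X A (\<lambda>_. f)" by (rule Diff_family[OF f])
  show "f (restrict (inv_into (topspace X) f) (topspace X) p) = p" if "p \<in> topspace X" for p
    using Bij_inv(2)[OF Diff_Bij[OF f] that] that by simp
qed

lemma surface_boundary_subset: "surface_boundary X A \<subseteq> topspace X"
  by (auto simp: surface_boundary_def)

lemma Diff_rel_compose:
  assumes "f \<in> Diff_rel X A" "g \<in> Diff_rel X A"
  shows "compose (topspace X) g f \<in> Diff_rel X A"
  using assms Diff_compose surface_boundary_subset unfolding Diff_rel_def compose_def
  by (auto simp: subset_iff)

lemma Diff_rel_inverse:
  assumes "f \<in> Diff_rel X A"
  shows "restrict (inv_into (topspace X) f) (topspace X) \<in> Diff_rel X A"
proof -
  have f: "f \<in> Diff X A" "\<And>p. p \<in> surface_boundary X A \<Longrightarrow> f p = p"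
    using assms by (auto simp: Diff_rel_def)
  have "restrict (inv_into (topspace X) f) (topspace X) p = p" if "p \<in> surface_boundary X A" for p
    using Bij_inv(1)[OF Diff_Bij[OF f(1)], of p] f(2)[OF that] surface_boundary_subset that by auto
  then show ?thesis using Diff_inverse[OF f(1)] by (simp add: Diff_rel_def)
qed

lemma Diff_id: "restrict id (topspace X) \<in> Diff X A"
  by (rule DiffI[OF _ C1_family_cong[OF C1_family_id] C1_family_id])
    (auto simp: id_Bij id_def)

lemma Diff_rel_id: "restrict id (topspace X) \<in> Diff_rel X A"
  using Diff_id surface_boundary_subset by (auto simp: Diff_rel_def)

text \<open>It suffices to treat the generating sets. Closeness over a compact set is an open
  condition on pairs of parameter and point, and the tube lemma makes it open in the
  parameter.\<close>

lemma C1_family_continuous_path: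
  assumes F: "C1_family X A F" and D: "\<And>t. F t \<in> Diff X A" and ne: "topspace X \<noteq> {}"
  shows "continuous_map euclideanreal (C1_topology X A) F"
  unfolding C1_topology_def
proof (rule continuous_on_generated_topo)
  let ?P = "prod_topology euclideanreal X"
  let ?B = "{C1_nhd X A c d f K \<epsilon> |c d f K \<epsilon>.
      c \<in> A \<and> d \<in> A \<and> f \<in> Diff X A \<and> compactin X K \<and> K \<subseteq> fst c \<and> f ` K \<subseteq> fst d \<and> 0 < \<epsilon>}"
  obtain c0 where c0: "c0 \<in> A" using ne chart_at by blast
  \<comment> \<open>A generated topology lives on the union of its generators. The generator with
    empty \<open>K\<close> contains all diffeomorphisms; a chart for it exists because the surface
    is nonempty.\<close>
  have "F t \<in> \<Union> ?B" for t
  proof (rule UnionI)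
    have "c0 \<in> A \<and> c0 \<in> A \<and> F t \<in> Diff X A \<and> compactin X {} \<and> {} \<subseteq> fst c0 \<and> F t ` {} \<subseteq> fst c0 \<and> (0::real) < 1"
      using c0 D by simp
    then show "C1_nhd X A c0 c0 (F t) {} 1 \<in> ?B" by blast
    show "F t \<in> C1_nhd X A c0 c0 (F t) {} 1" using D by (simp add: C1_nhd_def)
  qed
  then show "F ` topspace euclideanreal \<subseteq> \<Union> ?B" by (rule image_subsetI)
  fix U assume "U \<in> ?B"
  then obtain c d f K \<epsilon> where U: "U = C1_nhd X A c d f K \<epsilon>" and c: "c \<in> A" and d: "d \<in> A"
    and f: "f \<in> Diff X A" and K: "compactin X K" "K \<subseteq> fst c" "f ` K \<subseteq> fst d" and e: "0 < \<epsilon>"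
    by blast
  let ?O = "overlap_family c d F \<inter> overlap_family c d (\<lambda>_. f)"
  have Oo: "openin ?P ?O"
    by (rule openin_Int[OF openin_overlap_family[OF C1_family_continuous[OF F] c d]
      openin_overlap_family[OF C1_family_continuous[OF Diff_family[OF f]] c d]])
  have OX: "?O \<subseteq> topspace ?P" by (rule openin_subset[OF Oo])
  have tO: "topspace (subtopology ?P ?O) = ?O" using OX by auto
  have co: "continuous_map (subtopology ?P ?O) euclidean (\<lambda>z. snd d (G (fst z) (snd z)))"
    if G: "C1_family X A G" "?O \<subseteq> overlap_family c d G" for G
  proof -
    have "continuous_map (subtopology ?P ?O) (subtopology X (fst d)) (\<lambda>z. G (fst z) (snd z))"
      unfolding continuous_map_in_subtopology
      using continuous_map_from_subtopology[OF C1_family_continuous[OF G(1)], of ?O] G(2)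
      by (auto simp: overlap_family_def)
    from continuous_map_compose[OF this chart_continuous[OF atlas_chart[OF d]]]
    show ?thesis by (simp add: comp_def)
  qed
  have cj: "continuous_map (subtopology ?P ?O) euclidean (\<lambda>z. local_jacobian c d (G (fst z)) (snd z))"
    if G: "C1_family X A G" "?O \<subseteq> overlap_family c d G" for G
    by (rule continuous_map_from_subtopology_mono[OF C1_familyD(3)[OF G(1) c d] G(2)])
  let ?d1 = "\<lambda>z. dist (snd d (F (fst z) (snd z))) (snd d (f (snd z)))"
  let ?d2 = "\<lambda>z. dist (local_jacobian c d (F (fst z)) (snd z)) (local_jacobian c d f (snd z))"
  have cd: "continuous_map (subtopology ?P ?O) euclideanreal ?d1"
    "continuous_map (subtopology ?P ?O) euclideanreal ?d2"
    using co[OF F] co[OF Diff_family[OF f]] cj[OF F] cj[OF Diff_family[OF f]]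
    unfolding continuous_map_atin limitin_canonical_iff by (auto intro!: tendsto_dist)
  define W where "W = {z \<in> ?O. ?d1 z < \<epsilon>} \<inter> {z \<in> ?O. ?d2 z < \<epsilon>}"
  have "openin (subtopology ?P ?O) W"
    unfolding W_def
  proof (rule openin_Int)
    show "openin (subtopology ?P ?O) {z \<in> ?O. ?d1 z < \<epsilon>}"
      using openin_continuous_map_preimage[OF cd(1), of "{..<\<epsilon>}"] unfolding tO lessThan_iff by simp
    show "openin (subtopology ?P ?O) {z \<in> ?O. ?d2 z < \<epsilon>}"
      using openin_continuous_map_preimage[OF cd(2), of "{..<\<epsilon>}"] unfolding tO lessThan_iff by simp
  qed
  then have W: "openin ?P W" using Oo by (simp add: openin_open_subtopology)
  have iff: "F t \<in> U \<longleftrightarrow> {t} \<times> K \<subseteq> W" for t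
    using K D by (auto simp: U C1_nhd_def W_def overlap_family_def)
  have "\<exists>T. open T \<and> t \<in> T \<and> T \<subseteq> F -` U" if "F t \<in> U" for t
  proof -
    obtain T where T: "openin euclideanreal T" "t \<in> T" "T \<times> K \<subseteq> W"
      using tube_open[OF W K(1), of t] \<open>F t \<in> U\<close> unfolding iff by auto
    then have "T \<subseteq> F -` U" using iff by blast
    then show ?thesis using T by auto
  qed
  then have "open (F -` U)" by (subst open_subopen) (simp only: vimage_eq ball_simps Ball_def, blast)
  then show "openin euclideanreal (F -` U \<inter> topspace euclideanreal)" by simp
qed

end

section \<open>Rigidity of braid group actions with a fixed point\<close>

text \<open>The crude factor 2 counts coordinates. It is the reason why Jacobians are kept within
  1/200 of the identity to obtain the Lipschitz constant 1/100.\<close>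

lemma norm_matrix_vector_le: "norm (M *v h) \<le> 2 * norm M * norm h" for M :: "real^2^2"
proof -
  have "norm (M *v h) \<le> (\<Sum>i\<in>UNIV. \<bar>(M *v h) $ i\<bar>)" by (rule norm_le_l1_cart)
  also have "\<dots> \<le> (\<Sum>i\<in>(UNIV::2 set). norm M * norm h)"
  proof (rule sum_mono)
    fix i
    have "\<bar>(M *v h) $ i\<bar> \<le> norm (M $ i) * norm h"
      by (simp add: matrix_vector_mul_component Cauchy_Schwarz_ineq2)
    also have "\<dots> \<le> norm M * norm h"
      using Finite_Cartesian_Product.norm_nth_le[of M i] by (simp add: mult_right_mono)
    finally show "\<bar>(M *v h) $ i\<bar> \<le> norm M * norm h" .
  qed
  finally show ?thesis by (simp add: sum_2)
qed

text \<open>Mean value inequality for \<open>f v - v\<close>, whose derivative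
  \<open>J v - mat 1\<close> is small; this is where convexity of \<open>B\<close> enters.\<close>

lemma displacement_lipschitz:
  fixes f :: "real^2 \<Rightarrow> real^2"
  assumes B: "convex B" "x \<in> B" "y \<in> B"
    and f: "\<And>v. v \<in> B \<Longrightarrow> (f has_derivative (\<lambda>h. J v *v h)) (at v within B)"
    and J: "\<And>v. v \<in> B \<Longrightarrow> dist (J v) (mat 1) < 1/200"
  shows "norm ((f x - x) - (f y - y)) \<le> 1/100 * norm (x - y)"
proof -
  have "norm ((\<lambda>v. f v - v) x - (\<lambda>v. f v - v) y) \<le> 1/100 * norm (x - y)"
  proof (rule differentiable_bound[OF B(1) _ _ B(2,3)])
    fix v assume v: "v \<in> B"
    show "((\<lambda>v. f v - v) has_derivative (\<lambda>h. J v *v h - h)) (at v within B)"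
      by (rule has_derivative_diff[OF f[OF v] has_derivative_ident])
    show "onorm (\<lambda>h. J v *v h - h) \<le> 1/100"
    proof (rule onorm_le)
      fix h
      have "norm (J v *v h - h) = norm ((J v - mat 1) *v h)"
        by (simp add: matrix_vector_mult_diff_rdistrib)
      also have "\<dots> \<le> 2 * norm (J v - mat 1) * norm h" by (rule norm_matrix_vector_le)
      also have "\<dots> \<le> 1/100 * norm h"
        using J[OF v] by (intro mult_right_mono) (auto simp: dist_norm)
      finally show "norm (J v *v h - h) \<le> 1/100 * norm h" .
    qed
  qed
  then show ?thesis by simp
qed

context oriented_surface
begin

lemma Diff_continuous: "f \<in> Diff X A \<Longrightarrow> continuous_map X X f"
  by (simp add: Diff_def C1_map_def)

lemma Diff_chart_deriv:
  assumes "f \<in> Diff X A" "c \<in> A" "d \<in> A" "p \<in> fst c" "f p \<in> fst d"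
  shows "chart_deriv c d f p (local_jacobian c d f p)" "0 < det (local_jacobian c d f p)"
  using C1_familyD(1,2)[OF Diff_family[OF assms(1)] assms(2-5)] by simp_all

lemma Diff_jacobian_continuous:
  assumes f: "f \<in> Diff X A" and c: "c \<in> A" "d \<in> A"
  shows "continuous_map (subtopology X (fst c \<inter> f -` fst d)) euclidean (local_jacobian c d f)"
  using C1_on_iff[OF atlas_chart[OF c(1)] atlas_chart[OF c(2)] Diff_continuous[OF f]] f c
  by (simp add: Diff_def C1_map_def)

lemma Diff_local_jacobian_eq:
  assumes "f \<in> Diff X A" "c \<in> A" "p \<in> fst c" "f p \<in> fst c" "chart_deriv c c f p J"
  shows "local_jacobian c c f p = J"
  using local_jacobian_eq[OF atlas_chart[OF assms(2)] atlas_chart[OF assms(2)]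
      Diff_continuous[OF assms(1)] _ assms(5)] assms(3,4) by simp

lemma local_jacobian_compose_fixed:
  assumes f: "f \<in> Diff X A" "g \<in> Diff X A" and c: "c \<in> A" "z \<in> fst c"
    and fx: "f z = z" "g z = z"
  shows "local_jacobian c c (compose (topspace X) g f) z = local_jacobian c c g z ** local_jacobian c c f z"
proof (rule Diff_local_jacobian_eq[OF Diff_compose[OF f] c])
  have sub: "fst c \<subseteq> topspace X" using chart_subset[OF atlas_chart[OF c(1)]] .
  then show "compose (topspace X) g f z \<in> fst c" using c(2) fx by (auto simp: compose_def)
  have "chart_deriv c c (g \<circ> f) z (local_jacobian c c g z ** local_jacobian c c f z)"
    by (rule chart_deriv_compose[OF atlas_chart[OF c(1)] atlas_chart[OF c(1)] Diff_continuous[OF f(1)] c(2) _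
          Diff_chart_deriv(1)[OF f(1) c(1) c(1) c(2)]])
      (use fx c Diff_chart_deriv(1)[OF f(2) c(1) c(1) c(2)] in simp_all)
  then show "chart_deriv c c (compose (topspace X) g f) z (local_jacobian c c g z ** local_jacobian c c f z)"
    by (rule chart_deriv_cong[OF atlas_chart[OF c(1)] chart_openin[OF atlas_chart[OF c(1)]] c(2) c(2), rotated])
      (use sub in \<open>auto simp: compose_def\<close>)
qed

text \<open>The identities that the quotients of five generators satisfy, with \<open>u i j\<close>
  for the generator \<open>i\<close> times the inverse of the generator \<open>j\<close>. They are
  stated at points of the surface so that they can be read in a chart.\<close>

definition quotient_system :: "(nat \<Rightarrow> nat \<Rightarrow> 'a \<Rightarrow> 'a) \<Rightarrow> bool" where
  "quotient_system u \<longleftrightarrow>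
     (\<forall>i<5. \<forall>j<5. u i j \<in> Diff X A) \<and>
     (\<forall>i<5. \<forall>p\<in>topspace X. u i i p = p) \<and>
     (\<forall>i<5. \<forall>j<5. \<forall>k<5. \<forall>p\<in>topspace X. u i j (u j k p) = u i k p) \<and>
     (\<forall>(i,j,k)\<in>braid_edges. \<forall>p\<in>topspace X.
        u i k (u j k (u i k p)) = u j k (u i k (u j k p)))"

text \<open>By continuity of the Jacobians, all displacements in the chart are nearly constant
  around \<open>z\<close>, so \<open>displacement_trivial\<close> applies at every nearby
  point.\<close>

lemma quotient_system_local:
  assumes u: "quotient_system u" and c: "c \<in> A" "z \<in> fst c"
    and fx: "\<And>i j. i < 5 \<Longrightarrow> j < 5 \<Longrightarrow> u i j z = z"
    and jac: "\<And>i j. i < 5 \<Longrightarrow> j < 5 \<Longrightarrow> local_jacobian c c (u i j) z = mat 1"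
  shows "\<exists>U. openin X U \<and> z \<in> U \<and> (\<forall>p\<in>U. \<forall>i<5. \<forall>j<5. u i j p = p)"
proof -
  have ch: "is_chart X c" by (rule atlas_chart[OF c(1)])
  have sub: "fst c \<subseteq> topspace X" using chart_subset[OF ch] .
  have D: "u i j \<in> Diff X A" if "i < 5" "j < 5" for i j using u that by (simp add: quotient_system_def)
  let ?I = "{..<5::nat} \<times> {..<5::nat}"
  let ?J = "\<lambda>i j. local_jacobian c c (u i j)"
  define V where "V = (\<lambda>(i,j). {p \<in> fst c \<inter> u i j -` fst c. dist (?J i j p) (mat 1) < 1/200})"
  have V: "openin X (V (i,j))" "z \<in> V (i,j)" if ij: "i < 5" "j < 5" for i j
  proof -
    let ?O = "fst c \<inter> u i j -` fst c"
    have O: "openin X ?O"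
      by (rule openin_overlap[OF Diff_continuous[OF D[OF ij]] chart_openin[OF ch] chart_openin[OF ch]])
    have t: "topspace (subtopology X ?O) = ?O" using openin_subset[OF O] by auto
    have "openin (subtopology X ?O) {p \<in> ?O. ?J i j p \<in> ball (mat 1) (1/200)}"
      using openin_continuous_map_preimage[OF Diff_jacobian_continuous[OF D[OF ij] c(1) c(1)], of "ball (mat 1) (1/200)"]
      unfolding t by simp
    then have "openin X {p \<in> ?O. ?J i j p \<in> ball (mat 1) (1/200)}" using O by (simp add: openin_open_subtopology)
    moreover have "V (i,j) = {p \<in> ?O. ?J i j p \<in> ball (mat 1) (1/200)}"
      by (auto simp: V_def dist_commute)
    ultimately show "openin X (V (i,j))" by simp
    show "z \<in> V (i,j)" using fx[OF ij] jac[OF ij] c(2) by (simp add: V_def)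
  qed
  define V0 where "V0 = fst c \<inter> (\<Inter>e\<in>?I. V e)"
  have V0: "openin X V0" "z \<in> V0"
  proof -
    have "openin X (\<Inter>e\<in>?I. V e)"
      by (rule openin_Inter) (use V in \<open>auto simp: lessThan_empty_iff\<close>)
    then show "openin X V0" unfolding V0_def using chart_openin[OF ch] by (rule openin_Int[rotated])
    have "z \<in> V e" if "e \<in> ?I" for e using V(2)[of "fst e" "snd e"] that by (simp add: mem_Times_iff)
    then show "z \<in> V0" using c(2) unfolding V0_def by blast
  qed
  have "openin (top_of_set half_plane) (snd c ` V0)"
    by (rule chart_openin_image[OF ch V0(1)]) (simp add: V0_def)
  then obtain r where r: "r > 0" "ball (snd c z) r \<inter> half_plane \<subseteq> snd c ` V0"
    using V0(2) unfolding openin_contains_ball by blast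
  \<comment> \<open>At a boundary point this cuts off part of the disc, but it remains
    convex.\<close>
  define B where "B = ball (snd c z) r \<inter> half_plane"
  have Bc: "convex B"
    unfolding B_def half_plane_def
    by (intro convex_Int convex_ball) (simp add: convex_def)
  define N where "N = {p \<in> fst c. snd c p \<in> ball (snd c z) r}"
  have N: "openin X N" "z \<in> N" using chart_openin_preimage[OF ch open_ball] r(1) c(2) by (simp_all add: N_def)
  have NB: "snd c p \<in> B" "p \<in> fst c" if "p \<in> N" for p
    using that chart_in_half_plane[OF ch] by (auto simp: N_def B_def)
  have inN: "openin X {p \<in> topspace X. f p \<in> N}" if "f \<in> Diff X A" for f
    by (rule openin_continuous_map_preimage[OF Diff_continuous[OF that] N(1)])
  \<comment> \<open>\<open>displacement_trivial\<close> evaluates the maps after up to two letters.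
    The neighbourhood is therefore shrunk twice: one letter leads from \<open>U\<close> into
    \<open>N1\<close>, a second one into \<open>N\<close>.\<close>
  define N1 where "N1 = N \<inter> (\<Inter>(i,j)\<in>?I. {p \<in> topspace X. u i j p \<in> N})"
  have N1: "openin X N1" "z \<in> N1" "N1 \<subseteq> N"
  proof -
    have "openin X (\<Inter>(i,j)\<in>?I. {p \<in> topspace X. u i j p \<in> N})"
      by (rule openin_Inter) (use inN D in \<open>auto simp: lessThan_empty_iff\<close>)
    then show "openin X N1" unfolding N1_def by (rule openin_Int[OF N(1)])
    show "z \<in> N1" using N fx c(2) sub by (auto simp: N1_def)
  qed (auto simp: N1_def)
  define U where "U = N1 \<inter> (\<Inter>(i,j)\<in>?I. {p \<in> topspace X. u i j p \<in> N1})"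
  have U: "openin X U" "z \<in> U"
  proof -
    have "openin X {p \<in> topspace X. f p \<in> N1}" if "f \<in> Diff X A" for f
      by (rule openin_continuous_map_preimage[OF Diff_continuous[OF that] N1(1)])
    then have "openin X (\<Inter>(i,j)\<in>?I. {p \<in> topspace X. u i j p \<in> N1})"
      by (intro openin_Inter) (use D in \<open>auto simp: lessThan_empty_iff\<close>)
    then show "openin X U" unfolding U_def by (rule openin_Int[OF N1(1)])
    show "z \<in> U" using N1 fx c(2) sub by (auto simp: U_def)
  qed
  have "u i j p = p" if p: "p \<in> U" and ij: "i < 5" "j < 5" for p i j
  proof -
    let ?U = "\<lambda>i j. local_rep c c (u i j)"
    have rep: "?U i j (snd c q) = snd c (u i j q)" if "q \<in> fst c" for i j q
      by (rule local_rep_apply[OF ch that])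
    have pN: "p \<in> N" "p \<in> N1" using p N1 by (auto simp: U_def)
    have p1: "u i j p \<in> N" "u i j p \<in> N1" if "i < 5" "j < 5" for i j
      using p that N1 by (auto simp: U_def)
    have p2: "u i j (u k l p) \<in> N" if "i < 5" "j < 5" "k < 5" "l < 5" for i j k l
      using p1(2)[OF that(3,4)] that(1,2) by (auto simp: N1_def)
    have pX: "p \<in> topspace X" using NB(2)[OF pN(1)] sub by blast
    have "?U i j (snd c p) = snd c p"
    proof (rule displacement_trivial[of B ?U "snd c p", OF _ _ _ _ _ _ _ ij])
      fix i j :: nat and y y' assume ij: "i < 5" "j < 5" and y: "y \<in> B" "y' \<in> B"
      show "norm (?U i j y - y - (?U i j y' - y')) \<le> 1/100 * norm (y - y')"
      proof (rule displacement_lipschitz[OF Bc y, of "?U i j" "\<lambda>v. ?J i j (inv_into (fst c) (snd c) v)"])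
        fix v assume "v \<in> B"
        then have "v \<in> snd c ` V0" using r(2) by (auto simp: B_def)
        then obtain q where q: "q \<in> V0" "v = snd c q" by blast
        then have q': "q \<in> V (i,j)" "q \<in> fst c" using ij by (auto simp: V0_def)
        then have qf: "u i j q \<in> fst c" and qd: "dist (?J i j q) (mat 1) < 1/200" by (auto simp: V_def)
        have i: "inv_into (fst c) (snd c) v = q" using q q' chart_inv[OF ch] by simp
        show "dist (?J i j (inv_into (fst c) (snd c) v)) (mat 1) < 1/200" using qd i by simp
        have "chart_deriv c c (u i j) q (?J i j q)"
          by (rule Diff_chart_deriv(1)[OF D[OF ij] c(1) c(1) q'(2) qf])
        then have "(?U i j has_derivative (\<lambda>h. ?J i j q *v h)) (at v within B)"
          unfolding chart_deriv_def q(2) by (rule has_derivative_subset) (simp add: B_def)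
        then show "(?U i j has_derivative (\<lambda>h. ?J i j (inv_into (fst c) (snd c) v) *v h)) (at v within B)"
          by (simp only: i)
      qed
    next
      show "snd c p \<in> B" by (rule NB(1)[OF pN(1)])
      show "?U i j (snd c p) \<in> B" if "i < 5" "j < 5" for i j
        unfolding rep[OF NB(2)[OF pN(1)]] by (rule NB(1)[OF p1(1)[OF that]])
      show "?U i j (?U k l (snd c p)) \<in> B" if "i < 5" "j < 5" "k < 5" "l < 5" for i j k l
        unfolding rep[OF NB(2)[OF pN(1)]] rep[OF NB(2)[OF p1(1)[OF that(3,4)]]] by (rule NB(1)[OF p2[OF that]])
      show "?U i i (snd c p) = snd c p" if "i < 5" for i
        using u that pX rep[OF NB(2)[OF pN(1)]] by (simp add: quotient_system_def)
      show "?U i j (?U j k (snd c p)) = ?U i k (snd c p)" if "i < 5" "j < 5" "k < 5" for i j k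
        unfolding rep[OF NB(2)[OF pN(1)]] rep[OF NB(2)[OF p1(1)[OF that(2,3)]]]
        using u that pX by (simp add: quotient_system_def)
      show "?U i k (?U j k (?U i k (snd c p))) = ?U j k (?U i k (?U j k (snd c p)))"
        if e: "(i,j,k) \<in> braid_edges" for i j k
      proof -
        have lt: "i < 5" "j < 5" "k < 5" using e by (auto simp: braid_edges_def)
        have "u i k (u j k (u i k p)) = u j k (u i k (u j k p))"
          using u e pX unfolding quotient_system_def by blast
        then show ?thesis
          using rep[OF NB(2)[OF pN(1)]] rep[OF NB(2)[OF p1(1)]] rep[OF NB(2)[OF p2]] lt by simp
      qed
    qed
    then have "snd c (u i j p) = snd c p" using rep[OF NB(2)[OF pN(1)]] by simp
    then show ?thesis using inj_onD[OF chart_inj[OF ch]] NB(2)[OF p1(1)[OF ij]] NB(2)[OF pN(1)] by blast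
  qed
  then show ?thesis using U by blast
qed

text \<open>The local result starts an open set of common fixed points at \<open>z\<close>; applied
  again at the limit points of this set, it shows that the set is closed, and connectedness
  finishes.\<close>

lemma quotient_system_trivial:
  assumes u: "quotient_system u" and c: "c \<in> A" "z \<in> fst c"
    and fx: "\<And>i j. i < 5 \<Longrightarrow> j < 5 \<Longrightarrow> u i j z = z"
    and jac: "\<And>i j. i < 5 \<Longrightarrow> j < 5 \<Longrightarrow> local_jacobian c c (u i j) z = mat 1"
    and p: "p \<in> topspace X" and ij: "i < 5" "j < 5"
  shows "u i j p = p"
proof -
  have D: "u i j \<in> Diff X A" if "i < 5" "j < 5" for i j using u that by (simp add: quotient_system_def)
  let ?E = "\<lambda>U. openin X U \<and> (\<forall>p\<in>U. \<forall>i<5. \<forall>j<5. u i j p = p)"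
  \<comment> \<open>The interior of the common fixed point set. On it the derivatives are the
    identity, and openness is built in.\<close>
  define W where "W = \<Union>{U. ?E U}"
  have W: "openin X W" unfolding W_def by (rule openin_Union) blast
  have WE: "u i j q = q" if "q \<in> W" "i < 5" "j < 5" for i j q using that by (auto simp: W_def)
  have "z \<in> W" using quotient_system_local[OF u c fx jac] by (auto simp: W_def)
  have "q \<in> W" if q: "q \<in> X closure_of W" for q
  proof -
    have qX: "q \<in> topspace X" using q by (simp add: in_closure_of)
    have qfix: "u i j q = q" if ij: "i < 5" "j < 5" for i j
    proof -
      have "closedin X {x \<in> topspace X. u i j x = id x}"
        by (rule closedin_continuous_maps_eq[OF Hausdorff Diff_continuous[OF D[OF ij]] continuous_map_id])
      moreover have "W \<subseteq> {x \<in> topspace X. u i j x = id x}" using WE[OF _ ij] openin_subset[OF W] by auto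
      ultimately have "q \<in> {x \<in> topspace X. u i j x = id x}" using q closure_of_minimal by blast
      then show ?thesis by simp
    qed
    obtain d where d: "d \<in> A" "q \<in> fst d" using chart_at[OF qX] by blast
    have dc: "is_chart X d" by (rule atlas_chart[OF d(1)])
    \<comment> \<open>A derivative different from the identity would persist near \<open>q\<close>.
      There are points of \<open>W\<close> arbitrarily near, and around those the map is the
      identity.\<close>
    have "local_jacobian d d (u i j) q = mat 1" if ij: "i < 5" "j < 5" for i j
    proof (rule ccontr)
      assume ne: "local_jacobian d d (u i j) q \<noteq> mat 1"
      let ?O = "fst d \<inter> u i j -` fst d"
      have O: "openin X ?O"
        by (rule openin_overlap[OF Diff_continuous[OF D[OF ij]] chart_openin[OF dc] chart_openin[OF dc]])
      have t: "topspace (subtopology X ?O) = ?O" using openin_subset[OF O] by auto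
      have "openin (subtopology X ?O) {p \<in> ?O. local_jacobian d d (u i j) p \<in> - {mat 1}}"
        using openin_continuous_map_preimage[OF Diff_jacobian_continuous[OF D[OF ij] d(1) d(1)], of "- {mat 1}"]
        unfolding t by (simp add: open_Compl)
      then have "openin X {p \<in> ?O. local_jacobian d d (u i j) p \<in> - {mat 1}}"
        using O by (simp add: openin_open_subtopology)
      moreover have "q \<in> {p \<in> ?O. local_jacobian d d (u i j) p \<in> - {mat 1}}"
        using ne d(2) qfix[OF ij] by simp
      ultimately have "\<exists>y\<in>W. y \<in> {p \<in> ?O. local_jacobian d d (u i j) p \<in> - {mat 1}}"
        using q[unfolded in_closure_of, THEN conjunct2] by meson
      then obtain y where y: "y \<in> W" "y \<in> fst d" "local_jacobian d d (u i j) y \<noteq> mat 1"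
        by auto
      have "chart_deriv d d (u i j) y (mat 1)"
        by (rule chart_deriv_cong[OF dc W y(1,2) _ chart_deriv_id[OF dc y(2)]]) (simp add: WE[OF _ ij])
      then have "local_jacobian d d (u i j) y = mat 1"
        by (rule Diff_local_jacobian_eq[OF D[OF ij] d(1) y(2), rotated]) (simp add: WE[OF y(1) ij] y(2))
      then show False using y(3) by blast
    qed
    then obtain U where "?E U" "q \<in> U"
      using quotient_system_local[OF u d qfix] by blast
    then show ?thesis unfolding W_def by blast
  qed
  then have "closedin X W" using openin_subset[OF W] closure_of_subset_eq by blast
  then have "W = topspace X"
    using W \<open>z \<in> W\<close> connected connected_space_clopen_in by blast
  then show ?thesis using WE p ij by blast
qed


lemma det_pos_invertible: "0 < det M \<Longrightarrow> invertible M" for M :: "real^2^2"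
  using invertible_det_nz[of M] by simp

lemma matrix_cancel_right:
  fixes M N K :: "real^'n^'n"
  assumes "invertible K" "M ** K = N ** K"
  shows "M = N"
  by (metis assms invertible_def matrix_mul_assoc matrix_mul_rid)

theorem braid_action_trivial:
  defines "G \<equiv> BijGroup (topspace X)"
  assumes D: "g1 \<in> Diff X A" "g2 \<in> Diff X A" "g3 \<in> Diff X A" "g4 \<in> Diff X A"
    and b: "g1 \<otimes>\<^bsub>G\<^esub> g2 \<otimes>\<^bsub>G\<^esub> g1 = g2 \<otimes>\<^bsub>G\<^esub> g1 \<otimes>\<^bsub>G\<^esub> g2"
      "g2 \<otimes>\<^bsub>G\<^esub> g3 \<otimes>\<^bsub>G\<^esub> g2 = g3 \<otimes>\<^bsub>G\<^esub> g2 \<otimes>\<^bsub>G\<^esub> g3"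
      "g3 \<otimes>\<^bsub>G\<^esub> g4 \<otimes>\<^bsub>G\<^esub> g3 = g4 \<otimes>\<^bsub>G\<^esub> g3 \<otimes>\<^bsub>G\<^esub> g4"
    and co: "g1 \<otimes>\<^bsub>G\<^esub> g3 = g3 \<otimes>\<^bsub>G\<^esub> g1" "g1 \<otimes>\<^bsub>G\<^esub> g4 = g4 \<otimes>\<^bsub>G\<^esub> g1"
      "g2 \<otimes>\<^bsub>G\<^esub> g4 = g4 \<otimes>\<^bsub>G\<^esub> g2"
    and z: "z \<in> topspace X" "g1 z = z" "g2 z = z" "g3 z = z" "g4 z = z"
  shows "g1 = g2"
proof -
  interpret group G unfolding G_def by (rule group_BijGroup)
  have car: "carrier G = Bij (topspace X)" by (simp add: G_def BijGroup_def)
  have mult: "x \<otimes>\<^bsub>G\<^esub> y = compose (topspace X) x y" if "x \<in> Diff X A" "y \<in> Diff X A" for x y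
    using Diff_Bij that by (simp add: G_def BijGroup_def)
  have multD: "x \<otimes>\<^bsub>G\<^esub> y \<in> Diff X A" if "x \<in> Diff X A" "y \<in> Diff X A" for x y
    using Diff_compose[OF that(2,1)] mult[OF that] by simp
  have invD: "inv\<^bsub>G\<^esub> x \<in> Diff X A" if "x \<in> Diff X A" for x
    using Diff_inverse[OF that] inv_BijGroup[OF Diff_Bij[OF that]] by (simp add: G_def)
  have app: "(x \<otimes>\<^bsub>G\<^esub> y) p = x (y p)" if "x \<in> Diff X A" "y \<in> Diff X A" "p \<in> topspace X" for x y p
    using mult[OF that(1,2)] that(3) by (simp add: compose_def)
  have C: "x \<in> carrier G" if "x \<in> Diff X A" for x using Diff_Bij[OF that] car by simp
  obtain c where c: "c \<in> A" "z \<in> fst c" using chart_at[OF z(1)] by blast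
  define J where "J = (\<lambda>x. local_jacobian c c x z)"
  have Jm: "J (x \<otimes>\<^bsub>G\<^esub> y) = J x ** J y" if "x \<in> Diff X A" "y \<in> Diff X A" "x z = z" "y z = z" for x y
    using local_jacobian_compose_fixed[OF that(2,1) c that(4,3)] mult[OF that(1,2)] by (simp add: J_def)
  have Ji: "invertible (J x)" if "x \<in> Diff X A" "x z = z" for x
    using Diff_chart_deriv(2)[OF that(1) c(1) c(1) c(2)] that(2) c(2) det_pos_invertible by (simp add: J_def)
  have Jg: "J g2 = J g1 \<and> J g3 = J g1 \<and> J g4 = J g1"
  proof (rule matrix2_braid_rep_trivial)
    show "J g1 ** J g2 ** J g1 = J g2 ** J g1 ** J g2" "J g2 ** J g3 ** J g2 = J g3 ** J g2 ** J g3"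
      "J g3 ** J g4 ** J g3 = J g4 ** J g3 ** J g4"
      using b by (simp_all add: Jm[symmetric] D z multD app)
    show "J g1 ** J g3 = J g3 ** J g1" "J g1 ** J g4 = J g4 ** J g1" "J g2 ** J g4 = J g4 ** J g2"
      using co by (simp_all add: Jm[symmetric] D z)
  qed (use Ji D z in auto)
  define w where "w = g4 \<otimes>\<^bsub>G\<^esub> g3 \<otimes>\<^bsub>G\<^esub> g2"
  define g0 where "g0 = w \<otimes>\<^bsub>G\<^esub> g1 \<otimes>\<^bsub>G\<^esub> inv\<^bsub>G\<^esub> w"
  note pent = braid_pentagon[OF C[OF D(1)] C[OF D(2)] C[OF D(3)] C[OF D(4)] b co, folded w_def, folded g0_def]
  have wD: "w \<in> Diff X A" "w z = z" using D z by (simp_all add: w_def multD app)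
  have g0D: "g0 \<in> Diff X A" using D wD by (simp add: g0_def multD invD)
  have "(g0 \<otimes>\<^bsub>G\<^esub> w) z = z" using pent(5) D wD z by (simp add: app)
  then have g0z: "g0 z = z" using app[OF g0D wD(1) z(1)] wD(2) by simp
  \<comment> \<open>All four generators have the same derivative, so \<open>w\<close> has its cube
    as derivative; this commutes with it, and conjugation by \<open>w\<close> changes
    nothing.\<close>
  have J0: "J g0 = J g1"
  proof (rule matrix_cancel_right[OF Ji[OF wD]])
    have Jw: "J w = J g1 ** J g1 ** J g1" using Jg D z by (simp add: w_def Jm multD app)
    have "J g0 ** J w = J w ** J g1" using pent(5) D wD z g0D g0z by (metis Jm)
    then show "J g0 ** J w = J g1 ** J w" unfolding Jw by (simp add: matrix_mul_assoc)
  qed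
  \<comment> \<open>The numbering of \<open>braid_edges\<close>, with the additional element of
    \<open>braid_pentagon\<close> at index 0.\<close>
  define a where "a = (\<lambda>i::nat. if i = 0 then g0 else if i = 1 then g1 else if i = 2 then g2 else if i = 3 then g3 else g4)"
  have a: "a 0 = g0" "a 1 = g1" "a (Suc 0) = g1" "a 2 = g2" "a 3 = g3" "a 4 = g4" by (simp_all add: a_def)
  have aD: "a i \<in> Diff X A" "a i z = z" "J (a i) = J g1" for i
    using D g0D g0z z J0 Jg by (auto simp: a_def)
  define u where "u = (\<lambda>i j. a i \<otimes>\<^bsub>G\<^esub> inv\<^bsub>G\<^esub> (a j))"
  have uD: "u i j \<in> Diff X A" for i j unfolding u_def by (rule multD[OF aD(1) invD[OF aD(1)]])
  have ua: "u i j \<otimes>\<^bsub>G\<^esub> a j = a i" for i j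
    unfolding u_def using C[OF aD(1)[of i]] C[OF aD(1)[of j]] by (simp add: m_assoc)
  have uz: "u i j z = z" for i j
    using app[OF uD aD(1) z(1), of i j j] ua[of i j] aD(2) by metis
  have "J (u i j) = mat 1" for i j
  proof (rule matrix_cancel_right[OF Ji[OF aD(1,2), of j]])
    show "J (u i j) ** J (a j) = mat 1 ** J (a j)"
      using Jm[OF uD aD(1) uz aD(2), of i j j] ua[of i j] aD(3) by simp
  qed
  then have uJ: "local_jacobian c c (u i j) z = mat 1" for i j by (simp add: J_def)
  have q1: "u i i p = p" if "p \<in> topspace X" for i p
    using that r_inv[OF C[OF aD(1)]] by (simp add: u_def) (simp add: G_def BijGroup_def)
  have q2: "u i j (u j k p) = u i k p" if "p \<in> topspace X" for i j k p
  proof -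
    have "u i j \<otimes>\<^bsub>G\<^esub> u j k = u i k"
      unfolding u_def using C[OF aD(1)[of i]] C[OF aD(1)[of j]] C[OF aD(1)[of k]]
      by (metis inv_closed l_inv l_one m_assoc m_closed)
    then show ?thesis using app[OF uD uD that, of i j j k] by simp
  qed
  have edge: "u i k (u j k (u i k p)) = u j k (u i k (u j k p))"
      if "a i \<otimes>\<^bsub>G\<^esub> a j \<otimes>\<^bsub>G\<^esub> a i = a j \<otimes>\<^bsub>G\<^esub> a i \<otimes>\<^bsub>G\<^esub> a j"
        "a i \<otimes>\<^bsub>G\<^esub> a k = a k \<otimes>\<^bsub>G\<^esub> a i" "a j \<otimes>\<^bsub>G\<^esub> a k = a k \<otimes>\<^bsub>G\<^esub> a j" "p \<in> topspace X" for i j k p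
    proof -
      have "u i k \<otimes>\<^bsub>G\<^esub> u j k \<otimes>\<^bsub>G\<^esub> u i k = u j k \<otimes>\<^bsub>G\<^esub> u i k \<otimes>\<^bsub>G\<^esub> u j k"
        unfolding u_def by (rule braided_quotients[OF C C C that(1-3)]) (rule aD)+
      then have "(u i k \<otimes>\<^bsub>G\<^esub> u j k \<otimes>\<^bsub>G\<^esub> u i k) p = (u j k \<otimes>\<^bsub>G\<^esub> u i k \<otimes>\<^bsub>G\<^esub> u j k) p" by simp
      moreover have "u i' j' p \<in> topspace X" for i' j'
        using Bij_apply[OF Diff_Bij[OF uD] that(4)] .
      ultimately show ?thesis using that(4) by (simp add: app multD uD)
    qed
  have q3: "\<forall>(i,j,k)\<in>braid_edges. \<forall>p\<in>topspace X. u i k (u j k (u i k p)) = u j k (u i k (u j k p))"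
  proof
    fix e assume e: "e \<in> braid_edges"
    then have "e = (0,1,3) \<or> e = (1,2,4) \<or> e = (2,3,0) \<or> e = (3,4,1)" by (auto simp: braid_edges_def)
    then show "case e of (i, j, k) \<Rightarrow> \<forall>p\<in>topspace X. u i k (u j k (u i k p)) = u j k (u i k (u j k p))"
      using edge[of 0 1 3] edge[of 1 2 4] edge[of 2 3 0] edge[of 3 4 1] b co pent(1-3)
      by (elim disjE) (simp_all only: a split_conv, simp_all)
  qed
  have "quotient_system u"
    unfolding quotient_system_def using uD q1 q2 q3 by simp
  then have u12: "u 1 2 p = p" if "p \<in> topspace X" for p
    using quotient_system_trivial[where u = u and i = 1 and j = 2, OF _ c uz uJ that] by simp
  \<comment> \<open>On the surface \<open>u 1 2\<close> is the identity and takes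
    \<open>g2 p\<close> to \<open>g1 p\<close>. Elsewhere both values are \<open>undefined\<close>,
    because members of \<open>Bij\<close> are extensional.\<close>
  have "g1 p = g2 p" for p
  proof (cases "p \<in> topspace X")
    case True
    then have "u 1 2 (g2 p) = g1 p" using app[OF uD aD(1) True, of 1 2 2] ua[of 1 2] a by simp
    moreover have "g2 p \<in> topspace X" using Bij_apply[OF Diff_Bij[OF D(2)] True] .
    ultimately show ?thesis using u12 by simp
  next
    case False
    then show ?thesis using Bij_imp_extensional[OF Diff_Bij[OF D(1)]] Bij_imp_extensional[OF Diff_Bij[OF D(2)]]
      by (simp add: extensional_def)
  qed
  then show ?thesis by (rule ext)
qed

end

section \<open>Configuration spaces and monodromy\<close>

text \<open>A separating pair \<open>V q q'\<close>, \<open>W q q'\<close> is chosen for each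
  ordered pair of points. \<open>U q\<close> lies in the first member of its own pairs and in the
  second member of the others, so any two of these sets are separated.\<close>

lemma Hausdorff_separate_finite:
  assumes X: "Hausdorff_space X" and Q: "finite Q" "Q \<subseteq> topspace X"
  shows "\<exists>U. (\<forall>q\<in>Q. openin X (U q) \<and> q \<in> U q) \<and> (\<forall>q\<in>Q. \<forall>q'\<in>Q. q \<noteq> q' \<longrightarrow> U q \<inter> U q' = {})"
proof -
  let ?S = "\<lambda>q q' Z. openin X (fst Z) \<and> openin X (snd Z) \<and> q \<in> fst Z \<and> q' \<in> snd Z \<and> fst Z \<inter> snd Z = {}"
  define V W where "V q q' = fst (SOME Z. ?S q q' Z)" and "W q q' = snd (SOME Z. ?S q q' Z)" for q q'
  have VW: "openin X (V q q') \<and> openin X (W q q') \<and> q \<in> V q q' \<and> q' \<in> W q q' \<and> V q q' \<inter> W q q' = {}"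
    if q: "q \<in> Q" "q' \<in> Q" "q \<noteq> q'" for q q'
  proof -
    have "q \<in> topspace X" "q' \<in> topspace X" using q Q(2) by blast+
    then have "\<exists>V W. openin X V \<and> openin X W \<and> q \<in> V \<and> q' \<in> W \<and> disjnt V W"
      using X[unfolded Hausdorff_space_def] q(3) by simp
    then have "\<exists>Z. ?S q q' Z" unfolding disjnt_def by simp
    from someI_ex[OF this] show ?thesis unfolding V_def W_def .
  qed
  define U where "U q = topspace X \<inter> (\<Inter>q'\<in>Q - {q}. V q q' \<inter> W q' q)" for q
  have "openin X (U q) \<and> q \<in> U q" if q: "q \<in> Q" for q
  proof
    have "openin X (\<Inter>(insert (topspace X) ((\<lambda>q'. V q q' \<inter> W q' q) ` (Q - {q}))))"
      by (rule openin_Inter) (use Q VW q in auto)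
    then show "openin X (U q)" by (simp add: U_def)
    show "q \<in> U q" using Q VW q by (auto simp: U_def)
  qed
  moreover have "U q \<inter> U q' = {}" if q: "q \<in> Q" "q' \<in> Q" "q \<noteq> q'" for q q'
  proof -
    have "U q \<subseteq> V q q'" "U q' \<subseteq> W q q'" using q by (auto simp: U_def)
    then show ?thesis using VW[OF q] by blast
  qed
  ultimately show ?thesis by (intro exI[of _ U] conjI ballI impI) simp_all
qed

text \<open>Finite sets are closed in a Hausdorff space, so each fibre is closed and, with a finite
  complement of values, also open. This discreteness turns continuity of marked points into
  constancy.\<close>

lemma continuous_map_finite_const:
  assumes Z: "connected_space Z" and f: "continuous_map Z X f" and X: "Hausdorff_space X"
    and fin: "finite Q" "f ` topspace Z \<subseteq> Q" and xy: "x \<in> topspace Z" "y \<in> topspace Z"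
  shows "f x = f y"
proof -
  have fX: "f z \<in> topspace X" if "z \<in> topspace Z" for z
    using continuous_map_image_subset_topspace[OF f] that by blast
  let ?F = "\<lambda>R. {z \<in> topspace Z. f z \<in> R}"
  have cl: "closedin Z (?F (R \<inter> topspace X))" if "finite R" for R
    by (rule closedin_continuous_map_preimage[OF f closedin_Hausdorff_finite[OF X]]) (use that in auto)
  have "closedin Z (?F ((Q - {f x}) \<inter> topspace X))" by (rule cl) (use fin in auto)
  moreover have "topspace Z - ?F ((Q - {f x}) \<inter> topspace X) = ?F ({f x} \<inter> topspace X)"
    using fin(2) fX by auto
  ultimately have "openin Z (?F ({f x} \<inter> topspace X))"
    using openin_diff[OF openin_topspace, of Z "?F ((Q - {f x}) \<inter> topspace X)"] by simp
  moreover have "closedin Z (?F ({f x} \<inter> topspace X))" by (rule cl) simp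
  moreover have "x \<in> ?F ({f x} \<inter> topspace X)" using xy fX by simp
  ultimately have "?F ({f x} \<inter> topspace X) = topspace Z"
    using Z[unfolded connected_space_clopen_in, rule_format, of "?F ({f x} \<inter> topspace X)"] by blast
  then have "y \<in> ?F ({f x} \<inter> topspace X)" using xy(2) by (simp only:)
  then show ?thesis by simp
qed

section \<open>The covering of the configuration space by its marked points\<close>

lemma topspace_ordered_conf:
  "topspace (ordered_conf X A n) =
    {x \<in> {..<n} \<rightarrow>\<^sub>E topspace X. x ` {..<n} \<subseteq> surface_interior X A \<and> inj_on x {..<n}}"
  by (auto simp: ordered_conf_def)

lemma Conf_member:
  assumes "Q \<in> topspace (Conf X A n)"
  shows "finite Q" "card Q = n" "Q \<subseteq> surface_interior X A" "Q \<subseteq> topspace X"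
  using assms
  by (auto simp: Conf_def topspace_ordered_conf card_image surface_interior_def)

text \<open>The preimage under the orbit map is the union over the \<open>n\<close> coordinates of
  the tuples with that coordinate in \<open>U\<close>.\<close>

lemma openin_Conf_meets:
  assumes U: "openin X U"
  shows "openin (Conf X A n) {Q \<in> topspace (Conf X A n). Q \<inter> U \<noteq> {}}"
proof -
  let ?O = "ordered_conf X A n"
  have "openin ?O {x \<in> topspace ?O. x i \<in> U}" if "i < n" for i
  proof (rule openin_continuous_map_preimage[OF _ U])
    show "continuous_map ?O X (\<lambda>x. x i)"
      unfolding ordered_conf_def
      by (rule continuous_map_from_subtopology[OF continuous_map_product_projection]) (use that in simp)
  qed
  then have "\<And>S. S \<in> (\<lambda>i. {x \<in> topspace ?O. x i \<in> U}) ` {..<n} \<Longrightarrow> openin ?O S"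
    by (elim imageE) simp
  then have 1: "openin ?O (\<Union>i\<in>{..<n}. {x \<in> topspace ?O. x i \<in> U})" by (rule openin_Union)
  have topC: "topspace (Conf X A n) = (\<lambda>x. x ` {..<n}) ` topspace ?O"
    unfolding Conf_def by (rule topspace_quotient_topology)
  have "(\<Union>i\<in>{..<n}. {x \<in> topspace ?O. x i \<in> U}) =
    {x \<in> topspace ?O. x ` {..<n} \<in> {Q \<in> topspace (Conf X A n). Q \<inter> U \<noteq> {}}}"
    unfolding topC by blast
  with 1 have "openin ?O {x \<in> topspace ?O. x ` {..<n} \<in> {Q \<in> topspace (Conf X A n). Q \<inter> U \<noteq> {}}}"
    by (simp only:)
  then show ?thesis
    using topC unfolding Conf_def openin_quotient_topology by blast
qed

lemma continuous_map_Conf: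
  assumes "\<And>i. i < n \<Longrightarrow> continuous_map Z X (\<lambda>z. F z i)"
    and "\<And>z i. z \<in> topspace Z \<Longrightarrow> i < n \<Longrightarrow> F z i \<in> surface_interior X A"
    and "\<And>z. z \<in> topspace Z \<Longrightarrow> inj_on (F z) {..<n}"
  shows "continuous_map Z (Conf X A n) (\<lambda>z. F z ` {..<n})"
proof -
  have "continuous_map Z (ordered_conf X A n) (\<lambda>z. restrict (F z) {..<n})"
    unfolding ordered_conf_def continuous_map_in_subtopology continuous_map_componentwise
    using assms by (auto simp: inj_on_def)
  from continuous_map_compose[OF this quotient_imp_continuous_map[OF quotient_map_quotient_topology],
      of "\<lambda>x. x ` {..<n}"]
  have "continuous_map Z (Conf X A n) ((\<lambda>x. x ` {..<n}) \<circ> (\<lambda>z. restrict (F z) {..<n}))"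
    by (simp only: Conf_def)
  moreover have "(\<lambda>x. x ` {..<n}) \<circ> (\<lambda>z. restrict (F z) {..<n}) = (\<lambda>z. F z ` {..<n})"
    by (auto simp: fun_eq_iff)
  ultimately show ?thesis by simp
qed

text \<open>Choosing a point of a configuration defines an \<open>n\<close>-sheeted covering of
  \<open>Conf X A n\<close>. Over \<open>V\<close> it is trivial, with one sheet in each
  \<open>U q\<close>.\<close>

lemma Conf_local_sheets:
  assumes X: "Hausdorff_space X" and Q: "Q \<in> topspace (Conf X A n)"
  obtains V U where "openin (Conf X A n) V" "Q \<in> V" "\<And>q. q \<in> Q \<Longrightarrow> openin X (U q)" "\<And>q. q \<in> Q \<Longrightarrow> q \<in> U q"
    "\<And>R r. R \<in> V \<Longrightarrow> r \<in> R \<Longrightarrow> \<exists>q\<in>Q. r \<in> U q"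
    "\<And>R q. R \<in> V \<Longrightarrow> q \<in> Q \<Longrightarrow> \<exists>!r. r \<in> R \<inter> U q"
proof -
  obtain U where U0: "\<forall>q\<in>Q. openin X (U q) \<and> q \<in> U q"
      "\<forall>q\<in>Q. \<forall>q'\<in>Q. q \<noteq> q' \<longrightarrow> U q \<inter> U q' = {}"
    using Hausdorff_separate_finite[OF X Conf_member(1,4)[OF Q]] by (elim exE conjE)
  have U: "\<And>q. q \<in> Q \<Longrightarrow> openin X (U q)" "\<And>q. q \<in> Q \<Longrightarrow> q \<in> U q" using U0(1) by simp_all
  have dis: "\<And>q q'. q \<in> Q \<Longrightarrow> q' \<in> Q \<Longrightarrow> q \<noteq> q' \<Longrightarrow> U q \<inter> U q' = {}" using U0(2) by simp
  define V where "V = topspace (Conf X A n) \<inter> (\<Inter>q\<in>Q. {R \<in> topspace (Conf X A n). R \<inter> U q \<noteq> {}})"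
  have "openin (Conf X A n) (\<Inter>(insert (topspace (Conf X A n)) ((\<lambda>q. {R \<in> topspace (Conf X A n). R \<inter> U q \<noteq> {}}) ` Q)))"
  proof (rule openin_Inter)
    fix S assume "S \<in> insert (topspace (Conf X A n)) ((\<lambda>q. {R \<in> topspace (Conf X A n). R \<inter> U q \<noteq> {}}) ` Q)"
    then show "openin (Conf X A n) S"
      using openin_Conf_meets[OF U(1)] by (elim insertE imageE) simp_all
  qed (use Conf_member(1)[OF Q] in simp_all)
  then have V: "openin (Conf X A n) V" by (simp add: V_def)
  have QV: "Q \<in> V" using Q U by (auto simp: V_def)
  have main: "(\<forall>r\<in>R. \<exists>q\<in>Q. r \<in> U q) \<and> (\<forall>q\<in>Q. \<exists>!r. r \<in> R \<inter> U q)" if R: "R \<in> V" for R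
  proof -
    have "\<forall>q\<in>Q. \<exists>r. r \<in> R \<inter> U q" using R by (auto simp: V_def)
    then obtain f where f: "\<And>q. q \<in> Q \<Longrightarrow> f q \<in> R \<inter> U q" by metis
    have inj: "inj_on f Q"
      using f dis unfolding inj_on_def by (metis IntD2 IntI empty_iff)
    have R': "R \<in> topspace (Conf X A n)" using R by (simp add: V_def)
    \<comment> \<open>\<open>R\<close> has exactly \<open>n\<close> points and meets
      \<open>n\<close> disjoint sets, hence has exactly one point in each.\<close>
    have "f ` Q = R"
      by (rule card_subset_eq[OF Conf_member(1)[OF R']])
        (use f card_image[OF inj] Conf_member(2)[OF R'] Conf_member(2)[OF Q] in auto)
    then have all: "\<exists>q\<in>Q. r = f q" if "r \<in> R" for r using that by blast
    have eq: "r = f q" if "r \<in> R \<inter> U q" "q \<in> Q" for r q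
    proof -
      obtain q' where q': "q' \<in> Q" "r = f q'" using all[of r] \<open>r \<in> R \<inter> U q\<close> by blast
      then have "q' = q" using dis[OF q'(1) that(2)] f[OF q'(1)] \<open>r \<in> R \<inter> U q\<close> by blast
      then show ?thesis using q' by simp
    qed
    show ?thesis
    proof (intro conjI ballI)
      show "\<exists>q\<in>Q. r \<in> U q" if "r \<in> R" for r using all[OF that] f by blast
      show "\<exists>!r. r \<in> R \<inter> U q" if "q \<in> Q" for q by (rule ex1I[of _ "f q"]) (use f eq that in blast)+
    qed
  qed
  show thesis by (rule that[OF V QV U]) (use main in blast)+
qed

text \<open>Uniqueness of path lifting: the set of agreement is closed by the Hausdorff property and
  open because nearby values lie in the same sheet.\<close>

lemma section_unique:
  assumes X: "Hausdorff_space X" and h: "continuous_map (top_of_set {0..1::real}) (Conf X A n) h"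
    and x: "continuous_map (top_of_set {0..1}) X x" "\<And>t. t \<in> {0..1} \<Longrightarrow> x t \<in> h t"
    and y: "continuous_map (top_of_set {0..1}) X y" "\<And>t. t \<in> {0..1} \<Longrightarrow> y t \<in> h t"
    and eq: "x 0 = y 0" and t: "t \<in> {0..1}"
  shows "x t = y t"
proof -
  let ?I = "top_of_set {0..1::real}"
  let ?E = "{t \<in> topspace ?I. x t = y t}"
  have cl: "closedin ?I ?E" by (rule closedin_continuous_maps_eq[OF X x(1) y(1)])
  have op: "openin ?I ?E"
  proof (subst openin_subopen, intro ballI)
    fix t assume t: "t \<in> ?E"
    have tI: "t \<in> {0..1}" using t by simp
    have hT: "h t \<in> topspace (Conf X A n)"
      using continuous_map_image_subset_topspace[OF h] tI by auto
    obtain V U where V: "openin (Conf X A n) V" "h t \<in> V"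
      and U: "\<And>q. q \<in> h t \<Longrightarrow> openin X (U q)" "\<And>q. q \<in> h t \<Longrightarrow> q \<in> U q"
      and "\<And>R r. R \<in> V \<Longrightarrow> r \<in> R \<Longrightarrow> \<exists>q\<in>h t. r \<in> U q"
      and un: "\<And>R q. R \<in> V \<Longrightarrow> q \<in> h t \<Longrightarrow> \<exists>!r. r \<in> R \<inter> U q"
      by (rule Conf_local_sheets[OF X hT]) (rule that)
    have xt: "x t \<in> h t" by (rule x(2)[OF tI])
    let ?T = "{s \<in> topspace ?I. h s \<in> V} \<inter> {s \<in> topspace ?I. x s \<in> U (x t)} \<inter> {s \<in> topspace ?I. y s \<in> U (x t)}"
    have "openin ?I ?T"
      by (intro openin_Int openin_continuous_map_preimage[OF h V(1)]
          openin_continuous_map_preimage[OF x(1) U(1)[OF xt]] openin_continuous_map_preimage[OF y(1) U(1)[OF xt]])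
    moreover have "t \<in> ?T" using t V U(2)[OF xt] by auto
    moreover have "?T \<subseteq> ?E"
    proof
      fix s assume s: "s \<in> ?T"
      then have "x s \<in> h s \<inter> U (x t)" "y s \<in> h s \<inter> U (x t)" "h s \<in> V" using x(2) y(2) by auto
      then have "x s = y s" using un[OF _ xt] by blast
      then show "s \<in> ?E" using s by simp
    qed
    ultimately show "\<exists>T. openin ?I T \<and> t \<in> T \<and> T \<subseteq> ?E" by blast
  qed
  have "connected_space ?I" by simp
  moreover have "0 \<in> ?E" using eq by simp
  ultimately have "?E = topspace ?I"
    using cl op connected_space_clopen_in[of ?I] by (metis (no_types, lifting) empty_iff)
  moreover have "t \<in> topspace ?I" using t by simp
  ultimately have "t \<in> ?E" by (simp only:)
  then show ?thesis by (rule CollectE) (rule conjunct2)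
qed

text \<open>Path lifting, carried out simultaneously for all parameters \<open>s\<close> near
  \<open>s0\<close>. A lift over a thin strip is extended in the time direction; its width may
  shrink at every extension.\<close>

lemma local_section:
  fixes s0 :: real and h :: "real \<times> real \<Rightarrow> 'a set"
  assumes X: "Hausdorff_space X"
    and h: "continuous_map (top_of_set ({0..1} \<times> {0..1})) (Conf X A n) h"
    and hP: "\<And>s. s \<in> {0..1} \<Longrightarrow> h (s, 0) = P" and p: "p \<in> P" and s0: "s0 \<in> {0..1}"
  shows "\<exists>e>0. \<exists>x. continuous_map (top_of_set (({0..1} \<inter> cball s0 e) \<times> {0..1})) X x \<and>
    (\<forall>s\<in>{0..1} \<inter> cball s0 e. \<forall>t\<in>{0..1}. x (s, t) \<in> h (s, t)) \<and>
    (\<forall>s\<in>{0..1} \<inter> cball s0 e. x (s, 0) = p)"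
proof -
  define Q where "Q \<tau> \<longleftrightarrow> (\<exists>e>0. \<exists>x. continuous_map (top_of_set (({0..1} \<inter> cball s0 e) \<times> {0..\<tau>})) X x \<and>
    (\<forall>s\<in>{0..1} \<inter> cball s0 e. \<forall>t\<in>{0..\<tau>}. x (s, t) \<in> h (s, t)) \<and>
    (\<forall>s\<in>{0..1} \<inter> cball s0 e. x (s, 0) = p))" for \<tau> :: real
  have hT: "h z \<in> topspace (Conf X A n)" if "z \<in> {0..1} \<times> {0..1}" for z
    using continuous_map_image_subset_topspace[OF h] that by auto
  have pX: "p \<in> topspace X" using Conf_member(4)[OF hT[of "(0,0)"]] hP[of 0] p by auto
  have Q0: "Q 0"
    unfolding Q_def using hP p pX by (intro exI[of _ 1] conjI exI[of _ "\<lambda>_. p"]) auto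
  \<comment> \<open>\<open>Bolzano\<close> stands for compactness of the time interval: an
    implication that composes and holds across all short intervals holds from 0 to 1.\<close>
  have "0 \<le> (0::real) \<and> (1::real) \<le> 1 \<and> Q 0 \<longrightarrow> Q 1"
  proof (rule Bolzano[of 0 1 "\<lambda>a b. 0 \<le> a \<and> b \<le> 1 \<and> Q a \<longrightarrow> Q b"])
    show "(0::real) \<le> 1" by simp
    show "0 \<le> a \<and> c \<le> 1 \<and> Q a \<longrightarrow> Q c"
      if "0 \<le> a \<and> b \<le> 1 \<and> Q a \<longrightarrow> Q b" "0 \<le> b \<and> c \<le> 1 \<and> Q b \<longrightarrow> Q c" "a \<le> b" "b \<le> c" for a b c
      using that by linarith
    fix t0 :: real assume t0: "0 \<le> t0" "t0 \<le> 1"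
    have z0: "(s0, t0) \<in> {0..1} \<times> {0..1}" using s0 t0 by simp
    obtain V U where V: "openin (Conf X A n) V" "h (s0, t0) \<in> V"
      and U: "\<And>q. q \<in> h (s0, t0) \<Longrightarrow> openin X (U q)" and "\<And>q. q \<in> h (s0, t0) \<Longrightarrow> q \<in> U q"
      and cov: "\<And>R r. R \<in> V \<Longrightarrow> r \<in> R \<Longrightarrow> \<exists>q\<in>h (s0, t0). r \<in> U q"
      and un: "\<And>R q. R \<in> V \<Longrightarrow> q \<in> h (s0, t0) \<Longrightarrow> \<exists>!r. r \<in> R \<inter> U q"
      by (rule Conf_local_sheets[OF X hT[OF z0]]) (rule that)
    have "openin (top_of_set ({0..1} \<times> {0..1})) {z \<in> {0..1} \<times> {0..1}. h z \<in> V}"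
      using openin_continuous_map_preimage[OF h V(1)] by simp
    then obtain d where d: "d > 0" "ball (s0, t0) d \<inter> ({0..1} \<times> {0..1}) \<subseteq> {z \<in> {0..1} \<times> {0..1}. h z \<in> V}"
      using V(2) z0 unfolding openin_contains_ball by blast
    have hV: "h (s, t) \<in> V" if "s \<in> {0..1}" "t \<in> {0..1}" "\<bar>s - s0\<bar> < d/2" "\<bar>t - t0\<bar> < d/2" for s t
    proof -
      have "dist (s0, t0) (s, t) \<le> \<bar>s - s0\<bar> + \<bar>t - t0\<bar>"
        unfolding dist_Pair_Pair using sqrt_sum_squares_le_sum_abs by (simp add: dist_real_def abs_minus_commute)
      then have "(s, t) \<in> ball (s0, t0) d" using that(3,4) by simp
      then show ?thesis using d(2) that(1,2) by blast
    qed
    have step: "Q b" if ab: "a \<le> t0" "t0 \<le> b" "b - a < d/2" "0 \<le> a" "b \<le> 1" and Qa: "Q a" for a b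
    proof -
      obtain e x where e: "e > 0" and x0: "continuous_map (top_of_set (({0..1} \<inter> cball s0 e) \<times> {0..a})) X x"
        "\<forall>s\<in>{0..1} \<inter> cball s0 e. \<forall>t\<in>{0..a}. x (s, t) \<in> h (s, t)"
        "\<forall>s\<in>{0..1} \<inter> cball s0 e. x (s, 0) = p"
        using Qa unfolding Q_def by (elim exE conjE) (rule that)
      note x = x0(1) x0(2)[rule_format] x0(3)[rule_format]
      have inV: "h (s, t) \<in> V" if "s \<in> {0..1}" "\<bar>s - s0\<bar> < d/2" "a \<le> t" "t \<le> b" for s t
      proof (rule hV)
        show "t \<in> {0..1}" using that ab by simp
        have "t - t0 < d/2" "t0 - t < d/2" using that ab by linarith+
        then show "\<bar>t - t0\<bar> < d/2" by (simp only: abs_less_iff) simp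
      qed (use that in simp_all)
      have x0: "x (s0, a) \<in> h (s0, a)" by (rule x(2)) (use s0 e ab in simp_all)
      have h0: "h (s0, a) \<in> V" by (rule inV) (use s0 d ab in simp_all)
      obtain q where q: "q \<in> h (s0, t0)" "x (s0, a) \<in> U q" using cov[OF h0 x0] by blast
      have "continuous_map (top_of_set ({0..1} \<inter> cball s0 e)) (top_of_set (({0..1} \<inter> cball s0 e) \<times> {0..a})) (\<lambda>s. (s, a))"
        unfolding continuous_map_in_subtopology using ab by (auto intro!: continuous_intros)
      from continuous_map_compose[OF this x(1)]
      have xa: "continuous_map (top_of_set ({0..1} \<inter> cball s0 e)) X (\<lambda>s. x (s, a))" by (simp add: comp_def)
      have "openin (top_of_set ({0..1} \<inter> cball s0 e)) {s \<in> {0..1} \<inter> cball s0 e. x (s, a) \<in> U q}"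
        using openin_continuous_map_preimage[OF xa U[OF q(1)]] by simp
      moreover have "s0 \<in> {s \<in> {0..1} \<inter> cball s0 e. x (s, a) \<in> U q}" using s0 e q by simp
      ultimately obtain r where r: "r > 0"
        "ball s0 r \<inter> ({0..1} \<inter> cball s0 e) \<subseteq> {s \<in> {0..1} \<inter> cball s0 e. x (s, a) \<in> U q}"
        unfolding openin_contains_ball by blast
      \<comment> \<open>Narrow enough for the old lift to exist, for its values at time
        \<open>a\<close> to lie in the sheet \<open>U q\<close>, and for \<open>h\<close> to stay in
        \<open>V\<close>.\<close>
      define e' where "e' = min e (min (r/2) (d/4))"
      have e': "e' > 0" "e' \<le> e" "e' < r" "e' < d/2" using e r d by (auto simp: e'_def)
      let ?S = "{0..1} \<inter> cball s0 e'"
      have S: "s \<in> {0..1} \<inter> cball s0 e" "x (s, a) \<in> U q" "s \<in> {0..1}" "\<bar>s - s0\<bar> < d/2" if "s \<in> ?S" for s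
      proof -
        have sd: "dist s0 s \<le> e'" "s \<in> {0..1}" using that by auto
        then show "s \<in> {0..1} \<inter> cball s0 e" "s \<in> {0..1}" "\<bar>s - s0\<bar> < d/2"
          using e' by (auto simp: dist_real_def abs_minus_commute)
        have "s \<in> ball s0 r \<inter> ({0..1} \<inter> cball s0 e)" using sd e' by simp
        then show "x (s, a) \<in> U q" using r(2) by blast
      qed
      define y where "y z = (THE r. r \<in> h z \<inter> U q)" for z
      have y: "y z \<in> h z \<inter> U q" if "h z \<in> V" for z
        unfolding y_def by (rule theI'[OF un[OF that q(1)]])
      have y_eq: "y z = r" if "h z \<in> V" "r \<in> h z" "r \<in> U q" for z r
        unfolding y_def by (rule the1_equality[OF un[OF that(1) q(1)] IntI[OF that(2,3)]])
      let ?B = "?S \<times> {a..b}"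
      have hB: "h z \<in> V" if "z \<in> ?B" for z
      proof -
        have "fst z \<in> ?S" "a \<le> snd z" "snd z \<le> b" using that unfolding mem_Times_iff by simp_all
        then show ?thesis using inV[of "fst z" "snd z"] S(3,4)[of "fst z"] by simp
      qed
      have hBc: "continuous_map (top_of_set ?B) (Conf X A n) h"
        by (rule continuous_map_from_subtopology_mono[OF h]) (use ab in auto)
      have yc: "continuous_map (top_of_set ?B) X y"
        unfolding continuous_map_def
      proof (intro conjI allI impI)
        show "y \<in> topspace (top_of_set ?B) \<rightarrow> topspace X"
        proof
          fix z assume "z \<in> topspace (top_of_set ?B)"
          then have "h z \<in> V" using hB by simp
          then show "y z \<in> topspace X" using y openin_subset[OF U[OF q(1)]] by blast
        qed
        fix W assume W: "openin X W"
        \<comment> \<open>The configuration has a single point in \<open>U q\<close>, so that point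
          lies in \<open>W\<close> exactly when the configuration meets
          \<open>W \<inter> U q\<close>. This makes \<open>y\<close> continuous.\<close>
        have "{z \<in> topspace (top_of_set ?B). y z \<in> W} =
          {z \<in> topspace (top_of_set ?B). h z \<in> {R \<in> topspace (Conf X A n). R \<inter> (W \<inter> U q) \<noteq> {}}}"
        proof -
          have "y z \<in> W \<longleftrightarrow> h z \<in> {R \<in> topspace (Conf X A n). R \<inter> (W \<inter> U q) \<noteq> {}}" if "z \<in> ?B" for z
          proof -
            have "h z \<in> topspace (Conf X A n)" using hB[OF that] openin_subset[OF V(1)] by blast
            moreover have "y z \<in> W \<longleftrightarrow> h z \<inter> (W \<inter> U q) \<noteq> {}"
              using y[OF hB[OF that]] y_eq[OF hB[OF that]] by blast
            ultimately show ?thesis by simp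
          qed
          then show ?thesis by (intro Collect_cong conj_cong) simp_all
        qed
        then show "openin (top_of_set ?B) {z \<in> topspace (top_of_set ?B). y z \<in> W}"
          using openin_continuous_map_preimage[OF hBc openin_Conf_meets[OF openin_Int[OF W U[OF q(1)]]]]
          by (simp only:)
      qed
      let ?x = "\<lambda>z. if snd z \<le> a then x z else y z"
      let ?D = "?S \<times> {0..b}"
      have "continuous_map (top_of_set ?D) X ?x"
      proof (rule continuous_map_cases_le)
        show "continuous_map (top_of_set ?D) euclideanreal snd" by (simp add: continuous_on_snd)
        show "continuous_map (top_of_set ?D) euclideanreal (\<lambda>_. a)" by simp
        have "?S \<subseteq> {0..1} \<inter> cball s0 e" using S(1) by (rule subsetI)
        then have 1: "?D \<inter> {z \<in> topspace (top_of_set ?D). snd z \<le> a} \<subseteq> ({0..1} \<inter> cball s0 e) \<times> {0..a}"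
          by force
        have 2: "?D \<inter> {z \<in> topspace (top_of_set ?D). a \<le> snd z} \<subseteq> ?B" by auto
        show "continuous_map (subtopology (top_of_set ?D) {z \<in> topspace (top_of_set ?D). snd z \<le> a}) X x"
          unfolding subtopology_subtopology by (rule continuous_map_from_subtopology_mono[OF x(1) 1])
        show "continuous_map (subtopology (top_of_set ?D) {z \<in> topspace (top_of_set ?D). a \<le> snd z}) X y"
          unfolding subtopology_subtopology by (rule continuous_map_from_subtopology_mono[OF yc 2])
        fix z assume z: "z \<in> topspace (top_of_set ?D)" "snd z = a"
        then have zS: "fst z \<in> ?S" "z = (fst z, a)" by (auto simp: mem_Times_iff prod_eq_iff)
        show "x z = y z"
        proof (rule y_eq[symmetric])
          have "z \<in> ?B" using zS(1) z(2) ab unfolding mem_Times_iff by simp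
          then show "h z \<in> V" by (rule hB)
          have "x (fst z, a) \<in> h (fst z, a)" by (rule x(2)[OF S(1)[OF zS(1)]]) (use ab in simp)
          then show "x z \<in> h z" using zS(2) by (simp only: prod.collapse)
          show "x z \<in> U q" using S(2)[OF zS(1)] zS(2) by (simp only: prod.collapse)
        qed
      qed
      moreover have "?x (s, t) \<in> h (s, t)" if "s \<in> ?S" "t \<in> {0..b}" for s t
      proof (cases "t \<le> a")
        case True
        then show ?thesis using x(2)[OF S(1)[OF that(1)], of t] that(2) by simp
      next
        case False
        then have "(s, t) \<in> ?B" using that by simp
        then have "h (s, t) \<in> V" by (rule hB)
        then show ?thesis using y[of "(s, t)"] False by simp
      qed
      moreover have "?x (s, 0) = p" if "s \<in> ?S" for s
        using x(3)[OF S(1)[OF that]] ab by simp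
      ultimately show "Q b"
        unfolding Q_def by (intro exI[of _ e'] conjI exI[of _ ?x] ballI e'(1))
    qed
    show "\<exists>d>0. \<forall>a b. a \<le> t0 \<and> t0 \<le> b \<and> b - a < d \<longrightarrow> 0 \<le> a \<and> b \<le> 1 \<and> Q a \<longrightarrow> Q b"
      using d(1) step by (intro exI[of _ "d/2"] conjI allI impI) (simp, elim conjE, rule step)
  qed
  then show ?thesis using Q0 unfolding Q_def by simp
qed

text \<open>With the ends of the loops fixed, the endpoint of the strand starting at a given point
  varies continuously with the homotopy parameter but stays in the finite set \<open>P\<close>,
  hence is constant.\<close>

lemma monodromy:
  fixes h :: "real \<times> real \<Rightarrow> 'a set"
  assumes X: "Hausdorff_space X"
    and h: "continuous_map (top_of_set ({0..1} \<times> {0..1})) (Conf X A n) h"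
    and hP: "\<And>s. s \<in> {0..1} \<Longrightarrow> h (s, 0) = P" "\<And>s. s \<in> {0..1} \<Longrightarrow> h (s, 1) = P"
    and x: "continuous_map (top_of_set {0..1}) X x" "\<And>t. t \<in> {0..1} \<Longrightarrow> x t \<in> h (0, t)"
    and y: "continuous_map (top_of_set {0..1}) X y" "\<And>t. t \<in> {0..1} \<Longrightarrow> y t \<in> h (1, t)"
    and xy: "x 0 = y 0"
  shows "x 1 = y 1"
proof -
  define p where "p = x 0"
  have pP: "p \<in> P" using x(2)[of 0] hP(1)[of 0] by (simp add: p_def)
  have P: "P \<in> topspace (Conf X A n)"
    using continuous_map_image_subset_topspace[OF h] hP(1)[of 0] by force
  have hs: "continuous_map (top_of_set {0..1}) (Conf X A n) (\<lambda>t. h (s, t))" if "s \<in> {0..1}" for s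
  proof -
    have "continuous_map (top_of_set {0..1}) (top_of_set ({0..1} \<times> {0..1})) (\<lambda>t. (s, t))"
      unfolding continuous_map_in_subtopology using that by (auto intro!: continuous_intros)
    from continuous_map_compose[OF this h] show ?thesis by (simp add: comp_def)
  qed
  define L where "L s q \<longleftrightarrow> (\<exists>x. continuous_map (top_of_set {0..1}) X x \<and>
    (\<forall>t\<in>{0..1}. x t \<in> h (s, t)) \<and> x 0 = p \<and> x 1 = q)" for s q
  \<comment> \<open>Lets endpoints from different local lifts, and from the given strands
    \<open>x\<close> and \<open>y\<close>, be compared.\<close>
  have L_unique: "q = q'" if "L s q" "L s q'" "s \<in> {0..1}" for s q q'
  proof -
    obtain u where u: "continuous_map (top_of_set {0..1}) X u" "\<And>t. t \<in> {0..1} \<Longrightarrow> u t \<in> h (s, t)" "u 0 = p" "u 1 = q"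
      using \<open>L s q\<close> unfolding L_def by blast
    obtain v where v: "continuous_map (top_of_set {0..1}) X v" "\<And>t. t \<in> {0..1} \<Longrightarrow> v t \<in> h (s, t)" "v 0 = p" "v 1 = q'"
      using \<open>L s q'\<close> unfolding L_def by blast
    have "u 1 = v 1"
      by (rule section_unique[OF X hs[OF that(3)] u(1,2) v(1,2)]) (use u v in auto)
    then show ?thesis using u v by simp
  qed
  have "0 \<le> (0::real) \<and> (1::real) \<le> 1 \<and> L 0 (x 1) \<longrightarrow> L 1 (x 1)"
  proof (rule Bolzano[of 0 1 "\<lambda>a b. 0 \<le> a \<and> b \<le> 1 \<and> L a (x 1) \<longrightarrow> L b (x 1)"])
    show "(0::real) \<le> 1" by simp
    show "0 \<le> a \<and> c \<le> 1 \<and> L a (x 1) \<longrightarrow> L c (x 1)"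
      if "0 \<le> a \<and> b \<le> 1 \<and> L a (x 1) \<longrightarrow> L b (x 1)" "0 \<le> b \<and> c \<le> 1 \<and> L b (x 1) \<longrightarrow> L c (x 1)" "a \<le> b" "b \<le> c" for a b c
      using that by linarith
    fix s0 :: real assume s0: "0 \<le> s0" "s0 \<le> 1"
    have s0': "s0 \<in> {0..1}" using s0 by simp
    have "\<exists>e>0. \<exists>x. continuous_map (top_of_set (({0..1} \<inter> cball s0 e) \<times> {0..1})) X x \<and>
      (\<forall>s\<in>{0..1} \<inter> cball s0 e. \<forall>t\<in>{0..1}. x (s, t) \<in> h (s, t)) \<and>
      (\<forall>s\<in>{0..1} \<inter> cball s0 e. x (s, 0) = p)"
      by (rule local_section[OF X h _ pP s0']) (rule hP(1))
    then obtain e u where e: "e > 0"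
      and u0: "continuous_map (top_of_set (({0..1} \<inter> cball s0 e) \<times> {0..1})) X u"
        "\<forall>s\<in>{0..1} \<inter> cball s0 e. \<forall>t\<in>{0..1}. u (s, t) \<in> h (s, t)"
        "\<forall>s\<in>{0..1} \<inter> cball s0 e. u (s, 0) = p"
      by (elim exE conjE) (rule that)
    note u = u0(1) u0(2)[rule_format] u0(3)[rule_format]
    let ?S = "{0..1} \<inter> cball s0 e"
    have u1: "u (s, 1) = u (s', 1)" if "s \<in> ?S" "s' \<in> ?S" for s s'
    proof (rule continuous_map_finite_const[of "top_of_set ?S" X "\<lambda>s. u (s, 1)" P])
      have "convex ?S" by (intro convex_Int convex_cball) simp
      then show "connected_space (top_of_set ?S)" by (simp add: is_interval_convex_1)
      have "continuous_map (top_of_set ?S) (top_of_set (?S \<times> {0..1::real})) (\<lambda>s. (s, 1))"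
        unfolding continuous_map_in_subtopology by (auto intro!: continuous_intros)
      from continuous_map_compose[OF this u(1)]
      show "continuous_map (top_of_set ?S) X (\<lambda>s. u (s, 1))" by (simp add: comp_def)
      show "(\<lambda>s. u (s, 1)) ` topspace (top_of_set ?S) \<subseteq> P"
      proof (rule image_subsetI)
        fix s assume "s \<in> topspace (top_of_set ?S)"
        then have "s \<in> ?S" by simp
        then show "u (s, 1) \<in> P" using u(2)[of s 1] hP(2)[of s] by simp
      qed
    qed (use X that Conf_member(1)[OF P] in auto)
    have Lu: "L s (u (s, 1))" if "s \<in> ?S" for s
    proof -
      have "continuous_map (top_of_set {0..1}) (top_of_set (?S \<times> {0..1})) (\<lambda>t. (s, t))"
        unfolding continuous_map_in_subtopology using that by (auto intro!: continuous_intros)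
      from continuous_map_compose[OF this u(1)]
      have "continuous_map (top_of_set {0..1}) X (\<lambda>t. u (s, t))" by (simp add: comp_def)
      then show ?thesis unfolding L_def using u(2)[OF that] u(3)[OF that] by blast
    qed
    show "\<exists>d>0. \<forall>a b. a \<le> s0 \<and> s0 \<le> b \<and> b - a < d \<longrightarrow> 0 \<le> a \<and> b \<le> 1 \<and> L a (x 1) \<longrightarrow> L b (x 1)"
    proof (intro exI[of _ e] conjI e allI impI)
      fix a b assume ab: "a \<le> s0 \<and> s0 \<le> b \<and> b - a < e" and La: "0 \<le> a \<and> b \<le> 1 \<and> L a (x 1)"
      have S: "a \<in> ?S" "b \<in> ?S" using ab La s0 by (auto simp: dist_real_def)
      have "x 1 = u (a, 1)" by (rule L_unique[OF _ Lu[OF S(1)]]) (use La S in auto)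
      then show "L b (x 1)" using Lu[OF S(2)] u1[OF S] by simp
    qed
  qed
  moreover have "L 0 (x 1)" unfolding L_def using x by (intro exI[of _ x]) (simp add: p_def)
  ultimately have "L 1 (x 1)" by simp
  moreover have "L 1 (y 1)" unfolding L_def using y xy by (intro exI[of _ y]) (simp add: p_def)
  ultimately show ?thesis using L_unique[of 1] by simp
qed

section \<open>Twists\<close>

text \<open>A cutoff in the squared distance \<open>s\<close>, which keeps it differentiable at the
  centre. The squared positive part vanishes to first order at \<open>s = \<rho>\<^sup>2\<close>;
  the denominator normalizes the value to 1 at \<open>s = r\<^sup>2\<close>.\<close>

definition bump :: "real \<Rightarrow> real \<Rightarrow> real \<Rightarrow> real" where
  "bump \<rho> r s = (max 0 (1 - s / \<rho>\<^sup>2) / (1 - r\<^sup>2 / \<rho>\<^sup>2))\<^sup>2"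

definition bump' :: "real \<Rightarrow> real \<Rightarrow> real \<Rightarrow> real" where
  "bump' \<rho> r s = 2 * max 0 (1 - s / \<rho>\<^sup>2) / (1 - r\<^sup>2 / \<rho>\<^sup>2)\<^sup>2 * (- 1 / \<rho>\<^sup>2)"

text \<open>Only 0 needs an argument: there the difference quotient is at most the increment in
  absolute value.\<close>

lemma has_derivative_max_square:
  "((\<lambda>u::real. (max 0 u)\<^sup>2) has_field_derivative 2 * max 0 u) (at u)"
proof -
  consider "u > 0" | "u < 0" | "u = 0" by linarith
  then show ?thesis
  proof cases
    case 1
    have "((\<lambda>u::real. u\<^sup>2) has_field_derivative 2 * max 0 u) (at u)"
      using 1 by (auto intro!: derivative_eq_intros)
    then show ?thesis
      by (rule has_field_derivative_transform_within_open[of _ _ _ "{0<..}"]) (use 1 in auto)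
  next
    case 2
    have "((\<lambda>u::real. 0) has_field_derivative 2 * max 0 u) (at u)"
      using 2 by (auto intro!: derivative_eq_intros)
    then show ?thesis
      by (rule has_field_derivative_transform_within_open[of _ _ _ "{..<0}"]) (use 2 in auto)
  next
    case 3
    have "((\<lambda>h. (max 0 (0 + h))\<^sup>2 / h) \<longlongrightarrow> 0) (at (0::real))"
    proof (rule tendsto_0_le[of "\<lambda>h. h" _ _ 1])
      show "((\<lambda>h. h) \<longlongrightarrow> 0) (at (0::real))" by (rule tendsto_ident_at)
      have "norm ((max 0 (0 + h))\<^sup>2 / h) \<le> norm h * 1" for h :: real
        by (cases "h > 0") (auto simp: power2_eq_square max_def)
      then show "\<forall>\<^sub>F h in at (0::real). norm ((max 0 (0 + h))\<^sup>2 / h) \<le> norm h * 1" by simp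
    qed
    then show ?thesis unfolding 3 DERIV_def by simp
  qed
qed

lemma bump_deriv: "(bump \<rho> r has_field_derivative bump' \<rho> r s) (at s)"
proof -
  have "((\<lambda>s. (max 0 (1 - s / \<rho>\<^sup>2))\<^sup>2) has_field_derivative 2 * max 0 (1 - s / \<rho>\<^sup>2) * (- 1 / \<rho>\<^sup>2)) (at s)"
    using DERIV_chain2[OF has_derivative_max_square
        DERIV_diff[OF DERIV_const[of 1] DERIV_cdivide[OF DERIV_ident, of "\<rho>\<^sup>2"]]] by simp
  then have "((\<lambda>s. (max 0 (1 - s / \<rho>\<^sup>2))\<^sup>2 / (1 - r\<^sup>2 / \<rho>\<^sup>2)\<^sup>2) has_field_derivative
      2 * max 0 (1 - s / \<rho>\<^sup>2) * (- 1 / \<rho>\<^sup>2) / (1 - r\<^sup>2 / \<rho>\<^sup>2)\<^sup>2) (at s)"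
    by (rule DERIV_cdivide)
  moreover have "a * b / d = a / d * b" for a b d :: real by simp
  then have "2 * max 0 (1 - s / \<rho>\<^sup>2) * (- 1 / \<rho>\<^sup>2) / (1 - r\<^sup>2 / \<rho>\<^sup>2)\<^sup>2 = bump' \<rho> r s"
    unfolding bump'_def .
  moreover have "(\<lambda>s. (max 0 (1 - s / \<rho>\<^sup>2))\<^sup>2 / (1 - r\<^sup>2 / \<rho>\<^sup>2)\<^sup>2) = bump \<rho> r"
    by (simp add: fun_eq_iff bump_def power_divide)
  ultimately show ?thesis by simp
qed

lemma continuous_bump [continuous_intros]:
  "continuous_on S f \<Longrightarrow> continuous_on S (\<lambda>x. bump \<rho> r (f x))"
  "continuous_on S f \<Longrightarrow> continuous_on S (\<lambda>x. bump' \<rho> r (f x))"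
  unfolding bump_def bump'_def divide_inverse by (intro continuous_intros; assumption)+

lemma bump_0: "0 < \<rho> \<Longrightarrow> \<rho>\<^sup>2 \<le> s \<Longrightarrow> bump \<rho> r s = 0"
  by (simp add: bump_def field_simps)

lemma bump_1: "0 < r \<Longrightarrow> r < \<rho> \<Longrightarrow> bump \<rho> r (r\<^sup>2) = 1"
  by (simp add: bump_def power_strict_mono field_simps max_def)

definition rot :: "real \<Rightarrow> real^2 \<Rightarrow> real^2" where
  "rot a v = vector [cos a * v$1 - sin a * v$2, sin a * v$1 + cos a * v$2]"

lemma rot_nth [simp]:
  "rot a v $ 1 = cos a * v$1 - sin a * v$2" "rot a v $ 2 = sin a * v$1 + cos a * v$2"
  by (simp_all add: rot_def)

lemma rot_add: "rot a (rot b v) = rot (a + b) v"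
  by (simp add: vec_eq_iff forall_2 cos_add sin_add algebra_simps)

lemma rot_0 [simp]: "rot 0 v = v"
  by (simp add: vec_eq_iff forall_2)

lemma norm_square_2: "(norm (v::real^2))\<^sup>2 = (v$1)\<^sup>2 + (v$2)\<^sup>2"
  by (simp add: norm_vec_def L2_set_def sum_2)

lemma norm_rot [simp]: "norm (rot a v) = norm v"
proof -
  have "(norm (rot a v))\<^sup>2 = ((cos a)\<^sup>2 + (sin a)\<^sup>2) * (norm v)\<^sup>2"
  proof -
    have "(c * x - s * y)\<^sup>2 + (s * x + c * y)\<^sup>2 = (c\<^sup>2 + s\<^sup>2) * (x\<^sup>2 + y\<^sup>2)" for c s x y :: real
      by algebra
    then show ?thesis unfolding norm_square_2 rot_nth .
  qed
  then have "(norm (rot a v))\<^sup>2 = (norm v)\<^sup>2" by simp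
  then show ?thesis by (simp only: power2_eq_iff_nonneg norm_ge_zero)
qed

text \<open>A rotation about \<open>z\<close> whose angle depends only on the distance to
  \<open>z\<close>. As distances to \<open>z\<close> are preserved, angles add under composition and
  the inverse is the twist by \<open>-\<theta>\<close>.\<close>

definition twist :: "real^2 \<Rightarrow> real \<Rightarrow> real \<Rightarrow> real \<Rightarrow> real^2 \<Rightarrow> real^2" where
  "twist z \<rho> r \<theta> x = z + rot (\<theta> * bump \<rho> r ((norm (x - z))\<^sup>2)) (x - z)"

text \<open>The product rule gives the rotation matrix plus a matrix of rank one: the column
  \<open>(- f$2, f$1)\<close> is the derivative of the rotated vector in the angle, the row
  \<open>k * v\<close> is the gradient of the angle.\<close>

definition twist_jacobian :: "real^2 \<Rightarrow> real \<Rightarrow> real \<Rightarrow> real \<Rightarrow> real^2 \<Rightarrow> real^2^2" where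
  "twist_jacobian z \<rho> r \<theta> x =
    (let v = x - z; a = \<theta> * bump \<rho> r ((norm v)\<^sup>2); k = 2 * \<theta> * bump' \<rho> r ((norm v)\<^sup>2); f = rot a v
     in vector [vector [cos a - f$2 * k * v$1, - sin a - f$2 * k * v$2],
                vector [sin a + f$1 * k * v$1, cos a + f$1 * k * v$2]])"

lemma norm_twist: "norm (twist z \<rho> r \<theta> x - z) = norm (x - z)"
  by (simp add: twist_def)

lemma twist_add: "twist z \<rho> r \<theta> (twist z \<rho> r \<eta> x) = twist z \<rho> r (\<theta> + \<eta>) x"
  by (simp add: twist_def rot_add distrib_right)

lemma twist_0 [simp]: "twist z \<rho> r 0 x = x"
  by (simp add: twist_def)

lemma twist_outside: "0 < \<rho> \<Longrightarrow> \<rho> \<le> norm (x - z) \<Longrightarrow> twist z \<rho> r \<theta> x = x"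
  by (simp add: twist_def bump_0 power_mono)

lemma twist_on_circle: "0 < r \<Longrightarrow> r < \<rho> \<Longrightarrow> norm (x - z) = r \<Longrightarrow> twist z \<rho> r \<theta> x = z + rot \<theta> (x - z)"
  by (simp add: twist_def bump_1)

text \<open>The correction of rank one does not change the determinant: the gradient of the angle is
  radial, while the column, rotated back, is tangential.\<close>

lemma det_twist_jacobian: "det (twist_jacobian z \<rho> r \<theta> x) = 1"
proof -
  have *: "(c - (s * v1 + c * v2) * k * v1) * (c + (c * v1 - s * v2) * k * v2) -
     (- s - (s * v1 + c * v2) * k * v2) * (s + (c * v1 - s * v2) * k * v1) = s\<^sup>2 + c\<^sup>2"
    for c s v1 v2 k :: real by algebra
  show ?thesis
    by (simp add: twist_jacobian_def Let_def det_2 * del: sin_cos_squared_add sin_cos_squared_add2) simp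
qed

lemma has_derivative_vec_nth_2: "((\<lambda>x::real^2. x $ i) has_derivative (\<lambda>h. h $ i)) F"
  by (rule bounded_linear_imp_has_derivative[OF bounded_linear_vec_nth])

lemma twist_has_derivative:
  "(twist z \<rho> r \<theta> has_derivative (\<lambda>h. twist_jacobian z \<rho> r \<theta> x *v h)) (at x)"
proof -
  let ?s = "\<lambda>x::real^2. (x$1 - z$1)\<^sup>2 + (x$2 - z$2)\<^sup>2"
  let ?a = "\<lambda>x. \<theta> * bump \<rho> r (?s x)"
  let ?f1 = "\<lambda>x::real^2. cos (?a x) * (x$1 - z$1) - sin (?a x) * (x$2 - z$2)"
  let ?f2 = "\<lambda>x::real^2. sin (?a x) * (x$1 - z$1) + cos (?a x) * (x$2 - z$2)"
  let ?k = "2 * \<theta> * bump' \<rho> r (?s x)"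
  let ?da = "\<lambda>h::real^2. ?k * ((x$1 - z$1) * h$1 + (x$2 - z$2) * h$2)"
  have n: "(norm (y - z))\<^sup>2 = ?s y" for y by (simp add: norm_square_2)
  have s: "(?s has_derivative (\<lambda>h. 2 * ((x$1 - z$1) * h$1 + (x$2 - z$2) * h$2))) (at x)"
    by (auto intro!: derivative_eq_intros has_derivative_vec_nth_2 simp: power2_eq_square algebra_simps)
  have "((\<lambda>x. bump \<rho> r (?s x)) has_derivative
      (\<lambda>h. 2 * ((x$1 - z$1) * h$1 + (x$2 - z$2) * h$2) * bump' \<rho> r (?s x))) (at x)"
    by (rule DERIV_compose_FDERIV[OF bump_deriv s])
  then have "(?a has_derivative (\<lambda>h. \<theta> * (2 * ((x$1 - z$1) * h$1 + (x$2 - z$2) * h$2) * bump' \<rho> r (?s x)))) (at x)"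
    by (rule has_derivative_mult_right)
  then have a: "(?a has_derivative ?da) (at x)"
    by (rule has_derivative_eq_rhs) (simp add: fun_eq_iff algebra_simps)
  have c: "((\<lambda>x. cos (?a x)) has_derivative (\<lambda>h. ?da h * - sin (?a x))) (at x)"
    by (rule DERIV_compose_FDERIV[OF DERIV_cos a])
  have si: "((\<lambda>x. sin (?a x)) has_derivative (\<lambda>h. ?da h * cos (?a x))) (at x)"
    by (rule DERIV_compose_FDERIV[OF DERIV_sin a])
  have v: "((\<lambda>x. x$i - z$i) has_derivative (\<lambda>h. h$i)) (at x)" for i
    using has_derivative_diff[OF has_derivative_vec_nth_2 has_derivative_const] by simp
  have f1: "(?f1 has_derivative (\<lambda>h. cos (?a x) * h$1 - sin (?a x) * h$2 - ?f2 x * ?da h)) (at x)"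
    by (rule has_derivative_eq_rhs[OF has_derivative_diff[OF has_derivative_mult[OF c v] has_derivative_mult[OF si v]]])
      (simp add: fun_eq_iff algebra_simps)
  have f2: "(?f2 has_derivative (\<lambda>h. sin (?a x) * h$1 + cos (?a x) * h$2 + ?f1 x * ?da h)) (at x)"
    by (rule has_derivative_eq_rhs[OF has_derivative_add[OF has_derivative_mult[OF si v] has_derivative_mult[OF c v]]])
      (simp add: fun_eq_iff algebra_simps)
  have eq: "twist z \<rho> r \<theta> = (\<lambda>x. z + (?f1 x *\<^sub>R axis 1 1 + ?f2 x *\<^sub>R axis 2 1))"
    by (simp add: fun_eq_iff vec_eq_iff forall_2 twist_def n axis_def)
  show ?thesis
    unfolding eq
    by (rule has_derivative_eq_rhs[OF has_derivative_add[OF has_derivative_const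
            has_derivative_add[OF has_derivative_scaleR_left[OF f1] has_derivative_scaleR_left[OF f2]]]])
      (simp add: fun_eq_iff vec_eq_iff forall_2 twist_jacobian_def Let_def n axis_def
        matrix_vector_mult_def sum_2 algebra_simps)
qed

lemma continuous_rot:
  fixes f :: "'b::t2_space \<Rightarrow> real"
  shows "continuous_on S f \<Longrightarrow> continuous_on S g \<Longrightarrow> continuous_on S (\<lambda>x. rot (f x) (g x))"
proof -
  assume fg: "continuous_on S f" "continuous_on S g"
  have eq: "rot (f x) (g x) = (cos (f x) * g x $ 1 - sin (f x) * g x $ 2) *\<^sub>R axis 1 1 +
      (sin (f x) * g x $ 1 + cos (f x) * g x $ 2) *\<^sub>R axis 2 1" for x
    by (simp add: vec_eq_iff forall_2 axis_def)
  show "continuous_on S (\<lambda>x. rot (f x) (g x))"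
    unfolding eq by (intro continuous_intros fg)
qed

lemma continuous_twist: "continuous_on UNIV (\<lambda>p. twist z \<rho> r (fst p) (snd p))"
  unfolding twist_def by (intro continuous_intros continuous_rot)

lemma continuous_on_matrix:
  fixes f :: "'b::topological_space \<Rightarrow> real^2^2"
  assumes "\<And>i j. continuous_on S (\<lambda>x. f x $ i $ j)"
  shows "continuous_on S f"
proof -
  have "continuous_on S (\<lambda>x. \<chi> i. \<chi> j. f x $ i $ j)"
    by (intro continuous_on_vec_lambda assms)
  then show ?thesis by simp
qed

lemma continuous_twist_jacobian: "continuous_on UNIV (\<lambda>p. twist_jacobian z \<rho> r (fst p) (snd p))"
proof (rule continuous_on_matrix)
  fix i j :: 2
  consider "i = 1" "j = 1" | "i = 1" "j = 2" | "i = 2" "j = 1" | "i = 2" "j = 2"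
    using exhaust_2 by metis
  then show "continuous_on UNIV (\<lambda>p. twist_jacobian z \<rho> r (fst p) (snd p) $ i $ j)"
    by cases (simp_all add: twist_jacobian_def Let_def, (intro continuous_intros)+)
qed

context oriented_surface
begin

text \<open>A change of charts sending an interior point to the boundary line would have a minimum of its
  second coordinate there, hence a singular derivative.\<close>

lemma chart_interior_not_boundary:
  assumes c: "c \<in> A" "p \<in> fst c" and pos: "0 < snd c p $ 2"
  shows "p \<notin> surface_boundary X A"
proof
  assume "p \<in> surface_boundary X A"
  then obtain d where d: "d \<in> A" "p \<in> fst d" "snd d p $ 2 = 0" by (auto simp: surface_boundary_def)
  note ch = atlas_chart[OF c(1)] and dh = atlas_chart[OF d(1)]
  let ?v = "snd c p" and ?g = "local_rep c d id" and ?J = "local_jacobian c d id p"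
  have "openin (top_of_set half_plane) (snd c ` (fst c \<inter> fst d))"
    by (rule chart_openin_image[OF ch openin_Int[OF chart_openin[OF ch] chart_openin[OF dh]]]) simp
  then obtain T where T: "open T" "snd c ` (fst c \<inter> fst d) = half_plane \<inter> T" by (auto simp: openin_open)
  \<comment> \<open>On this open set the derivative within the half-plane is an ordinary one, so the
    criterion for an extremum applies.\<close>
  define S where "S = {v. 0 < v $ 2} \<inter> T"
  have S: "open S" unfolding S_def by (intro open_Int T(1) open_halfspace_component_gt_cart)
  have "?v \<in> half_plane \<inter> T" using c(2) d(2) unfolding T(2)[symmetric] by blast
  then have vS: "?v \<in> S" using pos by (simp add: S_def)
  have Ssub: "S \<subseteq> snd c ` (fst c \<inter> fst d)" unfolding T(2) S_def by (auto simp: half_plane_def)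
  have "at ?v within half_plane = at ?v"
    by (rule at_within_open_subset[OF vS S]) (auto simp: S_def half_plane_def)
  then have g: "(?g has_derivative (\<lambda>h. ?J *v h)) (at ?v)"
    using transition(1)[OF c(1) d(1) c(2) d(2)] by (simp add: chart_deriv_def)
  have d2: "((\<lambda>v. ?g v $ 2) has_derivative (\<lambda>h. (?J *v h) $ 2)) (at ?v)"
    using bounded_linear.has_derivative[OF bounded_linear_vec_nth g] .
  have m: "\<forall>y\<in>S. ?g ?v $ 2 \<le> ?g y $ 2"
  proof
    fix y assume "y \<in> S"
    then obtain q where q: "q \<in> fst c" "q \<in> fst d" "y = snd c q" using Ssub by blast
    have "?g y = snd d q" using local_rep_apply[OF ch q(1)] q(3) by simp
    moreover have "?g ?v = snd d p" using local_rep_apply[OF ch c(2)] by simp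
    ultimately show "?g ?v $ 2 \<le> ?g y $ 2"
      using d(3) chart_in_half_plane[OF dh q(2)] by (simp add: half_plane_def)
  qed
  have "(\<lambda>h. (?J *v h) $ 2) = (\<lambda>h. 0)"
    by (rule differential_zero_maxmin[OF vS S d2 disjI2[OF m]])
  then have "(?J *v h) $ 2 = 0" for h by (rule fun_cong)
  then have "(?J *v axis 1 1) $ 2 = 0" "(?J *v axis 2 1) $ 2 = 0" by blast+
  then have "?J $ 2 $ 1 = 0" "?J $ 2 $ 2 = 0"
    by (simp_all add: matrix_vector_mult_basis column_def)
  then have "det ?J = 0" by (simp add: det_2)
  then show False using transition(2)[OF c(1) d(1) c(2) d(2)] by simp
qed

end

section \<open>Twists carried to the surface by a chart\<close>

locale twist_disc = oriented_surface X A
  for X :: "'a topology" and A :: "'a chart set" +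
  fixes c :: "'a chart" and z :: "real^2" and \<rho> r :: real
  assumes c: "c \<in> A" and \<rho>: "0 < \<rho>"
    and disc: "cball z \<rho> \<subseteq> snd c ` fst c" and pos: "\<And>v. v \<in> cball z \<rho> \<Longrightarrow> 0 < v $ 2"
begin

lemma ch: "is_chart X c" by (rule atlas_chart[OF c])

abbreviation T :: "real \<Rightarrow> real^2 \<Rightarrow> real^2" where "T \<equiv> twist z \<rho> r"

text \<open>The value \<open>undefined\<close> off the surface makes the map extensional, as
  membership in \<open>Bij\<close> requires.\<close>

definition chart_twist :: "real \<Rightarrow> 'a \<Rightarrow> 'a" where
  "chart_twist \<theta> p =
    (if p \<in> fst c then inv_into (fst c) (snd c) (T \<theta> (snd c p))
     else if p \<in> topspace X then p else undefined)"

lemma T_image: "v \<in> snd c ` fst c \<Longrightarrow> T \<theta> v \<in> snd c ` fst c"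
proof (cases "norm (v - z) < \<rho>")
  case True
  then have "T \<theta> v \<in> cball z \<rho>" using norm_twist[of z \<rho> r \<theta> v] by (simp add: dist_norm norm_minus_commute)
  then show ?thesis using disc by blast
next
  case False
  assume "v \<in> snd c ` fst c"
  then show ?thesis using False twist_outside[OF \<rho>, of v z r \<theta>] by simp
qed

lemma chart_twist_in:
  assumes "p \<in> fst c"
  shows "chart_twist \<theta> p \<in> fst c" "snd c (chart_twist \<theta> p) = T \<theta> (snd c p)"
proof -
  have "T \<theta> (snd c p) \<in> snd c ` fst c" using T_image assms by blast
  then show "chart_twist \<theta> p \<in> fst c" "snd c (chart_twist \<theta> p) = T \<theta> (snd c p)"
    using assms by (simp_all add: chart_twist_def inv_into_into f_inv_into_f)
qed

lemma chart_twist_out: "p \<in> topspace X \<Longrightarrow> p \<notin> fst c \<Longrightarrow> chart_twist \<theta> p = p"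
  by (simp add: chart_twist_def)

lemma chart_twist_fixed:
  assumes "p \<in> topspace X" "p \<in> fst c \<Longrightarrow> \<rho> \<le> norm (snd c p - z)"
  shows "chart_twist \<theta> p = p"
  using assms twist_outside[OF \<rho>] chart_inv[OF ch] by (simp add: chart_twist_def)

lemma chart_twist_topspace: "p \<in> topspace X \<Longrightarrow> chart_twist \<theta> p \<in> topspace X"
  using chart_twist_in(1) chart_twist_out chart_subset[OF ch] by (metis subsetD)

lemma chart_twist_add:
  assumes p: "p \<in> topspace X"
  shows "chart_twist \<theta> (chart_twist \<eta> p) = chart_twist (\<theta> + \<eta>) p"
proof (cases "p \<in> fst c")
  case True
  have "snd c (chart_twist \<theta> (chart_twist \<eta> p)) = snd c (chart_twist (\<theta> + \<eta>) p)"
    using True by (simp add: chart_twist_in twist_add)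
  then show ?thesis using inj_onD[OF chart_inj[OF ch]] chart_twist_in(1) True by metis
next
  case False
  then show ?thesis using p by (simp add: chart_twist_out)
qed

lemma chart_twist_0: "chart_twist 0 = restrict id (topspace X)"
  using chart_subset[OF ch] by (auto simp: fun_eq_iff chart_twist_def chart_inv[OF ch])

lemma chart_twist_Bij: "chart_twist \<theta> \<in> Bij (topspace X)"
proof -
  have "bij_betw (chart_twist \<theta>) (topspace X) (topspace X)"
    by (rule bij_betw_byWitness[of _ "chart_twist (-\<theta>)"])
      (use chart_twist_add chart_twist_0 chart_twist_topspace in auto)
  moreover have "chart_twist \<theta> \<in> extensional (topspace X)"
    using chart_subset[OF ch] by (auto simp: extensional_def chart_twist_def)
  ultimately show ?thesis by (simp add: Bij_def)
qed

text \<open>Compactness makes the disc closed in the whole surface and not merely in the chart. Its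
  complement and the chart domain therefore form an open cover, on which the twist is respectively
  the identity and given by a formula.\<close>

definition disc_set :: "'a set" where
  "disc_set = inv_into (fst c) (snd c) ` cball z \<rho>"

lemma disc_set_closed: "closedin X disc_set"
proof -
  have "compactin (top_of_set (snd c ` fst c)) (cball z \<rho>)"
    using disc by (simp add: compactin_subtopology)
  then have "compactin X disc_set"
    unfolding disc_set_def by (rule image_compactin[OF _ chart_inv_continuous[OF ch]])
  then show ?thesis using Hausdorff compactin_imp_closedin by blast
qed

lemma disc_set_iff: "p \<in> fst c \<Longrightarrow> p \<in> disc_set \<longleftrightarrow> snd c p \<in> cball z \<rho>"
proof -
  assume p: "p \<in> fst c"
  have "p \<in> disc_set" if "snd c p \<in> cball z \<rho>"
    unfolding disc_set_def by (rule image_eqI[OF _ that]) (simp add: chart_inv[OF ch p])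
  moreover have "snd c p \<in> cball z \<rho>" if m: "p \<in> disc_set"
  proof -
    obtain v where v: "v \<in> cball z \<rho>" "p = inv_into (fst c) (snd c) v" using m unfolding disc_set_def by blast
    then have "snd c p = v" using f_inv_into_f[of v "snd c" "fst c"] disc by blast
    then show ?thesis using v by simp
  qed
  ultimately show ?thesis by blast
qed

lemma disc_set_subset: "disc_set \<subseteq> fst c"
  unfolding disc_set_def using disc by (auto intro: inv_into_into)

lemma chart_twist_off_disc: "p \<in> topspace X \<Longrightarrow> p \<notin> disc_set \<Longrightarrow> chart_twist \<theta> p = p"
  by (rule chart_twist_fixed) (auto simp: disc_set_iff dist_norm norm_minus_commute)

abbreviation P :: "(real \<times> 'a) topology" where "P \<equiv> prod_topology euclideanreal X"

lemma open_cover: "openin P (UNIV \<times> fst c)" "openin P (UNIV \<times> (topspace X - disc_set))"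
  by (simp_all add: openin_prod_Times_iff chart_openin[OF ch] openin_diff disc_set_closed)

lemma coord_continuous: "continuous_map (subtopology P (UNIV \<times> fst c)) euclidean (\<lambda>w. (fst w, snd c (snd w)))"
proof -
  have 1: "continuous_map (subtopology P (UNIV \<times> fst c)) (subtopology X (fst c)) snd"
    unfolding continuous_map_in_subtopology
    using continuous_map_from_subtopology[OF continuous_map_snd] by auto
  have "continuous_map (subtopology P (UNIV \<times> fst c)) euclidean (\<lambda>w. snd c (snd w))"
    using continuous_map_compose[OF 1 chart_continuous[OF ch]] by (simp add: comp_def)
  moreover have "continuous_map (subtopology P (UNIV \<times> fst c)) euclideanreal fst"
    by (rule continuous_map_from_subtopology[OF continuous_map_fst])
  ultimately have "continuous_map (subtopology P (UNIV \<times> fst c)) (prod_topology euclideanreal euclidean)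
      (\<lambda>w. (fst w, snd c (snd w)))"
    unfolding continuous_map_paired by blast
  then show ?thesis by simp
qed

lemma chart_twist_continuous_in:
  "continuous_map (subtopology P (UNIV \<times> fst c)) X (\<lambda>w. chart_twist (fst w) (snd w))"
proof -
  have "continuous_map (subtopology P (UNIV \<times> fst c)) euclidean
      ((\<lambda>w. T (fst w) (snd w)) \<circ> (\<lambda>w. (fst w, snd c (snd w))))"
    by (rule continuous_map_compose[OF coord_continuous]) (simp add: continuous_twist)
  then have "continuous_map (subtopology P (UNIV \<times> fst c)) (top_of_set (snd c ` fst c))
      ((\<lambda>w. T (fst w) (snd w)) \<circ> (\<lambda>w. (fst w, snd c (snd w))))"
    using T_image by (auto simp: continuous_map_in_subtopology)
  from continuous_map_compose[OF this chart_inv_continuous[OF ch]]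
  show ?thesis
    by (rule continuous_map_eq) (auto simp: chart_twist_def)
qed

lemma chart_twist_continuous: "continuous_map P X (\<lambda>w. chart_twist (fst w) (snd w))"
proof (rule continuous_map_open_cover)
  fix w assume w: "w \<in> topspace P"
  show "\<exists>U. openin P U \<and> w \<in> U \<and> continuous_map (subtopology P U) X (\<lambda>w. chart_twist (fst w) (snd w))"
  proof (cases "snd w \<in> fst c")
    case True
    then have "w \<in> UNIV \<times> fst c" by (simp add: mem_Times_iff)
    then show ?thesis using open_cover(1) chart_twist_continuous_in by blast
  next
    case False
    then have "w \<in> UNIV \<times> (topspace X - disc_set)" using w disc_set_subset by (auto simp: mem_Times_iff)
    moreover have "continuous_map (subtopology P (UNIV \<times> (topspace X - disc_set))) X (\<lambda>w. chart_twist (fst w) (snd w))"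
      by (rule continuous_map_eq[OF continuous_map_from_subtopology[OF continuous_map_snd]])
        (auto simp: chart_twist_off_disc)
    ultimately show ?thesis using open_cover(2) by blast
  qed
qed

lemma chart_twist_deriv:
  assumes p: "p \<in> fst c"
  shows "chart_deriv c c (chart_twist s) p (twist_jacobian z \<rho> r s (snd c p))"
proof -
  have at: "at (snd c p) within snd c ` fst c = at (snd c p) within half_plane"
    using ch p by (intro at_within_half_plane) (auto simp: is_chart_def)
  have "(T s has_derivative (\<lambda>h. twist_jacobian z \<rho> r s (snd c p) *v h)) (at (snd c p) within snd c ` fst c)"
    by (rule has_derivative_at_withinI[OF twist_has_derivative])
  then have "(local_rep c c (chart_twist s) has_derivative (\<lambda>h. twist_jacobian z \<rho> r s (snd c p) *v h))
      (at (snd c p) within snd c ` fst c)"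
    by (rule has_derivative_transform[rotated 2])
      (use p in \<open>auto simp: local_rep_apply[OF ch] chart_twist_in\<close>)
  then show ?thesis unfolding chart_deriv_def at .
qed

lemma transition_continuous:
  assumes d: "d \<in> A" "e \<in> A" and f: "continuous_map Y X f" "f ` topspace Y \<subseteq> fst d \<inter> fst e"
  shows "continuous_map Y euclidean (\<lambda>y. local_jacobian d e id (f y))"
proof -
  have "continuous_map Y (subtopology X (fst d \<inter> fst e)) f"
    using f by (auto simp: continuous_map_in_subtopology)
  from continuous_map_compose[OF this transition(3)[OF d]] show ?thesis by (simp add: comp_def)
qed

text \<open>On the domain of \<open>c\<close> the map is read from \<open>a\<close> to
  \<open>c\<close>, twisted, and read from \<open>c\<close> to \<open>b\<close>; off the disc it is
  a change of charts. All factors have positive determinant.\<close>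

theorem chart_twist_family: "C1_family X A chart_twist"
proof (rule C1_familyI[OF chart_twist_continuous])
  fix a b t p assume a: "a \<in> A" and b: "b \<in> A" and p: "p \<in> fst a" "chart_twist t p \<in> fst b"
  note ach = atlas_chart[OF a]
  have pX: "p \<in> topspace X" using chart_subset[OF ach] p(1) by blast
  let ?O = "overlap_family a b chart_twist"
  show "\<exists>W J. openin P W \<and> (t, p) \<in> W \<and>
      (\<forall>s q. (s, q) \<in> W \<inter> ?O \<longrightarrow> chart_deriv a b (chart_twist s) q (J (s, q)) \<and> 0 < det (J (s, q))) \<and>
      continuous_map (subtopology P (W \<inter> ?O)) euclidean J"
  proof (cases "p \<in> fst c")
    case True
    let ?W = "UNIV \<times> fst c"
    let ?J = "\<lambda>w. local_jacobian c b id (chart_twist (fst w) (snd w)) **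
      (twist_jacobian z \<rho> r (fst w) (snd c (snd w)) ** local_jacobian a c id (snd w))"
    have "chart_deriv a b (chart_twist s) q (?J (s, q)) \<and> 0 < det (?J (s, q))"
      if "(s, q) \<in> ?W \<inter> ?O" for s q
    proof
      have q: "q \<in> fst c" "q \<in> fst a" "chart_twist s q \<in> fst b" using that by (auto simp: overlap_family_def)
      note tq = chart_twist_in(1)[OF q(1)]
      have 1: "chart_deriv a c (chart_twist s \<circ> id) q
          (twist_jacobian z \<rho> r s (snd c q) ** local_jacobian a c id q)"
        by (rule chart_deriv_compose[OF ach ch continuous_map_id q(2) _ transition(1)[OF a c q(2,1)]])
          (use q chart_twist_deriv[OF q(1)] in simp_all)
      have "chart_deriv a b (id \<circ> (chart_twist s \<circ> id)) q (?J (s, q))"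
        unfolding fst_conv snd_conv
        by (rule chart_deriv_compose[OF ach ch _ q(2) _ 1])
          (use q tq joint_continuous_slice[OF chart_twist_continuous] transition(1)[OF c b tq q(3)] in simp_all)
      then show "chart_deriv a b (chart_twist s) q (?J (s, q))" by simp
      show "0 < det (?J (s, q))"
        using transition(2)[OF c b tq q(3)] transition(2)[OF a c q(2,1)]
        by (simp add: det_mul det_twist_jacobian)
    qed
    moreover have "continuous_map (subtopology P (?W \<inter> ?O)) euclidean ?J"
    proof (intro continuous_map_matrix_mult)
      have sub: "topspace (subtopology P (?W \<inter> ?O)) \<subseteq> ?W \<inter> ?O" by auto
      have O: "snd w \<in> fst c \<and> snd w \<in> fst a \<and> chart_twist (fst w) (snd w) \<in> fst b" if "w \<in> ?W \<inter> ?O" for w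
        using that by (auto simp: overlap_family_def)
      show "continuous_map (subtopology P (?W \<inter> ?O)) euclidean (\<lambda>w. local_jacobian c b id (chart_twist (fst w) (snd w)))"
        by (rule transition_continuous[OF c b continuous_map_from_subtopology[OF chart_twist_continuous]])
          (use sub O chart_twist_in(1) in blast)
      show "continuous_map (subtopology P (?W \<inter> ?O)) euclidean (\<lambda>w. local_jacobian a c id (snd w))"
        by (rule transition_continuous[OF a c continuous_map_from_subtopology[OF continuous_map_snd]])
          (use sub O in blast)
      have "continuous_map (subtopology P (?W \<inter> ?O)) euclidean
        ((\<lambda>w. twist_jacobian z \<rho> r (fst w) (snd w)) \<circ> (\<lambda>w. (fst w, snd c (snd w))))"
        by (rule continuous_map_compose[OF continuous_map_from_subtopology_mono[OF coord_continuous]])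
          (simp_all add: continuous_twist_jacobian)
      then show "continuous_map (subtopology P (?W \<inter> ?O)) euclidean (\<lambda>w. twist_jacobian z \<rho> r (fst w) (snd c (snd w)))"
        by (simp add: comp_def)
    qed
    moreover have "(t, p) \<in> ?W" using True by simp
    ultimately show ?thesis using open_cover(1) by (intro exI[of _ ?W] exI[of _ ?J]) blast
  next
    case False
    let ?W = "UNIV \<times> (topspace X - disc_set)"
    let ?J = "\<lambda>w. local_jacobian a b id (snd w)"
    have op: "openin X (topspace X - disc_set)" using disc_set_closed by blast
    have "chart_deriv a b (chart_twist s) q (?J (s, q)) \<and> 0 < det (?J (s, q))"
      if "(s, q) \<in> ?W \<inter> ?O" for s q
    proof -
      have q: "q \<in> topspace X - disc_set" "q \<in> fst a" "chart_twist s q \<in> fst b" using that by (auto simp: overlap_family_def)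
      then have qb: "q \<in> fst b" using chart_twist_off_disc[of q s] by simp
      have "chart_deriv a b (chart_twist s) q (local_jacobian a b id q)"
        by (rule chart_deriv_cong[OF ach op q(1,2) _ transition(1)[OF a b q(2) qb]])
          (simp add: chart_twist_off_disc)
      then show ?thesis using transition(2)[OF a b q(2) qb] by simp
    qed
    moreover have "continuous_map (subtopology P (?W \<inter> ?O)) euclidean ?J"
    proof (rule transition_continuous[OF a b continuous_map_from_subtopology[OF continuous_map_snd]])
      show "snd ` topspace (subtopology P (?W \<inter> ?O)) \<subseteq> fst a \<inter> fst b"
        using chart_twist_off_disc by (auto simp: overlap_family_def)
    qed
    moreover have "(t, p) \<in> ?W" using False pX disc_set_subset by auto
    ultimately show ?thesis using open_cover(2) by (intro exI[of _ ?W] exI[of _ ?J]) blast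
  qed
qed

lemma chart_twist_Diff: "chart_twist \<theta> \<in> Diff X A"
proof (rule DiffI[OF chart_twist_Bij])
  have const: "C1_family X A (\<lambda>_. chart_twist \<eta>)" for \<eta>
  proof (rule C1_family_const[OF C1_family_slice[OF chart_twist_family]])
    fix a b assume ab: "a \<in> A" "b \<in> A"
    have "continuous_map (subtopology X (fst a \<inter> chart_twist \<eta> -` fst b)) (subtopology P (overlap_family a b chart_twist)) (\<lambda>p. (\<eta>, p))"
      unfolding continuous_map_in_subtopology
      by (auto simp: overlap_family_def continuous_map_paired continuous_map_from_subtopology)
    from continuous_map_compose[OF this C1_familyD(3)[OF chart_twist_family ab]]
    have "continuous_map (subtopology X (fst a \<inter> chart_twist \<eta> -` fst b)) euclidean (local_jacobian a b (chart_twist \<eta>))"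
      by (simp add: comp_def)
    then show "C1_on (local_dom a b (chart_twist \<eta>)) (local_rep a b (chart_twist \<eta>))"
      unfolding C1_on_iff[OF atlas_chart[OF ab(1)] atlas_chart[OF ab(2)] C1_family_slice[OF chart_twist_family]]
      using C1_familyD(1)[OF chart_twist_family ab] by blast
    show "0 < det (local_jacobian a b (chart_twist \<eta>) p)" if "p \<in> fst a" "chart_twist \<eta> p \<in> fst b" for p
      by (rule C1_familyD(2)[OF chart_twist_family ab that])
  qed
  show "C1_family X A (\<lambda>_. chart_twist \<theta>)" "C1_family X A (\<lambda>_. chart_twist (-\<theta>))" by (rule const)+
  show "chart_twist (-\<theta>) (chart_twist \<theta> p) = p" if "p \<in> topspace X" for p
    using chart_twist_add[OF that, of "-\<theta>" \<theta>] that by (simp add: chart_twist_0)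
qed

theorem chart_twist_Diff_rel: "chart_twist \<theta> \<in> Diff_rel X A"
proof -
  have "chart_twist \<theta> p = p" if p: "p \<in> surface_boundary X A" for p
  proof (rule chart_twist_off_disc)
    show "p \<in> topspace X" using p surface_boundary_subset by blast
    show "p \<notin> disc_set"
    proof
      assume "p \<in> disc_set"
      then have "p \<in> fst c" "0 < snd c p $ 2" using disc_set_subset disc_set_iff pos by auto
      then show False using chart_interior_not_boundary[OF c] p by blast
    qed
  qed
  then show ?thesis using chart_twist_Diff by (simp add: Diff_rel_def)
qed

end

section \<open>Moving points by diffeomorphisms\<close>

text \<open>Removing a set that nowhere separates locally does not disconnect. A separation of
  \<open>Y\<close> would extend to \<open>X\<close>: every small \<open>N\<close> meets
  \<open>Y\<close> in a nonempty connected set, hence belongs to exactly one side.\<close>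

lemma connectedin_locally_dense:
  assumes X: "connected_space X" and Y: "Y \<subseteq> topspace X"
    and N: "\<And>z W. openin X W \<Longrightarrow> z \<in> W \<Longrightarrow>
      \<exists>N. openin X N \<and> z \<in> N \<and> N \<subseteq> W \<and> connectedin X (N \<inter> Y) \<and> N \<inter> Y \<noteq> {}"
  shows "connectedin X Y"
proof (rule ccontr)
  assume "\<not> connectedin X Y"
  then obtain E1 E2 where E: "openin X E1" "openin X E2" "Y \<subseteq> E1 \<union> E2" "E1 \<inter> E2 \<inter> Y = {}"
    "E1 \<inter> Y \<noteq> {}" "E2 \<inter> Y \<noteq> {}"
    unfolding connectedin using Y by blast
  define U where "U E = \<Union>{N. openin X N \<and> N \<inter> Y \<subseteq> E}" for E
  have U: "openin X (U E)" for E unfolding U_def by (rule openin_Union) simp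
  have EU: "E \<subseteq> U E" if "openin X E" for E
    unfolding U_def by (rule Union_upper) (simp add: that)
  have "topspace X \<subseteq> U E1 \<union> U E2"
  proof
    fix z assume "z \<in> topspace X"
    then obtain N where N: "openin X N" "z \<in> N" "connectedin X (N \<inter> Y)" using N[OF openin_topspace] by metis
    have "N \<inter> Y \<subseteq> E1 \<or> N \<inter> Y \<subseteq> E2"
    proof (rule ccontr)
      assume "\<not> (N \<inter> Y \<subseteq> E1 \<or> N \<inter> Y \<subseteq> E2)"
      then have "E1 \<inter> (N \<inter> Y) \<noteq> {}" "E2 \<inter> (N \<inter> Y) \<noteq> {}" "N \<inter> Y \<subseteq> E1 \<union> E2" "E1 \<inter> E2 \<inter> (N \<inter> Y) = {}"
        using E(3,4) by blast+
      then show False using N(3)[unfolded connectedin] E(1,2) by blast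
    qed
    then show "z \<in> U E1 \<union> U E2" unfolding U_def using N(1,2) by blast
  qed
  moreover have "U E1 \<inter> U E2 = {}"
  proof (rule ccontr)
    assume "U E1 \<inter> U E2 \<noteq> {}"
    then obtain z where z: "z \<in> U E1" "z \<in> U E2" by blast
    obtain N1 where N1: "openin X N1" "N1 \<inter> Y \<subseteq> E1" "z \<in> N1" using z(1) unfolding U_def by blast
    obtain N2 where N2: "openin X N2" "N2 \<inter> Y \<subseteq> E2" "z \<in> N2" using z(2) unfolding U_def by blast
    obtain N' where "N' \<subseteq> N1 \<inter> N2" "N' \<inter> Y \<noteq> {}"
      using N[OF openin_Int[OF N1(1) N2(1)]] N1(3) N2(3) by (metis IntI)
    then show False using N1(2) N2(2) E(4) by blast
  qed
  moreover have "U E1 \<noteq> {}" "U E2 \<noteq> {}" using EU E(1,2,5,6) by blast+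
  ultimately show False using X U[of E1] U[of E2] unfolding connected_space_def by blast
qed

context oriented_surface
begin

lemma boundary_iff:
  assumes c: "c \<in> A" and p: "p \<in> fst c"
  shows "p \<in> surface_boundary X A \<longleftrightarrow> \<not> 0 < snd c p $ 2"
proof
  assume "\<not> 0 < snd c p $ 2"
  then have "snd c p $ 2 = 0"
    using chart_in_half_plane[OF atlas_chart[OF c] p] by (simp add: half_plane_def)
  then show "p \<in> surface_boundary X A"
    using c p chart_subset[OF atlas_chart[OF c]] by (auto simp: surface_boundary_def)
qed (use chart_interior_not_boundary[OF c p] in blast)

lemma interior_subset: "surface_interior X A \<subseteq> topspace X"
  by (auto simp: surface_interior_def)

lemma interior_iff: "c \<in> A \<Longrightarrow> p \<in> fst c \<Longrightarrow> p \<in> surface_interior X A \<longleftrightarrow> 0 < snd c p $ 2"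
  using boundary_iff[of c p] chart_subset[OF atlas_chart, of c] unfolding surface_interior_def by blast

lemma interior_open: "openin X (surface_interior X A)"
proof (subst openin_subopen, intro ballI)
  fix p assume p: "p \<in> surface_interior X A"
  then obtain c where c: "c \<in> A" "p \<in> fst c" using chart_at interior_subset by blast
  have "openin X {q \<in> fst c. snd c q \<in> {v. 0 < v $ 2}}"
    by (rule chart_openin_preimage[OF atlas_chart[OF c(1)] open_halfspace_component_gt_cart])
  moreover have "{q \<in> fst c. snd c q \<in> {v. 0 < v $ 2}} \<subseteq> surface_interior X A"
    using interior_iff[OF c(1)] by blast
  moreover have "p \<in> {q \<in> fst c. snd c q \<in> {v. 0 < v $ 2}}" using p c interior_iff by simp
  ultimately show "\<exists>T. openin X T \<and> p \<in> T \<and> T \<subseteq> surface_interior X A" by blast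
qed

lemma interior_disc:
  assumes p: "p \<in> surface_interior X A" and W: "openin X W" "p \<in> W"
  obtains c \<rho> where "c \<in> A" "p \<in> fst c" "0 < \<rho>"
    "cball (snd c p) \<rho> \<subseteq> snd c ` (fst c \<inter> W)" "\<And>v. v \<in> cball (snd c p) \<rho> \<Longrightarrow> 0 < v $ 2"
proof -
  obtain c where c: "c \<in> A" "p \<in> fst c" using chart_at p interior_subset by blast
  note ch = atlas_chart[OF c(1)]
  have "openin (top_of_set half_plane) (snd c ` (fst c \<inter> W))"
    by (rule chart_openin_image[OF ch openin_Int[OF chart_openin[OF ch] W(1)]]) simp
  then obtain T where T: "open T" "snd c ` (fst c \<inter> W) = half_plane \<inter> T" by (auto simp: openin_open)
  have "open (T \<inter> {v. 0 < v $ 2})" by (rule open_Int[OF T(1) open_halfspace_component_gt_cart])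
  moreover have "snd c p \<in> T \<inter> {v. 0 < v $ 2}"
  proof -
    have "snd c p \<in> half_plane \<inter> T" unfolding T(2)[symmetric] using c W by blast
    then show ?thesis using interior_iff[OF c] p by simp
  qed
  ultimately obtain \<rho> where \<rho>: "\<rho> > 0" "cball (snd c p) \<rho> \<subseteq> T \<inter> {v. 0 < v $ 2}"
    unfolding open_contains_cball by blast
  show thesis
  proof (rule that[OF c \<rho>(1)])
    show "cball (snd c p) \<rho> \<subseteq> snd c ` (fst c \<inter> W)"
      unfolding T(2) using \<rho>(2) by (auto simp: half_plane_def)
  qed (use \<rho>(2) in blast)
qed

text \<open>A half turn about the midpoint exchanges \<open>p\<close> and \<open>q\<close>. Having
  one map for both directions makes reachability symmetric in \<open>move_point\<close>.\<close>

lemma local_move: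
  assumes p: "p \<in> surface_interior X A" and W: "openin X W" "p \<in> W"
  shows "\<exists>N. openin X N \<and> p \<in> N \<and> N \<subseteq> W \<and>
    (\<forall>q\<in>N. \<exists>\<Phi>\<in>Diff_rel X A. \<Phi> p = q \<and> \<Phi> q = p \<and> (\<forall>x\<in>topspace X - W. \<Phi> x = x))"
proof -
  obtain c \<rho> where c: "c \<in> A" "p \<in> fst c" and \<rho>: "0 < \<rho>" "cball (snd c p) \<rho> \<subseteq> snd c ` (fst c \<inter> W)"
    and pos: "\<And>v. v \<in> cball (snd c p) \<rho> \<Longrightarrow> 0 < v $ 2"
    by (rule interior_disc[OF p W]) (rule that)
  note ch = atlas_chart[OF c(1)]
  have inW: "q \<in> W" if q: "q \<in> fst c" "snd c q \<in> cball (snd c p) \<rho>" for q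
  proof -
    obtain q' where "q' \<in> fst c" "q' \<in> W" "snd c q = snd c q'" using \<rho>(2) q(2) by blast
    then show ?thesis using inj_onD[OF chart_inj[OF ch]] q(1) by metis
  qed
  define N where "N = {q \<in> fst c. snd c q \<in> ball (snd c p) (\<rho>/3)}"
  have N: "openin X N" unfolding N_def by (rule chart_openin_preimage[OF ch open_ball])
  have pN: "p \<in> N" using c \<rho> by (simp add: N_def)
  have NW: "N \<subseteq> W" using inW \<rho>(1) by (auto simp: N_def)
  have "\<exists>\<Phi>\<in>Diff_rel X A. \<Phi> p = q \<and> \<Phi> q = p \<and> (\<forall>x\<in>topspace X - W. \<Phi> x = x)" if q: "q \<in> N" for q
  proof (cases "q = p")
    case True
    then show ?thesis using Diff_rel_id p interior_subset by (intro bexI[of _ "restrict id (topspace X)"]) auto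
  next
    case False
    have qc: "q \<in> fst c" "dist (snd c p) (snd c q) < \<rho>/3" using q by (auto simp: N_def)
    define z where "z = (1/2) *\<^sub>R (snd c p + snd c q)"
    \<comment> \<open>Both points lie on the circle of radius \<open>r\<close> about
      \<open>z\<close>. The twist is supported in radius \<open>2*r\<close>, and the bound
      \<open>3*r < \<rho>/2\<close> keeps its disc within distance \<open>\<rho>\<close> of
      \<open>snd c p\<close>.\<close>
    define r where "r = dist (snd c p) (snd c q) / 2"
    have ne: "snd c p \<noteq> snd c q" using inj_onD[OF chart_inj[OF ch]] c(2) qc(1) False by metis
    have r: "0 < r" "r < \<rho>/6" using ne qc(2) by (auto simp: r_def)
    have pz: "snd c p - z = (1/2) *\<^sub>R (snd c p - snd c q)" "snd c q - z = - (snd c p - z)"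
      by (simp_all add: z_def algebra_simps flip: scaleR_add_left)
    have nr: "norm (snd c p - z) = r" unfolding pz(1) by (simp add: r_def dist_norm)
    then have nr': "norm (snd c q - z) = r" unfolding pz(2) norm_minus_cancel .
    have sub: "cball z (2*r) \<subseteq> cball (snd c p) \<rho>"
    proof
      fix v assume "v \<in> cball z (2*r)"
      then have "dist (snd c p) v \<le> r + 2*r"
        using dist_triangle[of "snd c p" v z] nr by (simp add: dist_norm)
      then show "v \<in> cball (snd c p) \<rho>" using r by simp
    qed
    note cp = c(2)
    interpret twist_disc X A c z "2*r" r
      by unfold_locales (use c r sub \<rho>(2) pos in auto)
    have rot_pi: "rot pi v = - v" for v by (simp add: vec_eq_iff forall_2)
    have "T pi (snd c p) = z + rot pi (snd c p - z)" by (rule twist_on_circle) (use r nr in simp_all)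
    then have sw1: "T pi (snd c p) = snd c q" unfolding rot_pi pz(2)[symmetric] by simp
    have "T pi (snd c q) = z + rot pi (snd c q - z)" by (rule twist_on_circle) (use r nr' in simp_all)
    then have sw2: "T pi (snd c q) = snd c p" unfolding rot_pi pz(2) by simp
    have "chart_twist pi p = q" "chart_twist pi q = p"
      using sw1 sw2 cp qc(1) chart_inv[OF ch] by (simp_all add: chart_twist_def)
    moreover have "chart_twist pi x = x" if x: "x \<in> topspace X - W" for x
    proof (rule chart_twist_fixed)
      show "2 * r \<le> norm (snd c x - z)" if xc: "x \<in> fst c"
      proof (rule ccontr)
        assume "\<not> 2 * r \<le> norm (snd c x - z)"
        then have "snd c x \<in> cball z (2*r)" by (simp add: dist_norm norm_minus_commute)
        then show False using inW[OF xc] sub x by blast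
      qed
    qed (use x in simp)
    ultimately show ?thesis using chart_twist_Diff_rel by blast
  qed
  then show ?thesis using N pN NW by blast
qed

text \<open>Locally the set is a convex open part of the plane with at most one point deleted, also
  near a boundary point; in dimension two the deletion leaves it connected.\<close>

lemma connectedin_punctured_interior:
  assumes Q: "finite Q"
  shows "connectedin X (surface_interior X A - Q)"
proof (rule connectedin_locally_dense[OF connected])
  let ?Y = "surface_interior X A - Q"
  show "?Y \<subseteq> topspace X" using interior_subset by blast
  fix z W assume W: "openin X W" "z \<in> W"
  have zX: "z \<in> topspace X" using openin_subset W by blast
  obtain c where c: "c \<in> A" "z \<in> fst c" using chart_at[OF zX] by blast
  note ch = atlas_chart[OF c(1)]
  \<comment> \<open>All punctures except possibly \<open>z\<close> itself are kept away.\<close>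
  define W' where "W' = fst c \<inter> W - ((Q - {z}) \<inter> topspace X)"
  have "closedin X ((Q - {z}) \<inter> topspace X)"
    by (rule closedin_Hausdorff_finite[OF Hausdorff]) (use Q in auto)
  then have W'o: "openin X W'"
    unfolding W'_def using openin_diff[OF openin_Int[OF chart_openin[OF ch] W(1)]] by blast
  have "openin (top_of_set half_plane) (snd c ` W')"
    by (rule chart_openin_image[OF ch W'o]) (auto simp: W'_def)
  moreover have "snd c z \<in> snd c ` W'" using c W by (auto simp: W'_def)
  ultimately obtain \<delta> where \<delta>: "\<delta> > 0" "ball (snd c z) \<delta> \<inter> half_plane \<subseteq> snd c ` W'"
    unfolding openin_contains_ball by blast
  define N where "N = {q \<in> fst c. snd c q \<in> ball (snd c z) \<delta>}"
  have N: "openin X N" unfolding N_def by (rule chart_openin_preimage[OF ch open_ball])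
  have NW': "q \<in> W'" if q: "q \<in> N" for q
  proof -
    have "q \<in> fst c" "snd c q \<in> snd c ` W'"
      using q \<delta>(2) chart_in_half_plane[OF ch] unfolding N_def by blast+
    then obtain q' where "q' \<in> W'" "snd c q = snd c q'" "q \<in> fst c" by blast
    moreover have "q' \<in> fst c" using \<open>q' \<in> W'\<close> by (simp add: W'_def)
    ultimately show ?thesis using inj_onD[OF chart_inj[OF ch]] by metis
  qed
  define D where "D = (ball (snd c z) \<delta> \<inter> {v. 0 < v $ 2}) - (if z \<in> Q then {snd c z} else {})"
  have op: "open (ball (snd c z) \<delta> \<inter> {v. 0 < v $ 2})"
    by (rule open_Int[OF open_ball open_halfspace_component_gt_cart])
  have "convex {v::real^2. 0 < v $ 2}" by (simp add: convex_def) (metis add_pos_nonneg add_nonneg_pos less_eq_real_def mult_nonneg_nonneg mult_pos_pos not_one_le_zero add.right_neutral)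
  then have "convex (ball (snd c z) \<delta> \<inter> {v. 0 < v $ 2})" by (rule convex_Int[OF convex_ball])
  then have "connected (ball (snd c z) \<delta> \<inter> {v. 0 < v $ 2})" by (rule convex_connected)
  then have Dc: "connected D"
    unfolding D_def using connected_open_delete[OF op] by (simp split: if_splits)
  \<comment> \<open>Half a radius upwards from \<open>snd c z\<close> lies a point of
    \<open>D\<close>, whether or not \<open>z\<close> is a boundary point or a puncture.\<close>
  define e :: "real^2" where "e = axis 2 1"
  have e: "norm e = 1" "e $ 2 = 1" by (simp_all add: e_def norm_axis_1)
  then have "e \<noteq> 0" by auto
  then have "snd c z + (\<delta>/2) *\<^sub>R e \<in> D"
    using \<delta>(1) chart_in_half_plane[OF ch c(2)] e
    by (simp add: D_def dist_norm half_plane_def)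
  then have Dn: "D \<noteq> {}" by blast
  have Dimg: "D \<subseteq> snd c ` fst c"
  proof
    fix v assume "v \<in> D"
    then have "v \<in> ball (snd c z) \<delta> \<inter> half_plane" by (auto simp: D_def half_plane_def)
    then have "v \<in> snd c ` W'" using \<delta>(2) by blast
    then show "v \<in> snd c ` fst c" by (auto simp: W'_def)
  qed
  have eq: "N \<inter> ?Y = inv_into (fst c) (snd c) ` D"
  proof (intro equalityI subsetI)
    fix q assume q: "q \<in> N \<inter> ?Y"
    then have qc: "q \<in> fst c" "0 < snd c q $ 2" "q \<notin> Q" "snd c q \<in> ball (snd c z) \<delta>"
      using interior_iff[OF c(1)] by (auto simp: N_def)
    have "snd c q \<noteq> snd c z" if "z \<in> Q" using inj_onD[OF chart_inj[OF ch] _ qc(1) c(2)] that qc(3) by blast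
    then have "snd c q \<in> D" using qc by (simp add: D_def)
    then show "q \<in> inv_into (fst c) (snd c) ` D" using chart_inv[OF ch qc(1)] by (metis imageI)
  next
    fix q assume "q \<in> inv_into (fst c) (snd c) ` D"
    then obtain v where v: "v \<in> D" "q = inv_into (fst c) (snd c) v" by blast
    have q: "q \<in> fst c" "snd c q = v"
      using v Dimg by (auto simp: inv_into_into f_inv_into_f subset_iff)
    then have qN: "q \<in> N" using v by (simp add: N_def D_def)
    have "q \<in> surface_interior X A" using interior_iff[OF c(1) q(1)] q(2) v by (simp add: D_def)
    moreover have "q \<notin> Q"
    proof
      assume "q \<in> Q"
      then have "q = z" using NW'[OF qN] openin_subset[OF chart_openin[OF ch]] q(1) by (auto simp: W'_def)
      then show False using v q \<open>q \<in> Q\<close> by (simp add: D_def)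
    qed
    ultimately show "q \<in> N \<inter> ?Y" using qN by blast
  qed
  have "connectedin (top_of_set (snd c ` fst c)) D"
    using Dc Dimg by (simp add: connectedin_subtopology)
  then have "connectedin X (N \<inter> ?Y)"
    unfolding eq by (rule connectedin_continuous_map_image[OF chart_inv_continuous[OF ch]])
  moreover have "N \<inter> ?Y \<noteq> {}" unfolding eq using Dn by simp
  moreover have "z \<in> N" using c \<delta> by (simp add: N_def)
  moreover have "N \<subseteq> W" using NW' by (auto simp: W'_def)
  ultimately show "\<exists>N. openin X N \<and> z \<in> N \<and> N \<subseteq> W \<and> connectedin X (N \<inter> ?Y) \<and> N \<inter> ?Y \<noteq> {}"
    using N by blast
qed

text \<open>The points reachable from \<open>p\<close> by diffeomorphisms fixing \<open>Q\<close>
  form a set that is open with open complement in the connected punctured interior.\<close>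

lemma move_point:
  assumes Q: "finite Q" "Q \<subseteq> topspace X" and p: "p \<in> surface_interior X A - Q" and q: "q \<in> surface_interior X A - Q"
  shows "\<exists>\<Phi>\<in>Diff_rel X A. \<Phi> p = q \<and> (\<forall>x\<in>Q. \<Phi> x = x)"
proof -
  let ?Y = "surface_interior X A - Q"
  define R where "R = {y \<in> ?Y. \<exists>\<Phi>\<in>Diff_rel X A. \<Phi> p = y \<and> (\<forall>x\<in>Q. \<Phi> x = x)}"
  have clQ: "closedin X Q" by (rule closedin_Hausdorff_finite[OF Hausdorff Q(2,1)])
  have Yo: "openin X ?Y" by (rule openin_diff[OF interior_open clQ])
  have step: "\<exists>N. openin X N \<and> y \<in> N \<and> N \<subseteq> ?Y \<and> (\<forall>w\<in>N. w \<in> R \<longleftrightarrow> y \<in> R)" if y: "y \<in> ?Y" for y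
  proof -
    obtain N where N: "openin X N" "y \<in> N" "N \<subseteq> ?Y"
      and mv: "\<forall>w\<in>N. \<exists>\<Phi>\<in>Diff_rel X A. \<Phi> y = w \<and> \<Phi> w = y \<and> (\<forall>x\<in>topspace X - ?Y. \<Phi> x = x)"
      using local_move[OF _ Yo y] y by blast
    have trans: "w' \<in> R" if w: "w \<in> R" "w' \<in> ?Y" and \<Phi>: "\<Phi> \<in> Diff_rel X A" "\<Phi> w = w'" "\<forall>x\<in>topspace X - ?Y. \<Phi> x = x" for w w' \<Phi>
    proof -
      obtain \<Psi> where \<Psi>: "\<Psi> \<in> Diff_rel X A" "\<Psi> p = w" "\<forall>x\<in>Q. \<Psi> x = x" using w(1) unfolding R_def by blast
      have "compose (topspace X) \<Phi> \<Psi> \<in> Diff_rel X A" by (rule Diff_rel_compose[OF \<Psi>(1) \<Phi>(1)])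
      moreover have "compose (topspace X) \<Phi> \<Psi> p = w'"
        using p interior_subset \<Psi>(2) \<Phi>(2) by (auto simp: compose_def)
      moreover have "compose (topspace X) \<Phi> \<Psi> x = x" if "x \<in> Q" for x
        using that Q(2) \<Psi>(3) \<Phi>(3) by (auto simp: compose_def)
      ultimately show ?thesis unfolding R_def using w(2) by blast
    qed
    have "w \<in> R \<longleftrightarrow> y \<in> R" if w: "w \<in> N" for w
    proof -
      obtain \<Phi> where \<Phi>: "\<Phi> \<in> Diff_rel X A" "\<Phi> y = w" "\<Phi> w = y" "\<forall>x\<in>topspace X - ?Y. \<Phi> x = x"
        using mv w by blast
      have "w \<in> ?Y" using w N(3) by blast
      then show ?thesis using trans[OF _ y \<Phi>(1,3,4)] trans[OF _ _ \<Phi>(1,2,4)] by blast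
    qed
    then show ?thesis using N by blast
  qed
  have Ro: "openin X R"
  proof (subst openin_subopen, intro ballI)
    fix y assume y: "y \<in> R"
    then have "y \<in> ?Y" by (simp add: R_def)
    from step[OF this] y show "\<exists>T. openin X T \<and> y \<in> T \<and> T \<subseteq> R" by blast
  qed
  have Ro': "openin X (?Y - R)"
  proof (subst openin_subopen, intro ballI)
    fix y assume y: "y \<in> ?Y - R"
    then obtain N where "openin X N" "y \<in> N" "N \<subseteq> ?Y" "\<forall>w\<in>N. w \<in> R \<longleftrightarrow> y \<in> R" using step[of y] by blast
    then show "\<exists>T. openin X T \<and> y \<in> T \<and> T \<subseteq> ?Y - R" using y by blast
  qed
  have "p \<in> R"
    unfolding R_def using p Diff_rel_id Q(2) interior_subset
    by (intro CollectI conjI bexI[of _ "restrict id (topspace X)"]) auto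
  have "q \<in> R"
  proof (rule ccontr)
    assume "q \<notin> R"
    then have "R \<inter> ?Y \<noteq> {}" "(?Y - R) \<inter> ?Y \<noteq> {}" "?Y \<subseteq> R \<union> (?Y - R)" "R \<inter> (?Y - R) \<inter> ?Y = {}"
      using \<open>p \<in> R\<close> p q by blast+
    then show False using connectedin_punctured_interior[OF Q(1)] Ro Ro' unfolding connectedin by blast
  qed
  then show ?thesis unfolding R_def by blast
qed

text \<open>One point at a time: while the others travel, \<open>x m\<close> is held fixed, and then
  it travels with their targets held fixed. Disjointness of the two tuples keeps held points and
  targets distinct.\<close>

lemma move_points:
  fixes x y :: "nat \<Rightarrow> 'a"
  assumes "finite Q" "Q \<subseteq> topspace X" "inj_on x {..<m}" "inj_on y {..<m}"
    "x ` {..<m} \<subseteq> surface_interior X A" "y ` {..<m} \<subseteq> surface_interior X A"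
    "x ` {..<m} \<inter> Q = {}" "y ` {..<m} \<inter> Q = {}" "x ` {..<m} \<inter> y ` {..<m} = {}"
  shows "\<exists>\<Phi>\<in>Diff_rel X A. (\<forall>k<m. \<Phi> (x k) = y k) \<and> (\<forall>q\<in>Q. \<Phi> q = q)"
  using assms
proof (induction m arbitrary: Q)
  case 0
  then show ?case using Diff_rel_id by (intro bexI[of _ "restrict id (topspace X)"]) auto
next
  case (Suc m)
  have xm: "x m \<in> surface_interior X A" "y m \<in> surface_interior X A" using Suc.prems(5,6) by auto
  have "\<exists>\<Phi>\<in>Diff_rel X A. (\<forall>k<m. \<Phi> (x k) = y k) \<and> (\<forall>q\<in>insert (x m) Q. \<Phi> q = q)"
  proof (rule Suc.IH)
    show "insert (x m) Q \<subseteq> topspace X" using Suc.prems(2) xm interior_subset by blast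
    show "x ` {..<m} \<inter> insert (x m) Q = {}"
      using Suc.prems(3,7) by (auto simp: lessThan_Suc inj_on_def)
    show "y ` {..<m} \<inter> insert (x m) Q = {}" using Suc.prems(8,9) by (auto simp: lessThan_Suc)
    show "x ` {..<m} \<inter> y ` {..<m} = {}" using Suc.prems(9) by (auto simp: lessThan_Suc)
    show "inj_on x {..<m}" "inj_on y {..<m}"
      using inj_on_subset[OF Suc.prems(3)] inj_on_subset[OF Suc.prems(4)] by auto
  qed (use Suc.prems in auto)
  then obtain \<Phi> where \<Phi>: "\<Phi> \<in> Diff_rel X A" "\<And>k. k < m \<Longrightarrow> \<Phi> (x k) = y k" "\<And>q. q \<in> Q \<Longrightarrow> \<Phi> q = q" "\<Phi> (x m) = x m"
    by blast
  have "\<exists>\<Psi>\<in>Diff_rel X A. \<Psi> (x m) = y m \<and> (\<forall>q\<in>Q \<union> y ` {..<m}. \<Psi> q = q)"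
  proof (rule move_point)
    show "Q \<union> y ` {..<m} \<subseteq> topspace X"
      using Suc.prems(2,6) interior_subset by (auto simp: lessThan_Suc)
    show "x m \<in> surface_interior X A - (Q \<union> y ` {..<m})" using xm Suc.prems(7,9) by auto
    have "y m \<notin> y ` {..<m}" using Suc.prems(4) by (auto simp: lessThan_Suc)
    then show "y m \<in> surface_interior X A - (Q \<union> y ` {..<m})" using xm Suc.prems(8) by auto
  qed (use Suc.prems in auto)
  then obtain \<Psi> where \<Psi>: "\<Psi> \<in> Diff_rel X A" "\<Psi> (x m) = y m" "\<And>q. q \<in> Q \<Longrightarrow> \<Psi> q = q" "\<And>k. k < m \<Longrightarrow> \<Psi> (y k) = y k"
    by blast
  have xX: "x k \<in> topspace X" if "k < Suc m" for k using Suc.prems(5) interior_subset that by auto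
  show ?case
  proof (intro bexI[OF _ Diff_rel_compose[OF \<Phi>(1) \<Psi>(1)]] conjI allI impI ballI)
    show "compose (topspace X) \<Psi> \<Phi> (x k) = y k" if "k < Suc m" for k
      using that \<Phi>(2,4) \<Psi>(2,4) xX[OF that] by (cases "k = m") (simp_all add: compose_def)
    show "compose (topspace X) \<Psi> \<Phi> q = q" if "q \<in> Q" for q
      using that \<Phi>(3) \<Psi>(3) Suc.prems(2) by (auto simp: compose_def)
  qed
qed

end

section \<open>The fundamental group\<close>

abbreviation unit_square :: "(real \<times> real) set" where
  "unit_square \<equiv> {0..1} \<times> {0..1}"

text \<open>The homotopy parameter comes first and time second. The endpoints of the given loops
  need no separate clause, since the boundary of the square determines them.\<close>

lemma loop_homotopy_iff:
  "(\<gamma>, \<delta>) \<in> loop_homotopy Y b \<longleftrightarrow>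
    (\<exists>h. continuous_map (top_of_set unit_square) Y h \<and>
      (\<forall>t\<in>{0..1}. h (0, t) = \<gamma> t) \<and> (\<forall>t\<in>{0..1}. h (1, t) = \<delta> t) \<and>
      (\<forall>s\<in>{0..1}. h (s, 0) = b) \<and> (\<forall>s\<in>{0..1}. h (s, 1) = b))" (is "?L \<longleftrightarrow> ?R")
proof -
  have hom: "homotopic_with (\<lambda>\<eta>. \<eta> 0 = b \<and> \<eta> 1 = b) (top_of_set {0..1}) Y \<gamma> \<delta> \<longleftrightarrow>
    (\<exists>h. continuous_map (top_of_set unit_square) Y h \<and>
      (\<forall>t\<in>{0..1}. h (0, t) = \<gamma> t) \<and> (\<forall>t\<in>{0..1}. h (1, t) = \<delta> t) \<and>
      (\<forall>s\<in>{0..1}. h (s, 0) = b \<and> h (s, 1) = b))"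
    by (subst homotopic_with) simp_all
  show ?thesis
  proof
    assume ?L
    then show ?R unfolding loop_homotopy_def using hom by auto
  next
    assume ?R
    then obtain h where h: "continuous_map (top_of_set unit_square) Y h"
      "\<forall>t\<in>{0..1}. h (0, t) = \<gamma> t" "\<forall>t\<in>{0..1}. h (1, t) = \<delta> t"
      "\<forall>s\<in>{0..1}. h (s, 0) = b" "\<forall>s\<in>{0..1}. h (s, 1) = b" by (elim exE conjE) (rule that)
    have slice: "pathin Y (\<lambda>t. h (s, t))" if "s \<in> {0..1}" for s
    proof -
      have "continuous_map (top_of_set {0..1}) (top_of_set unit_square) (\<lambda>t. (s, t))"
        unfolding continuous_map_in_subtopology using that by (auto intro!: continuous_intros)
      from continuous_map_compose[OF this h(1)] show ?thesis by (simp add: comp_def pathin_def)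
    qed
    have "\<gamma> \<in> loops_at Y b"
    proof -
      have "pathin Y \<gamma>" unfolding pathin_def
        by (rule continuous_map_eq[OF slice[of 0, unfolded pathin_def]]) (use h(2) in simp_all)
      moreover have "\<gamma> 0 = b" "\<gamma> 1 = b"
        using h(2)[rule_format, of 0] h(2)[rule_format, of 1] h(4)[rule_format, of 0] h(5)[rule_format, of 0] by simp_all
      ultimately show ?thesis by (simp add: loops_at_def)
    qed
    moreover have "\<delta> \<in> loops_at Y b"
    proof -
      have "pathin Y \<delta>" unfolding pathin_def
        by (rule continuous_map_eq[OF slice[of 1, unfolded pathin_def]]) (use h(3) in simp_all)
      moreover have "\<delta> 0 = b" "\<delta> 1 = b"
        using h(3)[rule_format, of 0] h(3)[rule_format, of 1] h(4)[rule_format, of 1] h(5)[rule_format, of 1] by simp_all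
      ultimately show ?thesis by (simp add: loops_at_def)
    qed
    moreover have "homotopic_with (\<lambda>\<eta>. \<eta> 0 = b \<and> \<eta> 1 = b) (top_of_set {0..1}) Y \<gamma> \<delta>"
      unfolding hom using h by auto
    ultimately show ?L by (simp add: loop_homotopy_def)
  qed
qed

lemma equiv_loop_homotopy: "equiv (loops_at Y b) (loop_homotopy Y b)"
proof (rule equivI)
  show "loop_homotopy Y b \<subseteq> loops_at Y b \<times> loops_at Y b" by (auto simp: loop_homotopy_def)
  show "refl_on (loops_at Y b) (loop_homotopy Y b)"
    by (auto simp: refl_on_def loop_homotopy_def loops_at_def pathin_def)
  show "sym (loop_homotopy Y b)"
    by (auto simp: sym_def loop_homotopy_def intro: homotopic_with_symD)
  show "trans (loop_homotopy Y b)"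
    unfolding trans_def loop_homotopy_def by (auto intro: homotopic_with_trans)
qed

lemma continuous_concat:
  assumes f: "continuous_map (top_of_set unit_square) Y f" and g: "continuous_map (top_of_set unit_square) Y g"
    and eq: "\<And>s. s \<in> {0..1} \<Longrightarrow> f (s, 1) = g (s, 0)"
  shows "continuous_map (top_of_set unit_square) Y
    (\<lambda>z. if snd z \<le> 1/2 then f (fst z, 2 * snd z) else g (fst z, 2 * snd z - 1))"
proof (rule continuous_map_cases_le)
  let ?S = "top_of_set unit_square"
  show "continuous_map ?S euclideanreal snd" "continuous_map ?S euclideanreal (\<lambda>_. 1/2)"
    by (simp_all add: continuous_on_snd)
  have "continuous_map (subtopology ?S {z \<in> topspace ?S. snd z \<le> 1/2}) ?S (\<lambda>z. (fst z, 2 * snd z))"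
    unfolding continuous_map_in_subtopology subtopology_subtopology
    by (auto intro!: continuous_intros)
  from continuous_map_compose[OF this f]
  show "continuous_map (subtopology ?S {z \<in> topspace ?S. snd z \<le> 1/2}) Y (\<lambda>z. f (fst z, 2 * snd z))"
    by (simp add: comp_def)
  have "continuous_map (subtopology ?S {z \<in> topspace ?S. 1/2 \<le> snd z}) ?S (\<lambda>z. (fst z, 2 * snd z - 1))"
    unfolding continuous_map_in_subtopology subtopology_subtopology
    by (auto intro!: continuous_intros)
  from continuous_map_compose[OF this g]
  show "continuous_map (subtopology ?S {z \<in> topspace ?S. 1/2 \<le> snd z}) Y (\<lambda>z. g (fst z, 2 * snd z - 1))"
    by (simp add: comp_def)
  fix z assume "z \<in> topspace ?S" "snd z = 1/2"
  then have "fst z \<in> {0..1}" "2 * snd z = 1" "2 * snd z - 1 = 0" by (auto simp: mem_Times_iff)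
  then show "f (fst z, 2 * snd z) = g (fst z, 2 * snd z - 1)" using eq by simp
qed

lemma path_concat_homotopy:
  assumes "(\<gamma>, \<gamma>') \<in> loop_homotopy Y b" "(\<delta>, \<delta>') \<in> loop_homotopy Y b"
  shows "(path_concat \<gamma> \<delta>, path_concat \<gamma>' \<delta>') \<in> loop_homotopy Y b"
proof -
  obtain f where f: "continuous_map (top_of_set unit_square) Y f"
      "\<forall>t\<in>{0..1}. f (0, t) = \<gamma> t" "\<forall>t\<in>{0..1}. f (1, t) = \<gamma>' t"
      "\<forall>s\<in>{0..1}. f (s, 0) = b" "\<forall>s\<in>{0..1}. f (s, 1) = b"
    using assms(1) unfolding loop_homotopy_iff by (elim exE conjE) (rule that)
  obtain g where g: "continuous_map (top_of_set unit_square) Y g"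
      "\<forall>t\<in>{0..1}. g (0, t) = \<delta> t" "\<forall>t\<in>{0..1}. g (1, t) = \<delta>' t"
      "\<forall>s\<in>{0..1}. g (s, 0) = b" "\<forall>s\<in>{0..1}. g (s, 1) = b"
    using assms(2) unfolding loop_homotopy_iff by (elim exE conjE) (rule that)
  let ?h = "\<lambda>z. if snd z \<le> 1/2 then f (fst z, 2 * snd z) else g (fst z, 2 * snd z - 1)"
  have "continuous_map (top_of_set unit_square) Y ?h"
    by (rule continuous_concat[OF f(1) g(1)]) (use f(5) g(4) in simp)
  then show ?thesis
    unfolding loop_homotopy_iff
    by (rule exI[of _ ?h, OF conjI]) (use f(2-5) g(2-5) in \<open>simp add: path_concat_def\<close>)
qed

lemma fundamental_group_class: "\<gamma> \<in> loops_at Y b \<Longrightarrow> loop_homotopy Y b `` {\<gamma>} \<in> carrier (fundamental_group Y b)"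
  by (simp add: fundamental_group_def quotientI)

text \<open>The union in the definition runs over all representatives; homotopy invariance of
  concatenation makes all its members equal.\<close>

lemma fundamental_group_mult:
  assumes "\<gamma> \<in> loops_at Y b" "\<delta> \<in> loops_at Y b"
  shows "loop_homotopy Y b `` {\<gamma>} \<otimes>\<^bsub>fundamental_group Y b\<^esub> loop_homotopy Y b `` {\<delta>} =
    loop_homotopy Y b `` {path_concat \<delta> \<gamma>}"
proof -
  let ?R = "loop_homotopy Y b"
  have E: "equiv (loops_at Y b) ?R" by (rule equiv_loop_homotopy)
  have "?R `` {path_concat \<delta>' \<gamma>'} = ?R `` {path_concat \<delta> \<gamma>}"
    if "\<gamma>' \<in> ?R `` {\<gamma>}" "\<delta>' \<in> ?R `` {\<delta>}" for \<gamma>' \<delta>'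
    using equiv_class_eq[OF E path_concat_homotopy[of \<delta> \<delta>' Y b \<gamma> \<gamma>']] that by simp
  moreover have "\<gamma> \<in> ?R `` {\<gamma>}" "\<delta> \<in> ?R `` {\<delta>}" using equiv_class_self[OF E] assms by blast+
  ultimately have "(\<Union>\<gamma>'\<in>?R `` {\<gamma>}. \<Union>\<delta>'\<in>?R `` {\<delta>}. ?R `` {path_concat \<delta>' \<gamma>'}) = ?R `` {path_concat \<delta> \<gamma>}"
    by blast
  then show ?thesis by (simp add: fundamental_group_def)
qed

section \<open>Braids in a disc\<close>

definition point :: "nat \<Rightarrow> real^2" where
  "point k = vector [real k, 0]"

text \<open>Contains the five points and all motions considered; convexity keeps straight-line
  homotopies inside.\<close>

definition braid_box :: "(real^2) set" where
  "braid_box = {v. 0 \<le> v $ 1 \<and> v $ 1 \<le> 4 \<and> -1 \<le> v $ 2 \<and> v $ 2 \<le> 1}"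

text \<open>A counterclockwise half turn of two neighbours about their midpoint: strand
  \<open>i\<close> passes below, strand \<open>Suc i\<close> above. Strands are labelled by their
  starting points, which allows deforming motions strand by strand.\<close>

definition half_twist :: "nat \<Rightarrow> real \<Rightarrow> nat \<Rightarrow> real^2" where
  "half_twist i t k =
    (if k = i then vector [i + 1/2 - cos (pi * t) / 2, - sin (pi * t) / 2]
     else if k = Suc i then vector [i + 1/2 + cos (pi * t) / 2, sin (pi * t) / 2]
     else point k)"

definition swap :: "nat \<Rightarrow> nat \<Rightarrow> nat" where
  "swap i k = (if k = i then Suc i else if k = Suc i then i else k)"

lemma swap_image: "Suc i < n \<Longrightarrow> swap i ` {..<n} = {..<n}"
proof -
  assume i: "Suc i < n"
  have inv: "swap i (swap i k) = k" for k by (simp add: swap_def)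
  have sub: "swap i ` {..<n} \<subseteq> {..<n}" using i by (auto simp: swap_def)
  then have "swap i ` swap i ` {..<n} \<subseteq> swap i ` {..<n}" by blast
  then have "{..<n} \<subseteq> swap i ` {..<n}" by (simp add: image_image inv)
  then show ?thesis using sub by blast
qed

definition braid_path :: "(real \<Rightarrow> nat \<Rightarrow> real^2) \<Rightarrow> bool" where
  "braid_path z \<longleftrightarrow> (\<forall>k<5. continuous_on {0..1} (\<lambda>t. z t k)) \<and>
     (\<forall>t\<in>{0..1}. \<forall>k<5. z t k \<in> braid_box) \<and> (\<forall>t\<in>{0..1}. inj_on (z t) {..<5}) \<and>
     z 0 ` {..<5} = point ` {..<5} \<and> z 1 ` {..<5} = point ` {..<5}"

text \<open>A sufficient condition for the segment from \<open>u\<close> to \<open>v\<close> to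
  avoid 0. Here \<open>u\<close> will be the difference of two strands of a word and
  \<open>v\<close> that of a model motion. The condition is asymmetric: \<open>u\<close> may be
  horizontal while the model difference points strictly upwards.\<close>

definition aligned :: "real^2 \<Rightarrow> real^2 \<Rightarrow> bool" where
  "aligned u v \<longleftrightarrow> (0 < u$1 \<and> 0 < v$1) \<or> (u$1 < 0 \<and> v$1 < 0) \<or> (0 \<le> u$2 \<and> u \<noteq> 0 \<and> 0 < v$2)"

lemma aligned_segment:
  assumes a: "aligned u v" and s: "0 \<le> s" "s \<le> 1"
  shows "(1 - s) *\<^sub>R u + s *\<^sub>R v \<noteq> 0"
proof
  assume z: "(1 - s) *\<^sub>R u + s *\<^sub>R v = 0"
  have c: "(1 - s) * u$i + s * v$i = 0" for i
    using arg_cong[OF z, of "\<lambda>w. w $ i"] by simp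
  have pos: "0 < (1 - s) * x + s * y" if "0 < x" "0 < y" for x y :: real
    using s that by (cases "s = 0") (auto intro: add_nonneg_pos)
  consider "0 < u$1" "0 < v$1" | "u$1 < 0" "v$1 < 0" | "0 \<le> u$2" "u \<noteq> 0" "0 < v$2"
    using a by (auto simp: aligned_def)
  then show False
  proof cases
    case 1
    then show ?thesis using pos[of "u$1" "v$1"] c[of 1] by simp
  next
    case 2
    then show ?thesis using pos[of "- u$1" "- v$1"] c[of 1] by simp
  next
    case 3
    then show ?thesis
    proof (cases "s = 0")
      case True
      then show ?thesis using z 3 by simp
    next
      case False
      then have "0 < (1 - s) * u$2 + s * v$2" using 3 s by (intro add_nonneg_pos) auto
      then show ?thesis using c[of 2] by simp
    qed
  qed
qed

lemma vector_2_nth [simp]: "(vector [a, b] :: real^2) $ 1 = a" "(vector [a, b] :: real^2) $ 2 = b"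
  by simp_all

lemma point_nth [simp]: "point k $ 1 = real k" "point k $ 2 = 0"
  by (simp_all add: point_def)

lemma inj_point: "inj_on point S"
  by (auto simp: inj_on_def point_def vec_eq_iff forall_2)

lemma half_twist_0: "half_twist i 0 k = point k"
  by (simp add: half_twist_def vec_eq_iff forall_2)

lemma half_twist_1: "half_twist i 1 k = point (swap i k)"
  by (auto simp: half_twist_def vec_eq_iff forall_2 swap_def)

lemma half_twist_outside: "k \<noteq> i \<Longrightarrow> k \<noteq> Suc i \<Longrightarrow> half_twist i t k = point k"
  by (simp add: half_twist_def)

lemma half_twist_range:
  assumes "k = i \<or> k = Suc i"
  shows "real i \<le> half_twist i t k $ 1" "half_twist i t k $ 1 \<le> real i + 1"
    "-1 \<le> half_twist i t k $ 2" "half_twist i t k $ 2 \<le> 1"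
proof -
  have b: "cos (pi * t) \<le> 1" "-1 \<le> cos (pi * t)" "sin (pi * t) \<le> 1" "-1 \<le> sin (pi * t)" by simp_all
  have "(half_twist i t k $ 1 = i + 1/2 - cos (pi * t) / 2 \<and> half_twist i t k $ 2 = - sin (pi * t) / 2) \<or>
    (half_twist i t k $ 1 = i + 1/2 + cos (pi * t) / 2 \<and> half_twist i t k $ 2 = sin (pi * t) / 2)"
    using assms by (elim disjE) (simp_all add: half_twist_def)
  then show "real i \<le> half_twist i t k $ 1" "half_twist i t k $ 1 \<le> real i + 1"
    "-1 \<le> half_twist i t k $ 2" "half_twist i t k $ 2 \<le> 1"
    using b by linarith+
qed

lemma half_twist_diff:
  "half_twist i t (Suc i) - half_twist i t i = vector [cos (pi * t), sin (pi * t)]"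
  by (simp add: half_twist_def vec_eq_iff forall_2)

lemma half_twist_diff_nonneg:
  assumes "0 \<le> t" "t \<le> 1"
  shows "0 \<le> (half_twist i t (Suc i) - half_twist i t i) $ 2" "half_twist i t (Suc i) - half_twist i t i \<noteq> 0"
proof -
  have "0 \<le> pi * t" "pi * t \<le> pi" using assms by (simp_all add: mult_left_le)
  then have "0 \<le> sin (pi * t)" by (rule sin_ge_zero)
  then show "0 \<le> (half_twist i t (Suc i) - half_twist i t i) $ 2" unfolding half_twist_diff by simp
  show "half_twist i t (Suc i) - half_twist i t i \<noteq> 0"
  proof
    assume "half_twist i t (Suc i) - half_twist i t i = 0"
    then have "cos (pi * t) = 0 \<and> sin (pi * t) = 0"
      unfolding half_twist_diff by (simp add: vec_eq_iff forall_2)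
    then show False using sin_cos_squared_add[of "pi * t"] by simp
  qed
qed

lemma half_twist_order:
  assumes "k < l" "\<not> (k = i \<and> l = Suc i)"
  shows "half_twist i t k $ 1 < half_twist i t l $ 1"
proof (cases "k = i \<or> k = Suc i")
  case True
  then have "l \<noteq> i" "l \<noteq> Suc i" "i + 1 < l" using assms by auto
  then show ?thesis using half_twist_range(2)[OF True, of t] by (simp add: half_twist_outside)
next
  case k: False
  show ?thesis
  proof (cases "l = i \<or> l = Suc i")
    case True
    then have "k < i" using assms k by auto
    then show ?thesis using half_twist_range(1)[OF True, of t] k by (simp add: half_twist_outside)
  next
    case False
    then show ?thesis using assms k by (simp add: half_twist_outside)
  qed
qed

lemma inj_half_twist:
  assumes t: "0 \<le> t" "t \<le> 1"
  shows "inj_on (half_twist i t) S"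
proof (rule inj_onI)
  have ne: "half_twist i t k \<noteq> half_twist i t l" if "k < l" for k l
  proof (cases "k = i \<and> l = Suc i")
    case True
    then show ?thesis using half_twist_diff_nonneg(2)[OF t, of i] by auto
  next
    case False
    then show ?thesis using half_twist_order[OF that] by (metis less_irrefl)
  qed
  fix k l assume "half_twist i t k = half_twist i t l"
  then show "k = l" using ne[of k l] ne[of l k] by (metis linorder_neqE_nat)
qed

lemma continuous_vector_2:
  assumes "continuous_on S f" "continuous_on S g"
  shows "continuous_on S (\<lambda>x. vector [f x, g x] :: real^2)"
proof -
  have "(vector [f x, g x] :: real^2) = f x *\<^sub>R axis 1 1 + g x *\<^sub>R axis 2 1" for x
    by (simp add: vec_eq_iff forall_2 axis_def)
  then show ?thesis by (simp only:) (intro continuous_intros assms)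
qed

lemma point_in_braid_box: "k < 5 \<Longrightarrow> point k \<in> braid_box"
  by (auto simp: braid_box_def)

lemma half_twist_in_braid_box:
  assumes "i < 4" "k < 5"
  shows "half_twist i t k \<in> braid_box"
proof (cases "k = i \<or> k = Suc i")
  case True
  then show ?thesis using half_twist_range[OF True, of t] assms by (simp add: braid_box_def)
next
  case False
  then show ?thesis using assms point_in_braid_box by (simp add: half_twist_outside)
qed

lemma continuous_half_twist: "continuous_on S (\<lambda>t. half_twist i t k)"
  unfolding half_twist_def
  by (cases "k = i"; cases "k = Suc i") (auto intro!: continuous_vector_2 continuous_intros)

lemma braid_path_half_twist:
  assumes "i < 4"
  shows "braid_path (half_twist i)"
  unfolding braid_path_def
proof (intro conjI allI impI ballI)
  show "half_twist i 0 ` {..<5} = point ` {..<5}" by (simp add: half_twist_0)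
  have "half_twist i 1 ` {..<5} = point ` swap i ` {..<5}" by (simp add: half_twist_1 image_image)
  then show "half_twist i 1 ` {..<5} = point ` {..<5}" using swap_image[of i 5] assms by simp
qed (use assms in \<open>auto intro: continuous_half_twist half_twist_in_braid_box inj_half_twist\<close>)

text \<open>Labels follow the strands: one that starts as \<open>k\<close> ends the first motion
  where the strand \<open>\<pi> k\<close> of the second motion starts.\<close>

definition relabel_concat :: "(nat \<Rightarrow> nat) \<Rightarrow> (real \<Rightarrow> nat \<Rightarrow> real^2) \<Rightarrow> (real \<Rightarrow> nat \<Rightarrow> real^2) \<Rightarrow> real \<Rightarrow> nat \<Rightarrow> real^2" where
  "relabel_concat \<pi> y z t k = (if t \<le> 1/2 then y (2 * t) k else z (2 * t - 1) (\<pi> k))"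

lemma braid_path_relabel_concat:
  assumes y: "braid_path y" and z: "braid_path z" and \<pi>: "\<pi> ` {..<5} = {..<5}"
    and eq: "\<And>k. k < 5 \<Longrightarrow> y 1 k = z 0 (\<pi> k)"
  shows "braid_path (relabel_concat \<pi> y z)"
proof -
  have \<pi>5: "\<pi> k < 5" if "k < 5" for k using \<pi> that by auto
  have \<pi>i: "inj_on \<pi> {..<5}" using \<pi> by (simp add: eq_card_imp_inj_on)
  have I: "2 * t \<in> {0..1}" if "t \<in> {0..1}" "t \<le> 1/2" for t :: real using that by simp
  have J: "2 * t - 1 \<in> {0..1}" if "t \<in> {0..1}" "\<not> t \<le> 1/2" for t :: real using that by simp
  show ?thesis
    unfolding braid_path_def
  proof (intro conjI allI impI ballI)
    fix k :: nat assume k: "k < 5"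
    have "continuous_on ({0..1/2} \<union> {1/2..1}) (\<lambda>t. if t \<le> 1/2 then y (2 * t) k else z (2 * t - 1) (\<pi> k))"
    proof (rule continuous_on_cases)
      show "continuous_on {0..1/2} (\<lambda>t. y (2 * t) k)"
        by (rule continuous_on_compose2[of "{0..1}" "\<lambda>t. y t k"])
          (use y k in \<open>auto simp: braid_path_def intro!: continuous_intros\<close>)
      show "continuous_on {1/2..1} (\<lambda>t. z (2 * t - 1) (\<pi> k))"
        by (rule continuous_on_compose2[of "{0..1}" "\<lambda>t. z t (\<pi> k)"])
          (use z \<pi>5[OF k] in \<open>auto simp: braid_path_def intro!: continuous_intros\<close>)
      show "\<forall>t. t \<in> {0..1/2} \<and> \<not> t \<le> 1/2 \<or> t \<in> {1/2..1} \<and> t \<le> 1/2 \<longrightarrow> y (2 * t) k = z (2 * t - 1) (\<pi> k)"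
      proof (intro allI impI)
        fix t :: real assume "t \<in> {0..1/2} \<and> \<not> t \<le> 1/2 \<or> t \<in> {1/2..1} \<and> t \<le> 1/2"
        then have "2 * t = 1" "2 * t - 1 = 0" by auto
        then show "y (2 * t) k = z (2 * t - 1) (\<pi> k)" using eq[OF k] by (simp only:)
      qed
    qed simp_all
    moreover have "{0..1/2} \<union> {1/2..1} = {0..1::real}" by auto
    ultimately show "continuous_on {0..1} (\<lambda>t. relabel_concat \<pi> y z t k)"
      by (simp add: relabel_concat_def)
  next
    fix t :: real and k :: nat assume t: "t \<in> {0..1}" and k: "k < 5"
    show "relabel_concat \<pi> y z t k \<in> braid_box"
      using y z k \<pi>5[OF k] I[OF t] J[OF t] by (cases "t \<le> 1/2") (simp_all add: relabel_concat_def braid_path_def)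
  next
    fix t :: real assume t: "t \<in> {0..1}"
    show "inj_on (relabel_concat \<pi> y z t) {..<5}"
    proof (cases "t \<le> 1/2")
      case True
      then have "relabel_concat \<pi> y z t = y (2 * t)" by (simp add: fun_eq_iff relabel_concat_def)
      then show ?thesis using y I[OF t True] by (simp add: braid_path_def)
    next
      case False
      have "inj_on (z (2 * t - 1)) (\<pi> ` {..<5})" using z J[OF t False] \<pi> by (simp add: braid_path_def)
      then have "inj_on (z (2 * t - 1) \<circ> \<pi>) {..<5}" by (rule comp_inj_on[OF \<pi>i])
      moreover have "relabel_concat \<pi> y z t = z (2 * t - 1) \<circ> \<pi>" using False by (simp add: fun_eq_iff relabel_concat_def)
      ultimately show ?thesis by simp
    qed
  next
    show "relabel_concat \<pi> y z 0 ` {..<5} = point ` {..<5}"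
      using y by (simp add: relabel_concat_def braid_path_def)
    have "relabel_concat \<pi> y z 1 ` {..<5} = z 1 ` \<pi> ` {..<5}" by (simp add: relabel_concat_def image_image)
    then show "relabel_concat \<pi> y z 1 ` {..<5} = point ` {..<5}" using z \<pi> by (simp add: braid_path_def)
  qed
qed

text \<open>The difference of two strands that make exactly one positive half turn around each other.\<close>

definition half_turn :: "real \<Rightarrow> real^2 \<Rightarrow> bool" where
  "half_turn t v \<longleftrightarrow> (t = 0 \<longrightarrow> 0 < v$1) \<and> (t = 1 \<longrightarrow> v$1 < 0) \<and> (0 < t \<and> t < 1 \<longrightarrow> 0 < v$2)"

lemma aligned_half_turn:
  assumes "half_turn t v" "0 \<le> t" "t \<le> 1" "0 \<le> u$2" "u \<noteq> 0" "t = 0 \<Longrightarrow> 0 < u$1" "t = 1 \<Longrightarrow> u$1 < 0"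
  shows "aligned u v"
proof -
  consider "t = 0" | "t = 1" | "0 < t" "t < 1" using assms(2,3) by linarith
  then show ?thesis by cases (use assms in \<open>auto simp: half_turn_def aligned_def\<close>)
qed

lemma aligned_half_turn_right: "half_turn t v \<Longrightarrow> 0 \<le> t \<Longrightarrow> t < 1 \<Longrightarrow> 0 \<le> u$2 \<Longrightarrow> 0 < u$1 \<Longrightarrow> aligned u v"
  by (rule aligned_half_turn) auto

lemma aligned_half_turn_left: "half_turn t v \<Longrightarrow> 0 < t \<Longrightarrow> t \<le> 1 \<Longrightarrow> 0 \<le> u$2 \<Longrightarrow> u$1 < 0 \<Longrightarrow> aligned u v"
  by (rule aligned_half_turn) auto

lemma half_turn_half_twist:
  assumes "0 \<le> t" "t \<le> 1"
  shows "half_turn t (half_twist i t (Suc i) - half_twist i t i)"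
proof -
  have "0 < sin (pi * t)" if "0 < t" "t < 1" using that by (intro sin_gt_zero) simp_all
  then show ?thesis unfolding half_twist_diff by (simp add: half_turn_def)
qed

lemma aligned_half_twist:
  assumes "half_turn t v" "0 \<le> t" "t \<le> 1" "0 \<le> \<tau>" "\<tau> \<le> 1" "t = 0 \<Longrightarrow> \<tau> = 0" "t = 1 \<Longrightarrow> \<tau> = 1"
  shows "aligned (half_twist i \<tau> (Suc i) - half_twist i \<tau> i) v"
  by (rule aligned_half_turn[OF assms(1-3) half_twist_diff_nonneg[OF assms(4,5)]])
    (use assms(6,7) in \<open>simp_all add: half_twist_diff\<close>)

lemma aligned_order: "u $ 1 < u' $ 1 \<Longrightarrow> v $ 1 < v' $ 1 \<Longrightarrow> aligned (u' - u) (v' - v)"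
  by (simp add: aligned_def)

text \<open>Distant twists performed simultaneously; both orders of the product will be deformed to
  this motion.\<close>

definition both_twists :: "nat \<Rightarrow> nat \<Rightarrow> real \<Rightarrow> nat \<Rightarrow> real^2" where
  "both_twists i j t k = (if k = i \<or> k = Suc i then half_twist i t k else half_twist j t k)"

text \<open>Three collinear points reversed together, the half twist of three strands. The
  polynomial curve \<open>(1 - 2t, t(1 - t))\<close> replaces a circular arc; both sides of a braid
  relation will be deformed to this motion.\<close>

definition half_turn3 :: "nat \<Rightarrow> real \<Rightarrow> nat \<Rightarrow> real^2" where
  "half_turn3 i t k = (if i \<le> k \<and> k \<le> i + 2
     then vector [real i + 1 + (real k - real i - 1) * (1 - 2 * t), (real k - real i - 1) * (t * (1 - t))]
     else point k)"

lemma half_turn3_diff: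
  assumes "i \<le> k" "k < l" "l \<le> i + 2"
  shows "half_turn3 i t l - half_turn3 i t k = (real l - real k) *\<^sub>R vector [1 - 2 * t, t * (1 - t)]"
  using assms by (simp add: half_turn3_def vec_eq_iff forall_2 algebra_simps)

lemma half_turn_half_turn3:
  assumes "i \<le> k" "k < l" "l \<le> i + 2"
  shows "half_turn t (half_turn3 i t l - half_turn3 i t k)"
  unfolding half_turn3_diff[OF assms] using assms(2) by (simp add: half_turn_def)

lemma half_turn3_outside: "\<not> (i \<le> k \<and> k \<le> i + 2) \<Longrightarrow> half_turn3 i t k = point k"
  unfolding half_turn3_def by (rule if_not_P)

lemma half_turn3_range:
  assumes "i \<le> k" "k \<le> i + 2" "0 \<le> t" "t \<le> 1"
  shows "real i \<le> half_turn3 i t k $ 1" "half_turn3 i t k $ 1 \<le> real i + 2"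
    "-1 \<le> half_turn3 i t k $ 2" "half_turn3 i t k $ 2 \<le> 1"
proof -
  define m where "m = real k - real i - 1"
  have "k = i \<or> k = i + 1 \<or> k = i + 2" using assms(1,2) by linarith
  then have m: "m = -1 \<or> m = 0 \<or> m = 1" by (auto simp: m_def)
  define w where "w = t * (1 - t)"
  have w: "0 \<le> w" "w \<le> 1"
    unfolding w_def using assms(3,4) mult_le_one[of t "1 - t"] mult_nonneg_nonneg[of t "1 - t"] by simp_all
  then have w': "-1 \<le> w" by linarith
  have "half_turn3 i t k = vector [real i + 1 + m * (1 - 2 * t), m * w]"
    using assms by (simp add: half_turn3_def m_def w_def)
  then show "real i \<le> half_turn3 i t k $ 1" "half_turn3 i t k $ 1 \<le> real i + 2"
    "-1 \<le> half_turn3 i t k $ 2" "half_turn3 i t k $ 2 \<le> 1"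
    using m w w' assms(3,4) by auto
qed

text \<open>Strands of the triple stay between \<open>i\<close> and \<open>i + 2\<close>
  horizontally and the others do not move, so a pair not inside the triple keeps its order.\<close>

lemma order_of_ranges:
  assumes "k < l" "\<not> (i \<le> k \<and> l \<le> i + 2)"
    and "\<And>k. i \<le> k \<Longrightarrow> k \<le> i + 2 \<Longrightarrow> real i \<le> w k $ 1 \<and> w k $ 1 \<le> real i + 2"
    and "\<And>k. \<not> (i \<le> k \<and> k \<le> i + 2) \<Longrightarrow> w k = point k"
  shows "w k $ 1 < w l $ 1"
proof (cases "i \<le> k \<and> k \<le> i + 2")
  case True
  then have "i + 2 < l" using assms(2) by linarith
  then have "w l = point l" using assms(4)[of l] by simp
  then show ?thesis using assms(3)[of k] True \<open>i + 2 < l\<close> by simp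
next
  case k: False
  show ?thesis
  proof (cases "i \<le> l \<and> l \<le> i + 2")
    case True
    then have "k < i" using k assms(1) by linarith
    moreover have "w k = point k" by (rule assms(4)[OF k])
    ultimately show ?thesis using assms(3)[of l] True by simp
  next
    case l: False
    show ?thesis using assms(1) assms(4)[OF k] assms(4)[OF l] by simp
  qed
qed

lemma half_turn3_order:
  assumes "k < l" "\<not> (i \<le> k \<and> l \<le> i + 2)" "0 \<le> t" "t \<le> 1"
  shows "half_turn3 i t k $ 1 < half_turn3 i t l $ 1"
  by (rule order_of_ranges[OF assms(1,2)])
    (use half_turn3_range[OF _ _ assms(3,4)] half_turn3_outside in simp_all)

lemma braid_path_half_turn3:
  assumes "i + 2 < 5"
  shows "braid_path (half_turn3 i)"
  unfolding braid_path_def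
proof (intro conjI allI impI ballI)
  show "half_turn3 i 0 ` {..<5} = point ` {..<5}"
    by (rule image_cong) (auto simp: half_turn3_def vec_eq_iff forall_2)
  \<comment> \<open>The triple ends reversed, by an involution of the labels.\<close>
  have 1: "half_turn3 i 1 k = point (if i \<le> k \<and> k \<le> i + 2 then 2 * i + 2 - k else k)" for k
    by (simp add: half_turn3_def vec_eq_iff forall_2 of_nat_diff)
  define f where "f k = (if i \<le> k \<and> k \<le> i + 2 then 2 * i + 2 - k else k)" for k
  have sub: "f ` {..<5} \<subseteq> {..<5}" using assms by (auto simp: f_def)
  have ff: "f (f k) = k" for k
    by (cases "i \<le> k \<and> k \<le> i + 2") (auto simp: f_def)
  have "{..<5} = f ` f ` {..<5}" by (simp add: image_image ff)
  then have "f ` {..<5} = {..<5}" using sub image_mono[OF sub, of f] by (metis subset_antisym)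
  moreover have "half_turn3 i 1 ` {..<5} = point ` f ` {..<5}"
    unfolding image_image by (rule image_cong) (simp_all add: 1 f_def)
  ultimately show "half_turn3 i 1 ` {..<5} = point ` {..<5}" by simp
next
  fix k :: nat
  show "continuous_on {0..1} (\<lambda>t. half_turn3 i t k)"
    unfolding half_turn3_def
    by (cases "i \<le> k \<and> k \<le> i + 2") (auto intro!: continuous_vector_2 continuous_intros)
next
  fix t :: real and k :: nat assume t: "t \<in> {0..1}" and k: "k < 5"
  show "half_turn3 i t k \<in> braid_box"
  proof (cases "i \<le> k \<and> k \<le> i + 2")
    case True
    then show ?thesis using half_turn3_range[of i k t] t assms by (simp add: braid_box_def)
  next
    case False
    then show ?thesis using point_in_braid_box[OF k] by (simp add: half_turn3_outside)
  qed
next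
  fix t :: real assume t: "t \<in> {0..1}"
  have ne: "half_turn3 i t k \<noteq> half_turn3 i t l" if "k < l" for k l
  proof (cases "i \<le> k \<and> l \<le> i + 2")
    case True
    then have "half_turn t (half_turn3 i t l - half_turn3 i t k)" using half_turn_half_turn3[OF _ that] by simp
    moreover have "\<not> half_turn t 0" using t by (cases "t = 0"; cases "t = 1") (simp_all add: half_turn_def)
    ultimately show ?thesis by (metis right_minus_eq)
  next
    case False
    have "half_turn3 i t k $ 1 < half_turn3 i t l $ 1"
      by (rule half_turn3_order[OF that False]) (use t in simp_all)
    then show ?thesis by (metis less_irrefl)
  qed
  show "inj_on (half_turn3 i t) {..<5}"
    by (rule linorder_inj_onI) (use ne in auto)
qed

section \<open>Words in half twists and their comparison with the model motions\<close>

definition braid_word3 :: "nat \<Rightarrow> nat \<Rightarrow> real \<Rightarrow> nat \<Rightarrow> real^2" where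
  "braid_word3 i j = relabel_concat (swap i) (half_twist i) (relabel_concat (swap j) (half_twist j) (half_twist i))"

definition braid_word2 :: "nat \<Rightarrow> nat \<Rightarrow> real \<Rightarrow> nat \<Rightarrow> real^2" where
  "braid_word2 i j = relabel_concat (swap i) (half_twist i) (half_twist j)"

lemma braid_path_word2:
  assumes "i < 4" "j < 4"
  shows "braid_path (braid_word2 i j)"
  unfolding braid_word2_def
  by (rule braid_path_relabel_concat)
    (use assms in \<open>simp_all add: braid_path_half_twist swap_image half_twist_0 half_twist_1\<close>)

lemma braid_path_word3:
  assumes "i < 4" "j < 4"
  shows "braid_path (braid_word3 i j)"
  unfolding braid_word3_def
proof (rule braid_path_relabel_concat)
  show "braid_path (relabel_concat (swap j) (half_twist j) (half_twist i))"
    using braid_path_word2[OF assms(2,1)] by (simp add: braid_word2_def)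
qed (use assms in \<open>simp_all add: braid_path_half_twist swap_image half_twist_0 half_twist_1 relabel_concat_def\<close>)

text \<open>Nested concatenation gives the first letter half of the time and the other two a quarter
  each; labels are permuted by the letters already performed.\<close>

lemma braid_word3_eval:
  "t \<le> 1/2 \<Longrightarrow> braid_word3 i j t k = half_twist i (2 * t) k"
  "1/2 < t \<Longrightarrow> t \<le> 3/4 \<Longrightarrow> braid_word3 i j t k = half_twist j (4 * t - 2) (swap i k)"
  "3/4 < t \<Longrightarrow> braid_word3 i j t k = half_twist i (4 * t - 3) (swap j (swap i k))"
  by (simp_all add: braid_word3_def relabel_concat_def algebra_simps)

lemma sin_half_twist: "0 \<le> \<tau> \<Longrightarrow> \<tau> \<le> 1 \<Longrightarrow> 0 \<le> sin (pi * \<tau>)"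
  by (rule sin_ge_zero) (simp_all add: mult_left_le)

lemma half_twist_values:
  "half_twist i t i = vector [i + 1/2 - cos (pi * t) / 2, - sin (pi * t) / 2]"
  "half_twist i t (Suc i) = vector [i + 1/2 + cos (pi * t) / 2, sin (pi * t) / 2]"
  "half_twist i t (Suc (Suc i)) = point (Suc (Suc i))" "half_twist (Suc i) t i = point i"
  by (simp_all add: half_twist_def)

lemma swap_values:
  "swap i i = Suc i" "swap i (Suc i) = i" "swap i (Suc (Suc i)) = Suc (Suc i)" "swap (Suc i) i = i"
  by (simp_all add: swap_def)

text \<open>Each pair turns during exactly one letter. Before its turn its difference points right,
  afterwards left; the turn itself passes through the upper half-plane together with the model.
  Possibly negative heights occur only in the first and last letters, where \<open>vR\<close> and
  \<open>vL\<close> supply the horizontal direction of the model.\<close>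

lemma braid_word3_aligned_inner:
  assumes t: "0 \<le> t" "t \<le> 1" and h: "half_turn t v" and vR: "t < 1/2 \<Longrightarrow> 0 < v $ 1" and vL: "1/2 < t \<Longrightarrow> v $ 1 < 0"
    and ij: "(p = i \<and> q = Suc i) \<or> (p = Suc i \<and> q = i)"
    and kl: "(k, l) \<in> {(i, Suc i), (i, Suc (Suc i)), (Suc i, Suc (Suc i))}"
  shows "aligned (braid_word3 p q t l - braid_word3 p q t k) v"
proof -
  have cb: "cos (pi * x) \<le> 1" "-1 \<le> cos (pi * x)" for x by simp_all
  let ?D = "\<lambda>p q k l. braid_word3 p q t l - braid_word3 p q t k"
  have rot: "aligned u v"
    if "u $ 1 = cos (pi * \<tau>)" "u $ 2 = sin (pi * \<tau>)" "0 \<le> \<tau>" "\<tau> \<le> 1" "t = 0 \<Longrightarrow> \<tau> = 0" "t = 1 \<Longrightarrow> \<tau> = 1" for u \<tau>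
  proof -
    have "u = half_twist 0 \<tau> (Suc 0) - half_twist 0 \<tau> 0"
      unfolding half_twist_diff using that(1,2) by (simp add: vec_eq_iff forall_2)
    then show ?thesis using aligned_half_twist[OF h t that(3-6)] by simp
  qed
  have right: "aligned u v" if "0 < u $ 1" "0 \<le> u $ 2" "t < 1" for u
    using aligned_half_turn_right[OF h t(1)] that by blast
  have left: "aligned u v" if "u $ 1 < 0" "0 \<le> u $ 2" "0 < t" for u
    using aligned_half_turn_left[OF h that(3) t(2)] that by blast
  have all: "aligned (?D p q k l) v"
    if "aligned (?D i (Suc i) i (Suc i)) v" "aligned (?D i (Suc i) i (Suc (Suc i))) v" "aligned (?D i (Suc i) (Suc i) (Suc (Suc i))) v"
      "aligned (?D (Suc i) i i (Suc i)) v" "aligned (?D (Suc i) i i (Suc (Suc i))) v" "aligned (?D (Suc i) i (Suc i) (Suc (Suc i))) v"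
    using ij kl that by auto
  consider "t \<le> 1/2" | "1/2 < t" "t \<le> 3/4" | "3/4 < t" by linarith
  then show ?thesis
  proof cases
    case 1
    define C S where "C = cos (pi * (2 * t))" and "S = sin (pi * (2 * t))"
    have S: "0 \<le> S" unfolding S_def by (rule sin_half_twist) (use t 1 in simp_all)
    have C: "0 < 3/2 + C/2" "0 < 3/2 - C/2" using cb[of "2 * t"] unfolding C_def by linarith+
    have rot1: "aligned u v" if "u $ 1 = C" "u $ 2 = S" for u
      by (rule rot[of u "2 * t"]) (use that t 1 in \<open>simp_all add: C_def S_def\<close>)
    have up: "aligned u v" if "u $ 1 = 3/2 + C/2" "u $ 2 = S/2" for u
      by (rule right) (use that 1 S C in simp_all)
    \<comment> \<open>The height is not positive, so alignment must come from the horizontal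
      direction. At \<open>t = 1/2\<close>, where \<open>vR\<close> says nothing, the height has
      returned to 0.\<close>
    have down: "aligned u v" if u: "u $ 1 = 3/2 - C/2" "u $ 2 = - S/2" for u
    proof (cases "t = 1/2")
      case True
      then have "2 * t = 1" by simp
      then have "S = 0" unfolding S_def by (simp only: mult_1_right sin_pi)
      then show ?thesis by (intro right) (use u True C in simp_all)
    next
      case False
      then have "0 < v $ 1" using vR 1 by simp
      then show ?thesis using C(2) u by (simp add: aligned_def)
    qed
    note e = braid_word3_eval(1)[OF 1] half_twist_values swap_values C_def[symmetric] S_def[symmetric]
    show ?thesis
    proof (rule all)
      show "aligned (?D i (Suc i) i (Suc i)) v" by (rule rot1) (simp_all add: e)
      show "aligned (?D i (Suc i) i (Suc (Suc i))) v" by (rule up) (simp_all add: e)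
      show "aligned (?D i (Suc i) (Suc i) (Suc (Suc i))) v" by (rule down) (simp_all add: e)
      show "aligned (?D (Suc i) i i (Suc i)) v" by (rule down) (simp_all add: e)
      show "aligned (?D (Suc i) i i (Suc (Suc i))) v" by (rule up) (simp_all add: e)
      show "aligned (?D (Suc i) i (Suc i) (Suc (Suc i))) v" by (rule rot1) (simp_all add: e)
    qed
  next
    case 2
    define C S where "C = cos (pi * (4 * t - 2))" and "S = sin (pi * (4 * t - 2))"
    have S: "0 \<le> S" unfolding S_def by (rule sin_half_twist) (use t 2 in simp_all)
    have C: "0 < 3/2 + C/2" "- 3/2 + C/2 < 0" using cb[of "4 * t - 2"] unfolding C_def by linarith+
    have rot1: "aligned u v" if "u $ 1 = C" "u $ 2 = S" for u
      by (rule rot[of u "4 * t - 2"]) (use that t 2 in \<open>simp_all add: C_def S_def\<close>)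
    have up: "aligned u v" if "u $ 1 = 3/2 + C/2" "u $ 2 = S/2" for u
      by (rule right) (use that 2 S C in simp_all)
    have up': "aligned u v" if "u $ 1 = - 3/2 + C/2" "u $ 2 = S/2" for u
      by (rule left) (use that 2 S C in simp_all)
    note e = braid_word3_eval(2)[OF 2] half_twist_values swap_values C_def[symmetric] S_def[symmetric]
    show ?thesis
    proof (rule all)
      show "aligned (?D i (Suc i) i (Suc i)) v" by (rule up') (simp_all add: e)
      show "aligned (?D i (Suc i) i (Suc (Suc i))) v" by (rule rot1) (simp_all add: e)
      show "aligned (?D i (Suc i) (Suc i) (Suc (Suc i))) v" by (rule up) (simp_all add: e)
      show "aligned (?D (Suc i) i i (Suc i)) v" by (rule up) (simp_all add: e)
      show "aligned (?D (Suc i) i i (Suc (Suc i))) v" by (rule rot1) (simp_all add: e)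
      show "aligned (?D (Suc i) i (Suc i) (Suc (Suc i))) v" by (rule up') (simp_all add: e)
    qed
  next
    case 3
    define C S where "C = cos (pi * (4 * t - 3))" and "S = sin (pi * (4 * t - 3))"
    have C: "- 3/2 + C/2 < 0" "- 3/2 - C/2 < 0" using cb[of "4 * t - 3"] unfolding C_def by linarith+
    have vl: "v $ 1 < 0" using vL 3 by simp
    have rot1: "aligned u v" if "u $ 1 = C" "u $ 2 = S" for u
      by (rule rot[of u "4 * t - 3"]) (use that t 3 in \<open>simp_all add: C_def S_def\<close>)
    have neg: "aligned u v" if "u $ 1 = - 3/2 + C/2 \<or> u $ 1 = - 3/2 - C/2" for u
      using that C vl by (auto simp: aligned_def)
    note e = braid_word3_eval(3)[OF 3] half_twist_values swap_values C_def[symmetric] S_def[symmetric]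
    show ?thesis
    proof (rule all)
      show "aligned (?D i (Suc i) i (Suc i)) v" by (rule neg) (simp add: e)
      show "aligned (?D i (Suc i) i (Suc (Suc i))) v" by (rule neg) (simp add: e)
      show "aligned (?D i (Suc i) (Suc i) (Suc (Suc i))) v" by (rule rot1) (simp_all add: e)
      show "aligned (?D (Suc i) i i (Suc i)) v" by (rule rot1) (simp_all add: e)
      show "aligned (?D (Suc i) i i (Suc (Suc i))) v" by (rule neg) (simp add: e)
      show "aligned (?D (Suc i) i (Suc i) (Suc (Suc i))) v" by (rule neg) (simp add: e)
    qed
  qed
qed

lemma swap_triple:
  assumes "m = i \<or> m = Suc i"
  shows "i \<le> k \<Longrightarrow> k \<le> i + 2 \<Longrightarrow> i \<le> swap m k \<and> swap m k \<le> i + 2"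
    "\<not> (i \<le> k \<and> k \<le> i + 2) \<Longrightarrow> swap m k = k"
  using assms by (auto simp: swap_def)

lemma half_twist_triple:
  assumes "m = i \<or> m = Suc i"
  shows "i \<le> k \<Longrightarrow> k \<le> i + 2 \<Longrightarrow> real i \<le> half_twist m t k $ 1 \<and> half_twist m t k $ 1 \<le> real i + 2"
    "\<not> (i \<le> k \<and> k \<le> i + 2) \<Longrightarrow> half_twist m t k = point k"
proof -
  assume k: "i \<le> k" "k \<le> i + 2"
  show "real i \<le> half_twist m t k $ 1 \<and> half_twist m t k $ 1 \<le> real i + 2"
  proof (cases "k = m \<or> k = Suc m")
    case True
    then show ?thesis using half_twist_range(1,2)[OF True, of t] assms by auto
  next
    case False
    then show ?thesis using k by (simp add: half_twist_outside)
  qed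
next
  assume "\<not> (i \<le> k \<and> k \<le> i + 2)"
  then have "k \<noteq> m" "k \<noteq> Suc m" using assms by auto
  then show "half_twist m t k = point k" by (rule half_twist_outside)
qed

lemma braid_word3_triple:
  assumes p: "p = i \<or> p = Suc i" and q: "q = i \<or> q = Suc i"
  shows "i \<le> k \<Longrightarrow> k \<le> i + 2 \<Longrightarrow> real i \<le> braid_word3 p q t k $ 1 \<and> braid_word3 p q t k $ 1 \<le> real i + 2"
    "\<not> (i \<le> k \<and> k \<le> i + 2) \<Longrightarrow> braid_word3 p q t k = point k"
proof -
  note s = swap_triple[OF p] swap_triple[OF q] and h = half_twist_triple[OF p] half_twist_triple[OF q]
  have t: "t \<le> 1/2 \<or> (1/2 < t \<and> t \<le> 3/4) \<or> 3/4 < t" by linarith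
  { assume k: "i \<le> k" "k \<le> i + 2"
    show "real i \<le> braid_word3 p q t k $ 1 \<and> braid_word3 p q t k $ 1 \<le> real i + 2"
      using t by (elim disjE conjE; simp only: braid_word3_eval; intro h; simp only: s k) }
  { assume k: "\<not> (i \<le> k \<and> k \<le> i + 2)"
    have "half_twist p \<tau> k = point k" "half_twist q \<tau> k = point k" "swap p k = k" "swap q k = k" for \<tau>
      using h(2,4)[OF k] s(2,4)[OF k] by simp_all
    then show "braid_word3 p q t k = point k"
      using t by (elim disjE conjE) (simp_all only: braid_word3_eval) }
qed

lemma braid_word3_aligned:
  assumes t: "0 \<le> t" "t \<le> 1" and pq: "(p = i \<and> q = Suc i) \<or> (p = Suc i \<and> q = i)" and kl: "k < l"
  shows "aligned (braid_word3 p q t l - braid_word3 p q t k) (half_turn3 i t l - half_turn3 i t k)"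
proof (cases "i \<le> k \<and> l \<le> i + 2")
  case True
  have d: "half_turn3 i t l - half_turn3 i t k = (real l - real k) *\<^sub>R vector [1 - 2 * t, t * (1 - t)]"
    using half_turn3_diff True kl by blast
  have "half_turn t (half_turn3 i t l - half_turn3 i t k)" using half_turn_half_turn3 True kl by blast
  moreover have "0 < (half_turn3 i t l - half_turn3 i t k) $ 1" if "t < 1/2"
    unfolding d using that kl by simp
  moreover have "(half_turn3 i t l - half_turn3 i t k) $ 1 < 0" if "1/2 < t"
    unfolding d using that kl by (simp add: mult_pos_neg)
  moreover have "(k, l) \<in> {(i, Suc i), (i, Suc (Suc i)), (Suc i, Suc (Suc i))}" using True kl by auto
  ultimately show ?thesis by (intro braid_word3_aligned_inner[OF t _ _ _ pq]) auto
next
  case False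
  have p: "p = i \<or> p = Suc i" "q = i \<or> q = Suc i" using pq by auto
  show ?thesis
  proof (rule aligned_order)
    show "braid_word3 p q t k $ 1 < braid_word3 p q t l $ 1"
      by (rule order_of_ranges[OF kl False braid_word3_triple[OF p]])
    show "half_turn3 i t k $ 1 < half_turn3 i t l $ 1" by (rule half_turn3_order[OF kl False t])
  qed
qed

lemma braid_word3_ends:
  assumes pq: "(p = i \<and> q = Suc i) \<or> (p = Suc i \<and> q = i)"
  shows "braid_word3 p q 0 k = half_turn3 i 0 k" "braid_word3 p q 1 k = half_turn3 i 1 k"
proof -
  show "braid_word3 p q 0 k = half_turn3 i 0 k"
    by (simp add: braid_word3_eval half_twist_0 half_turn3_def vec_eq_iff forall_2)
  have "swap p (swap q (swap p k)) = (if i \<le> k \<and> k \<le> i + 2 then 2 * i + 2 - k else k)"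
    using pq by (auto simp: swap_def)
  then show "braid_word3 p q 1 k = half_turn3 i 1 k"
    by (simp add: braid_word3_eval half_twist_1 half_turn3_def vec_eq_iff forall_2 of_nat_diff)
qed

lemma braid_word2_eval:
  "t \<le> 1/2 \<Longrightarrow> braid_word2 i j t k = half_twist i (2 * t) k"
  "1/2 < t \<Longrightarrow> braid_word2 i j t k = half_twist j (2 * t - 1) (swap i k)"
  by (simp_all add: braid_word2_def relabel_concat_def)

text \<open>A pair turns in one half of the time. In the other half its difference is constantly
  \<open>(1, 0)\<close>, if the turn is still to come, or \<open>(-1, 0)\<close>, if it is
  over.\<close>

lemma braid_word2_aligned_inner:
  assumes t: "0 \<le> t" "t \<le> 1" and h: "half_turn t v" and pq: "p + 2 \<le> q \<or> q + 2 \<le> p" and m: "m = p \<or> m = q"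
  shows "aligned (braid_word2 p q t (Suc m) - braid_word2 p q t m) v"
proof (cases "t \<le> 1/2")
  case True
  show ?thesis
  proof (cases "m = p")
    case m: True
    have "aligned (half_twist p (2 * t) (Suc p) - half_twist p (2 * t) p) v"
      by (rule aligned_half_twist[OF h t]) (use t True in simp_all)
    then show ?thesis unfolding braid_word2_eval(1)[OF True] m .
  next
    case False
    then have "m \<noteq> p" "m \<noteq> Suc p" "Suc m \<noteq> p" "Suc m \<noteq> Suc p" using pq m by auto
    then have "braid_word2 p q t (Suc m) - braid_word2 p q t m = vector [1, 0]"
      unfolding braid_word2_eval(1)[OF True] by (simp add: half_twist_outside vec_eq_iff forall_2)
    then show ?thesis using aligned_half_turn_right[OF h t(1), of "vector [1, 0]"] True by simp
  qed
next
  case False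
  then have t': "1/2 < t" by simp
  show ?thesis
  proof (cases "m = q")
    case m: True
    have "swap p q = q" "swap p (Suc q) = Suc q" using pq by (auto simp: swap_def)
    moreover have "aligned (half_twist q (2 * t - 1) (Suc q) - half_twist q (2 * t - 1) q) v"
      by (rule aligned_half_twist[OF h t]) (use t t' in simp_all)
    ultimately show ?thesis unfolding braid_word2_eval(2)[OF t'] m by simp
  next
    case False
    then have "m = p" using m by simp
    moreover have "swap p p = Suc p" "swap p (Suc p) = p" by (auto simp: swap_def)
    moreover have "p \<noteq> q" "Suc p \<noteq> q" "p \<noteq> Suc q" using pq by auto
    ultimately have "braid_word2 p q t (Suc m) - braid_word2 p q t m = vector [- 1, 0]"
      unfolding braid_word2_eval(2)[OF t'] by (simp add: half_twist_outside vec_eq_iff forall_2)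
    then show ?thesis using aligned_half_turn_left[OF h _ t(2), of "vector [- 1, 0]"] t' by simp
  qed
qed

lemma braid_word2_order:
  assumes kl: "k < l" and pq: "p + 2 \<le> q \<or> q + 2 \<le> p" and n: "\<not> (k = p \<and> l = Suc p)" "\<not> (k = q \<and> l = Suc q)"
  shows "braid_word2 p q t k $ 1 < braid_word2 p q t l $ 1"
proof (cases "t \<le> 1/2")
  case True
  then show ?thesis unfolding braid_word2_eval(1)[OF True] by (intro half_twist_order kl n(1))
next
  case False
  then have t': "1/2 < t" by simp
  have "swap p k < swap p l" "\<not> (swap p k = q \<and> swap p l = Suc q)"
    using kl n pq by (auto simp: swap_def)
  then show ?thesis unfolding braid_word2_eval(2)[OF t'] by (rule half_twist_order)
qed

lemma both_twists_order:
  assumes kl: "k < l" and ij: "i + 2 \<le> j" and n: "\<not> (k = i \<and> l = Suc i)" "\<not> (k = j \<and> l = Suc j)"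
  shows "both_twists i j t k $ 1 < both_twists i j t l $ 1"
proof (cases "k = i \<or> k = Suc i")
  case k: True
  then have l: "i + 2 \<le> l" using kl n by auto
  then have ll: "both_twists i j t l = half_twist j t l" by (simp add: both_twists_def)
  have "real i + 1 < both_twists i j t l $ 1"
  proof (cases "l = j \<or> l = Suc j")
    case True
    then show ?thesis using half_twist_range(1)[OF True, of t] ij ll by simp
  next
    case False
    then show ?thesis using l ll by (simp add: half_twist_outside)
  qed
  then show ?thesis using half_twist_range(2)[OF k, of t] k by (simp add: both_twists_def)
next
  case k: False
  then have kk: "both_twists i j t k = half_twist j t k" by (simp add: both_twists_def)
  show ?thesis
  proof (cases "l = i \<or> l = Suc i")
    case True
    then have "k < i" using k kl by auto
    then have "both_twists i j t k = point k" using kk ij by (simp add: half_twist_outside)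
    then show ?thesis using half_twist_range(1)[OF True, of t] True \<open>k < i\<close> by (simp add: both_twists_def)
  next
    case False
    then have "both_twists i j t l = half_twist j t l" by (simp add: both_twists_def)
    then show ?thesis unfolding kk using half_twist_order[OF kl n(2)] by simp
  qed
qed

lemma braid_word2_aligned:
  assumes t: "0 \<le> t" "t \<le> 1" and ij: "i + 2 \<le> j" and pq: "(p = i \<and> q = j) \<or> (p = j \<and> q = i)" and kl: "k < l"
  shows "aligned (braid_word2 p q t l - braid_word2 p q t k) (both_twists i j t l - both_twists i j t k)"
proof -
  have pq': "p + 2 \<le> q \<or> q + 2 \<le> p" using pq ij by auto
  have b: "both_twists i j t (Suc m) - both_twists i j t m = half_twist m t (Suc m) - half_twist m t m"
    if "m = i \<or> m = j" for m
    using that ij by (auto simp: both_twists_def)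
  show ?thesis
  proof (cases "(k = i \<and> l = Suc i) \<or> (k = j \<and> l = Suc j)")
    case True
    then have k: "k = i \<or> k = j" and l: "l = Suc k" by auto
    have "half_turn t (both_twists i j t (Suc k) - both_twists i j t k)"
      unfolding b[OF k] by (rule half_turn_half_twist[OF t])
    then show ?thesis
      unfolding l by (rule braid_word2_aligned_inner[OF t _ pq']) (use k pq in auto)
  next
    case False
    show ?thesis
    proof (rule aligned_order)
      show "braid_word2 p q t k $ 1 < braid_word2 p q t l $ 1"
        by (rule braid_word2_order[OF kl pq']) (use False pq in auto)
      show "both_twists i j t k $ 1 < both_twists i j t l $ 1"
        by (rule both_twists_order[OF kl ij]) (use False in auto)
    qed
  qed
qed

lemma both_twists_ends:
  assumes ij: "i + 2 \<le> j" and pq: "(p = i \<and> q = j) \<or> (p = j \<and> q = i)"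
  shows "braid_word2 p q 0 k = both_twists i j 0 k" "braid_word2 p q 1 k = both_twists i j 1 k"
proof -
  show "braid_word2 p q 0 k = both_twists i j 0 k"
    by (simp add: braid_word2_eval half_twist_0 both_twists_def)
  have "swap q (swap p k) = (if k = i \<or> k = Suc i then swap i k else swap j k)"
    using pq
  proof (elim disjE conjE)
    assume "p = i" "q = j"
    then show ?thesis using ij by (simp add: swap_def)
  next
    assume "p = j" "q = i"
    then show ?thesis using ij by (simp add: swap_def)
  qed
  then show "braid_word2 p q 1 k = both_twists i j 1 k"
    by (simp add: braid_word2_eval half_twist_1 both_twists_def)
qed

lemma braid_path_both_twists:
  assumes ij: "i + 2 \<le> j" "j < 4"
  shows "braid_path (both_twists i j)"
  unfolding braid_path_def
proof (intro conjI allI impI ballI)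
  have b: "braid_path (braid_word2 i j)" using assms by (intro braid_path_word2) auto
  have "both_twists i j s ` {..<5} = braid_word2 i j s ` {..<5}" if "s = 0 \<or> s = 1" for s
    using both_twists_ends[OF ij(1), of i j] that by auto
  then show "both_twists i j 0 ` {..<5} = point ` {..<5}" "both_twists i j 1 ` {..<5} = point ` {..<5}"
    using b by (simp_all add: braid_path_def)
next
  fix k :: nat
  show "continuous_on {0..1} (\<lambda>t. both_twists i j t k)"
    unfolding both_twists_def by (cases "k = i \<or> k = Suc i") (simp_all add: continuous_half_twist)
next
  fix t :: real and k :: nat assume "t \<in> {0..1}" "k < 5"
  then show "both_twists i j t k \<in> braid_box"
    using half_twist_in_braid_box[of i k t] half_twist_in_braid_box[of j k t] ij by (simp add: both_twists_def)
next
  fix t :: real assume t: "t \<in> {0..1}"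
  \<comment> \<open>The end of an aligned segment is nonzero, so the comparison with a word also
    excludes collisions in the model.\<close>
  have "both_twists i j t k \<noteq> both_twists i j t l" if "k < l" for k l
    using aligned_segment[OF braid_word2_aligned[of t i j i j k l], of 1] t ij(1) that by auto
  then show "inj_on (both_twists i j t) {..<5}"
    by (intro linorder_inj_onI) auto
qed

section \<open>Loops of configurations in an embedded disc\<close>

text \<open>\<open>R\<close> holds the marked points that do not move. It avoids the image of the
  whole box, so strands moving in the box never meet it.\<close>

locale marked_disc = oriented_surface X A
  for X :: "'a topology" and A :: "'a chart set" +
  fixes n :: nat and \<iota> :: "real^2 \<Rightarrow> 'a" and R :: "'a set"
  assumes embed_continuous: "continuous_map (top_of_set braid_box) X \<iota>"
    and embed_inj: "inj_on \<iota> braid_box" and embed_interior: "\<iota> ` braid_box \<subseteq> surface_interior X A"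
    and R: "finite R" "R \<subseteq> surface_interior X A" "R \<inter> \<iota> ` braid_box = {}" and n: "n = card R + 5"
begin

definition config :: "(real \<Rightarrow> nat \<Rightarrow> real^2) \<Rightarrow> real \<Rightarrow> 'a set" where
  "config z t = \<iota> ` z t ` {..<5} \<union> R"

definition base :: "'a set" where
  "base = \<iota> ` point ` {..<5} \<union> R"

abbreviation Y :: "'a set topology" where "Y \<equiv> Conf X A n"

lemma continuous_config:
  fixes z :: "'b \<Rightarrow> nat \<Rightarrow> real^2"
  assumes z: "\<And>k. k < 5 \<Longrightarrow> continuous_map Z (top_of_set braid_box) (\<lambda>w. z w k)"
    and inj: "\<And>w. w \<in> topspace Z \<Longrightarrow> inj_on (z w) {..<5}"
  shows "continuous_map Z Y (\<lambda>w. \<iota> ` z w ` {..<5} \<union> R)"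
proof -
  \<comment> \<open>Enumerating \<open>R\<close> completes the five strands to an
    \<open>n\<close>-tuple, the form in which continuity into \<open>Conf\<close> is
    checked.\<close>
  obtain e where e: "bij_betw e {5..<n} R"
    using finite_same_card_bij[of "{5..<n}" R] R(1) n by auto
  define F where "F w k = (if k < 5 then \<iota> (z w k) else e k)" for w k
  have eR: "e k \<in> R" if "k < n" "\<not> k < 5" for k using e that by (auto simp: bij_betw_def)
  have zb: "z w k \<in> braid_box" if "w \<in> topspace Z" "k < 5" for w k
    using z[OF that(2)] that(1) by (auto simp: continuous_map_in_subtopology)
  have img: "F w ` {..<n} = \<iota> ` z w ` {..<5} \<union> R" for w
  proof -
    have "{..<n} = {..<5} \<union> {5..<n}" using n by auto
    then have "F w ` {..<n} = F w ` {..<5} \<union> F w ` {5..<n}" by (simp only: image_Un)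
    moreover have "F w ` {..<5} = \<iota> ` z w ` {..<5}" unfolding image_image by (rule image_cong) (simp_all add: F_def)
    moreover have "F w ` {5..<n} = e ` {5..<n}" by (rule image_cong) (simp_all add: F_def)
    ultimately show ?thesis using e by (simp add: bij_betw_def)
  qed
  have "continuous_map Z Y (\<lambda>w. F w ` {..<n})"
  proof (rule continuous_map_Conf)
    fix k assume k: "k < n"
    show "continuous_map Z X (\<lambda>w. F w k)"
    proof (cases "k < 5")
      case True
      then show ?thesis using continuous_map_compose[OF z[OF True] embed_continuous] by (simp add: F_def comp_def)
    next
      case False
      then show ?thesis using eR[OF k False] R(2) interior_subset by (auto simp: F_def)
    qed
    fix w assume w: "w \<in> topspace Z"
    show "F w k \<in> surface_interior X A"
    proof (cases "k < 5")
      case True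
      then show ?thesis using zb[OF w True] embed_interior by (auto simp: F_def)
    next
      case False
      then show ?thesis using eR[OF k False] R(2) by (auto simp: F_def)
    qed
  next
    fix w assume w: "w \<in> topspace Z"
    have ne: "F w k \<noteq> F w l" if "k < l" "l < n" for k l
    proof (cases "l < 5")
      case True
      then have "z w k \<noteq> z w l" using inj[OF w] that by (auto simp: inj_on_def)
      then show ?thesis using inj_onD[OF embed_inj] zb[OF w] that True by (auto simp: F_def)
    next
      case l: False
      show ?thesis
      proof (cases "k < 5")
        case True
        have "F w k \<in> \<iota> ` braid_box" using zb[OF w True] True by (simp add: F_def)
        moreover have "F w l \<in> R" using eR[OF that(2) l] l by (simp add: F_def)
        ultimately show ?thesis using R(3) by auto
      next
        case False
        then have "k \<in> {5..<n}" "l \<in> {5..<n}" "k \<noteq> l" using that l by simp_all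
        moreover have "inj_on e {5..<n}" using e by (rule bij_betw_imp_inj_on)
        ultimately have "e k \<noteq> e l" using inj_on_eq_iff by metis
        then show ?thesis using False l by (simp add: F_def)
      qed
    qed
    show "inj_on (F w) {..<n}" by (rule linorder_inj_onI) (use ne in auto)
  qed
  then show ?thesis by (simp only: img)
qed

lemma config_loop:
  assumes z: "braid_path z"
  shows "config z \<in> loops_at Y base"
proof -
  have "continuous_map (top_of_set {0..1}) Y (\<lambda>t. \<iota> ` z t ` {..<5} \<union> R)"
    by (rule continuous_config) (use z in \<open>auto simp: braid_path_def continuous_map_in_subtopology\<close>)
  then have "pathin Y (config z)" by (simp add: pathin_def config_def[abs_def])
  then show ?thesis using z by (simp add: loops_at_def config_def base_def braid_path_def)
qed

lemma convex_braid_box: "convex braid_box"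
proof -
  have eq: "braid_box = {v. 0 \<le> v $ 1} \<inter> {v. v $ 1 \<le> 4} \<inter> {v. -1 \<le> v $ 2} \<inter> {v. v $ 2 \<le> 1}"
    by (auto simp: braid_box_def)
  have c: "convex {v::real^2. a \<le> v $ i}" "convex {v::real^2. v $ i \<le> a}" for a i
  proof -
    have "{v::real^2. a \<le> v $ i} = {v. inner (axis i 1) v \<ge> a}" "{v::real^2. v $ i \<le> a} = {v. inner (axis i 1) v \<le> a}"
      by (simp_all add: inner_axis' )
    then show "convex {v::real^2. a \<le> v $ i}" "convex {v::real^2. v $ i \<le> a}"
      by (simp_all only: convex_halfspace_ge convex_halfspace_le)
  qed
  show ?thesis unfolding eq by (intro convex_Int c)
qed

text \<open>Straight-line homotopy: \<^const>\<open>aligned\<close> excludes collisions.\<close>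

lemma config_homotopy:
  assumes z: "braid_path z" and y: "braid_path y"
    and al: "\<And>t k l. 0 \<le> t \<Longrightarrow> t \<le> 1 \<Longrightarrow> k < l \<Longrightarrow> aligned (z t l - z t k) (y t l - y t k)"
    and ends: "\<And>k. z 0 k = y 0 k" "\<And>k. z 1 k = y 1 k"
  shows "(config z, config y) \<in> loop_homotopy Y base"
proof -
  define h where "h w k = (1 - fst w) *\<^sub>R z (snd w) k + fst w *\<^sub>R y (snd w) k" for w :: "real \<times> real" and k
  have "continuous_map (top_of_set unit_square) Y (\<lambda>w. \<iota> ` h w ` {..<5} \<union> R)"
  proof (rule continuous_config)
    fix k :: nat assume k: "k < 5"
    have c: "continuous_on unit_square (\<lambda>w. x (snd w) k)" if "braid_path x" for x
      by (rule continuous_on_compose2[of "{0..1}" "\<lambda>t. x t k"])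
        (use that k in \<open>auto simp: braid_path_def intro!: continuous_intros\<close>)
    have "continuous_on unit_square (\<lambda>w. h w k)"
      unfolding h_def by (intro continuous_intros c z y)
    moreover have "h w k \<in> braid_box" if "w \<in> unit_square" for w
    proof -
      have "snd w \<in> {0..1}" "fst w \<in> {0..1}" using that by auto
      then show ?thesis
        unfolding h_def using z y k by (intro convexD[OF convex_braid_box]) (simp_all add: braid_path_def)
    qed
    ultimately show "continuous_map (top_of_set unit_square) (top_of_set braid_box) (\<lambda>w. h w k)"
      by (auto simp: continuous_map_in_subtopology)
  next
    fix w assume "w \<in> topspace (top_of_set unit_square)"
    then have w: "0 \<le> fst w" "fst w \<le> 1" "0 \<le> snd w" "snd w \<le> 1" by auto
    have "h w k \<noteq> h w l" if "k < l" for k l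
    proof -
      have "h w l - h w k = (1 - fst w) *\<^sub>R (z (snd w) l - z (snd w) k) + fst w *\<^sub>R (y (snd w) l - y (snd w) k)"
        by (simp add: h_def algebra_simps)
      then show ?thesis using aligned_segment[OF al[OF w(3,4) that] w(1,2)] by auto
    qed
    then show "inj_on (h w) {..<5}" by (intro linorder_inj_onI) auto
  qed
  moreover have "h (0, t) = z t" "h (1, t) = y t" for t by (simp_all add: h_def fun_eq_iff)
  moreover have "h (s, 0) = z 0" "h (s, 1) = z 1" for s
    by (simp_all add: h_def fun_eq_iff ends[symmetric] flip: scaleR_add_left)
  ultimately show ?thesis
    unfolding loop_homotopy_iff using z
    by (intro exI[of _ "\<lambda>w. \<iota> ` h w ` {..<5} \<union> R"]) (simp add: config_def base_def braid_path_def)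
qed

lemma config_relabel_concat:
  assumes "\<pi> ` {..<5} = {..<5}"
  shows "config (relabel_concat \<pi> y z) = path_concat (config y) (config z)"
proof
  fix t
  show "config (relabel_concat \<pi> y z) t = path_concat (config y) (config z) t"
  proof (cases "t \<le> 1/2")
    case True
    then have "relabel_concat \<pi> y z t = y (2 * t)" by (simp add: fun_eq_iff relabel_concat_def)
    then show ?thesis using True by (simp add: config_def path_concat_def)
  next
    case False
    then have "relabel_concat \<pi> y z t ` {..<5} = z (2 * t - 1) ` \<pi> ` {..<5}"
      by (simp add: relabel_concat_def image_image)
    then show ?thesis using False assms by (simp add: config_def path_concat_def)
  qed
qed

definition gen :: "nat \<Rightarrow> (real \<Rightarrow> 'a set) set" where
  "gen i = loop_homotopy Y base `` {config (half_twist i)}"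

abbreviation B :: "(real \<Rightarrow> 'a set) set monoid" where "B \<equiv> surface_braid_group X A n base"

lemma gen_carrier: "i < 4 \<Longrightarrow> gen i \<in> carrier B"
  unfolding gen_def surface_braid_group_def
  by (rule fundamental_group_class[OF config_loop[OF braid_path_half_twist]])

text \<open>The right factor of a product is traversed first, so the word is read as
  \<open>j\<close> and then \<open>i\<close>.\<close>

lemma gen_mult2:
  assumes "i < 4" "j < 4"
  shows "gen i \<otimes>\<^bsub>B\<^esub> gen j = loop_homotopy Y base `` {config (braid_word2 j i)}"
proof -
  have "swap j ` {..<5} = {..<5}" using swap_image[of j 5] assms by simp
  then show ?thesis
    unfolding gen_def surface_braid_group_def braid_word2_def config_relabel_concat[OF \<open>swap j ` {..<5} = {..<5}\<close>]
    by (intro fundamental_group_mult config_loop braid_path_half_twist assms)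
qed

lemma gen_mult3:
  assumes "i < 4" "j < 4"
  shows "gen i \<otimes>\<^bsub>B\<^esub> gen j \<otimes>\<^bsub>B\<^esub> gen i = loop_homotopy Y base `` {config (braid_word3 i j)}"
proof -
  have s: "swap i ` {..<5} = {..<5}" using swap_image[of i 5] assms by simp
  have "config (braid_word3 i j) = path_concat (config (half_twist i)) (config (braid_word2 j i))"
    unfolding braid_word3_def config_relabel_concat[OF s] braid_word2_def ..
  then show ?thesis
    unfolding gen_mult2[OF assms] unfolding gen_def surface_braid_group_def
    using fundamental_group_mult[OF config_loop[OF braid_path_word2[OF assms(2,1)]]
        config_loop[OF braid_path_half_twist[OF assms(1)]]] by simp
qed

lemma class_eq: "(\<gamma>, \<delta>) \<in> loop_homotopy Y base \<Longrightarrow> loop_homotopy Y base `` {\<gamma>} = loop_homotopy Y base `` {\<delta>}"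
  by (rule equiv_class_eq[OF equiv_loop_homotopy])

text \<open>Both words are deformed to the same \<open>half_turn3\<close>, so no direct homotopy
  between them is needed.\<close>

lemma gen_braid:
  assumes i: "i + 2 < 5"
  shows "gen i \<otimes>\<^bsub>B\<^esub> gen (Suc i) \<otimes>\<^bsub>B\<^esub> gen i = gen (Suc i) \<otimes>\<^bsub>B\<^esub> gen i \<otimes>\<^bsub>B\<^esub> gen (Suc i)"
proof -
  have i4: "i < 4" "Suc i < 4" using i by auto
  have hom: "(config (braid_word3 p q), config (half_turn3 i)) \<in> loop_homotopy Y base"
    if pq: "(p = i \<and> q = Suc i) \<or> (p = Suc i \<and> q = i)" for p q
  proof (rule config_homotopy[OF _ braid_path_half_turn3[OF i]])
    show "braid_path (braid_word3 p q)" by (rule braid_path_word3) (use pq i4 in auto)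
    show "aligned (braid_word3 p q t l - braid_word3 p q t k) (half_turn3 i t l - half_turn3 i t k)"
      if "0 \<le> t" "t \<le> 1" "k < l" for t k l by (rule braid_word3_aligned[OF that(1,2) pq that(3)])
  qed (rule braid_word3_ends[OF pq])+
  show ?thesis
    unfolding gen_mult3[OF i4] gen_mult3[OF i4(2,1)]
    using class_eq[OF hom[of i "Suc i"]] class_eq[OF hom[of "Suc i" i]] by simp
qed

lemma gen_commute:
  assumes ij: "i + 2 \<le> j" "j < 4"
  shows "gen i \<otimes>\<^bsub>B\<^esub> gen j = gen j \<otimes>\<^bsub>B\<^esub> gen i"
proof -
  have i4: "i < 4" using ij by auto
  have hom: "(config (braid_word2 p q), config (both_twists i j)) \<in> loop_homotopy Y base"
    if pq: "(p = i \<and> q = j) \<or> (p = j \<and> q = i)" for p q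
  proof (rule config_homotopy[OF _ braid_path_both_twists[OF ij]])
    show "braid_path (braid_word2 p q)" by (rule braid_path_word2) (use pq i4 ij in auto)
    show "aligned (braid_word2 p q t l - braid_word2 p q t k) (both_twists i j t l - both_twists i j t k)"
      if "0 \<le> t" "t \<le> 1" "k < l" for t k l by (rule braid_word2_aligned[OF that(1,2) ij(1) pq that(3)])
  qed (rule both_twists_ends[OF ij(1) pq])+
  show ?thesis
    unfolding gen_mult2[OF i4 ij(2)] gen_mult2[OF ij(2) i4]
    using class_eq[OF hom[of i j]] class_eq[OF hom[of j i]] by simp
qed

end

section \<open>The permutation induced by point-pushing\<close>

context oriented_surface
begin

lemma C1_topology_topspace_subset: "topspace (C1_topology X A) \<subseteq> Diff X A"
  unfolding C1_topology_def topology_generated_by_topspace by (auto simp: C1_nhd_def)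

lemma Diff_in_C1_topology:
  assumes "f \<in> Diff X A" "topspace X \<noteq> {}"
  shows "f \<in> topspace (C1_topology X A)"
  using C1_family_continuous_path[OF Diff_family[OF assms(1)] assms(1,2)]
    continuous_map_image_subset_topspace[of euclideanreal "C1_topology X A" "\<lambda>_. f"] by auto

text \<open>The neighbourhoods with compact set \<open>{p}\<close> already control the value at
  \<open>p\<close>.\<close>

lemma C1_topology_eval:
  assumes p: "p \<in> topspace X"
  shows "continuous_map (C1_topology X A) X (\<lambda>f. f p)"
  unfolding continuous_map_def
proof (intro conjI allI impI)
  let ?T = "C1_topology X A"
  show "(\<lambda>f. f p) \<in> topspace ?T \<rightarrow> topspace X"
    using C1_topology_topspace_subset Bij_apply[OF Diff_Bij _] p by blast
  fix U assume U: "openin X U"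
  show "openin ?T {f \<in> topspace ?T. f p \<in> U}"
  proof (subst openin_subopen, intro ballI)
    fix f assume f: "f \<in> {f \<in> topspace ?T. f p \<in> U}"
    then have fD: "f \<in> Diff X A" "f p \<in> U" using C1_topology_topspace_subset by auto
    obtain c where c: "c \<in> A" "p \<in> fst c" using chart_at[OF p] by blast
    obtain d where d: "d \<in> A" "f p \<in> fst d" using chart_at openin_subset[OF U] fD(2) by blast
    note dh = atlas_chart[OF d(1)]
    have "openin (top_of_set half_plane) (snd d ` (fst d \<inter> U))"
      by (rule chart_openin_image[OF dh openin_Int[OF chart_openin[OF dh] U]]) simp
    moreover have "snd d (f p) \<in> snd d ` (fst d \<inter> U)" using d fD by blast
    ultimately obtain e where e: "e > 0" "ball (snd d (f p)) e \<inter> half_plane \<subseteq> snd d ` (fst d \<inter> U)"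
      unfolding openin_contains_ball by blast
    let ?N = "C1_nhd X A c d f {p} e"
    have "compactin X {p}" using p by (simp add: finite_imp_compactin)
    then have "c \<in> A \<and> d \<in> A \<and> f \<in> Diff X A \<and> compactin X {p} \<and> {p} \<subseteq> fst c \<and> f ` {p} \<subseteq> fst d \<and> 0 < e"
      using c d fD e by simp
    then have "openin ?T ?N"
      unfolding C1_topology_def by (intro topology_generated_by_Basis) blast
    moreover have "f \<in> ?N" using fD d e by (simp add: C1_nhd_def)
    moreover have "?N \<subseteq> {f \<in> topspace ?T. f p \<in> U}"
    proof
      fix g assume g: "g \<in> ?N"
      then have gd: "g p \<in> fst d" "dist (snd d (g p)) (snd d (f p)) < e" by (auto simp: C1_nhd_def)
      then have "snd d (g p) \<in> ball (snd d (f p)) e \<inter> half_plane"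
        using chart_in_half_plane[OF dh] by (simp add: dist_commute)
      then obtain q where "q \<in> fst d" "q \<in> U" "snd d (g p) = snd d q" using e(2) by blast
      then have "g p \<in> U" using inj_onD[OF chart_inj[OF dh]] gd(1) by metis
      then show "g \<in> {f \<in> topspace ?T. f p \<in> U}" using openin_subset[OF \<open>openin ?T ?N\<close>] g by blast
    qed
    ultimately show "\<exists>T. openin ?T T \<and> f \<in> T \<and> T \<subseteq> {f \<in> topspace ?T. f p \<in> U}" by blast
  qed
qed

lemma path_eval:
  assumes "pathin (subtopology (C1_topology X A) S) f" "p \<in> topspace X"
  shows "continuous_map (top_of_set {0..1}) X (\<lambda>t. f t p)"
  using continuous_map_compose[OF _ C1_topology_eval[OF assms(2)], of "top_of_set {0..1}" f] assms(1)
  by (simp add: pathin_def continuous_map_in_subtopology comp_def)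

text \<open>Along a path in \<open>Diff_marked\<close> the image of a marked point moves
  continuously in the finite set \<open>P\<close>.\<close>

lemma mapping_class_permutation:
  assumes P: "finite P" "P \<subseteq> topspace X" and fg: "g \<in> mapping_class X A P f" and p: "p \<in> P"
  shows "g p = f p"
proof -
  obtain h where h: "pathin (subtopology (C1_topology X A) (Diff_marked X A P)) h" "h 0 = f" "h 1 = g"
    using fg unfolding mapping_class_def path_component_of_def by blast
  have hP: "h t p \<in> P" if "t \<in> {0..1}" for t
  proof -
    have "h t \<in> Diff_marked X A P" using h(1) that by (simp add: pathin_subtopology)
    then show ?thesis using p by (auto simp: Diff_marked_def)
  qed
  have "h 0 p = h 1 p"
  proof (rule continuous_map_finite_const[of "top_of_set {0..1::real}" X "\<lambda>t. h t p" P])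
    show "continuous_map (top_of_set {0..1}) X (\<lambda>t. h t p)" using path_eval[OF h(1)] p P(2) by blast
  qed (use hP Hausdorff P(1) in auto)
  then show ?thesis using h by simp
qed

text \<open>Under a lift, a marked point traces a strand of the loop, so \<open>monodromy\<close>
  compares the endpoints for homotopic loops.\<close>

lemma lift_permutation:
  assumes P: "P \<in> topspace (Conf X A n)"
    and hom: "(\<gamma>, \<delta>) \<in> loop_homotopy (Conf X A n) P"
    and f: "lifts_loop X A P \<gamma> f" and g: "lifts_loop X A P \<delta> g" and p: "p \<in> P"
  shows "f 1 p = g 1 p"
proof -
  obtain h where h: "continuous_map (top_of_set unit_square) (Conf X A n) h"
      "\<forall>t\<in>{0..1}. h (0, t) = \<gamma> t" "\<forall>t\<in>{0..1}. h (1, t) = \<delta> t"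
      "\<forall>s\<in>{0..1}. h (s, 0) = P" "\<forall>s\<in>{0..1}. h (s, 1) = P"
    using hom unfolding loop_homotopy_iff by (elim exE conjE) (rule that)
  have pX: "p \<in> topspace X" using Conf_member(4)[OF P] p by blast
  have 1: "continuous_map (top_of_set {0..1}) X (\<lambda>t. f t p)" "continuous_map (top_of_set {0..1}) X (\<lambda>t. g t p)"
    using f g path_eval[OF _ pX] unfolding lifts_loop_def by blast+
  have f2: "f t p \<in> h (0, t)" if "t \<in> {0..1}" for t
    using f p h(2) that unfolding lifts_loop_def by (metis imageI)
  have g2: "g t p \<in> h (1, t)" if "t \<in> {0..1}" for t
    using g p h(3) that unfolding lifts_loop_def by (metis imageI)
  have "f 0 p = g 0 p" using f g by (simp add: lifts_loop_def)
  from monodromy[OF Hausdorff h(1) h(4)[rule_format] h(5)[rule_format] 1(1) f2 1(2) g2 this]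
  show ?thesis .
qed

text \<open>The given lift shows that the choice in \<open>point_push\<close> succeeds. Whichever
  loop and lift it picks, they induce the same permutation of \<open>P\<close> as the given
  ones.\<close>

lemma point_push_permutation:
  assumes P: "P \<in> topspace (Conf X A n)" and \<gamma>: "\<gamma> \<in> loops_at (Conf X A n) P"
    and f: "lifts_loop X A P \<gamma> f" and g: "g \<in> Diff_marked X A P"
    and m: "mapping_class X A P g = point_push X A P (loop_homotopy (Conf X A n) P `` {\<gamma>})"
    and p: "p \<in> P"
  shows "g p = f 1 p"
proof -
  let ?C = "loop_homotopy (Conf X A n) P `` {\<gamma>}"
  have "\<gamma> \<in> ?C" by (rule equiv_class_self[OF equiv_loop_homotopy \<gamma>])
  then have "\<exists>m. \<exists>\<gamma>\<in>?C. \<exists>f. lifts_loop X A P \<gamma> f \<and> m = mapping_class X A P (f 1)" using f by blast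
  from someI_ex[OF this] obtain \<delta> h where \<delta>: "\<delta> \<in> ?C" "lifts_loop X A P \<delta> h" "mapping_class X A P g = mapping_class X A P (h 1)"
    unfolding m point_push_def by blast
  have pX: "p \<in> topspace X" using Conf_member(4)[OF P] p by blast
  have ne: "topspace X \<noteq> {}" using pX by blast
  have "g \<in> Diff X A" using g by (simp add: Diff_marked_def Diff_rel_def)
  then have "g \<in> topspace (subtopology (C1_topology X A) (Diff_marked X A P))"
    using g Diff_in_C1_topology[OF _ ne] by simp
  then have "g \<in> mapping_class X A P g" unfolding mapping_class_def by (simp add: path_component_of_refl)
  then have "g p = h 1 p"
    unfolding \<delta>(3) using mapping_class_permutation[OF Conf_member(1,4)[OF P] _ p] by blast
  moreover have "f 1 p = h 1 p" using lift_permutation[OF P _ f \<delta>(2) p] \<delta>(1) by simp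
  ultimately show ?thesis by simp
qed

end

section \<open>Non-realizability\<close>

context marked_disc
begin

lemma base_Conf: "base \<in> topspace Y"
proof -
  have "config (half_twist 0) \<in> loops_at Y base" by (rule config_loop[OF braid_path_half_twist]) simp
  then have "pathin Y (config (half_twist 0))" "config (half_twist 0) 0 = base" by (simp_all add: loops_at_def)
  then show ?thesis unfolding pathin_def using continuous_map_image_subset_topspace by fastforce
qed

lemma half_twist_lift:
  assumes F: "pathin (subtopology (C1_topology X A) (Diff_rel X A)) F" "F 0 = (\<lambda>x\<in>topspace X. x)"
    and pts: "\<And>t k. t \<in> {0..1} \<Longrightarrow> k < 5 \<Longrightarrow> F t (\<iota> (point k)) = \<iota> (half_twist i t k)"
    and rest: "\<And>t q. t \<in> {0..1} \<Longrightarrow> q \<in> R \<Longrightarrow> F t q = q"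
  shows "lifts_loop X A base (config (half_twist i)) F"
proof -
  have "F t ` base = config (half_twist i) t" if t: "t \<in> {0..1}" for t
  proof -
    have "F t ` \<iota> ` point ` {..<5} = \<iota> ` half_twist i t ` {..<5}"
      unfolding image_image by (rule image_cong) (simp_all add: pts[OF t])
    moreover have "F t ` R = R" using rest[OF t] by simp
    ultimately show ?thesis by (simp only: base_def config_def image_Un)
  qed
  then show ?thesis using F by (simp add: lifts_loop_def)
qed

text \<open>The lifts \<open>F i\<close> determine how a realization would permute the marked
  points; the point \<open>z\<close> is then fixed by all four generators, and
  \<open>braid_action_trivial\<close> makes the first two equal.\<close>

theorem not_realized:
  assumes F: "\<And>i. i < 4 \<Longrightarrow> pathin (subtopology (C1_topology X A) (Diff_rel X A)) (F i)"
      "\<And>i. i < 4 \<Longrightarrow> F i 0 = (\<lambda>x\<in>topspace X. x)"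
      "\<And>i t k. i < 4 \<Longrightarrow> t \<in> {0..1} \<Longrightarrow> k < 5 \<Longrightarrow> F i t (\<iota> (point k)) = \<iota> (half_twist i t k)"
      "\<And>i t q. i < 4 \<Longrightarrow> t \<in> {0..1} \<Longrightarrow> q \<in> R \<Longrightarrow> F i t q = q"
    and z: "z \<in> R \<or> z \<in> surface_boundary X A"
  shows "\<not> realized_by_C1_diffeos X A n base"
proof
  assume "realized_by_C1_diffeos X A n base"
  then obtain \<sigma> where hom: "\<sigma> \<in> hom B (Diff_marked_group X A base)"
    and real: "\<And>C. C \<in> carrier B \<Longrightarrow> mapping_class X A base (\<sigma> C) = point_push X A base C"
    unfolding realized_by_C1_diffeos_def by blast
  define g where "g i = \<sigma> (gen i)" for i
  have gM: "g i \<in> Diff_marked X A base" if "i < 4" for i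
    using hom_in_carrier[OF hom gen_carrier[OF that]] by (simp add: g_def Diff_marked_group_def)
  then have gD: "g i \<in> Diff X A" if "i < 4" for i
    using that by (simp add: Diff_marked_def Diff_rel_def)
  have perm: "g i p = F i 1 p" if i: "i < 4" and p: "p \<in> base" for i p
  proof (rule point_push_permutation[OF base_Conf config_loop[OF braid_path_half_twist[OF i]] _ gM[OF i] _ p])
    show "lifts_loop X A base (config (half_twist i)) (F i)"
      by (rule half_twist_lift) (use F i in simp_all)
    show "mapping_class X A base (g i) =
        point_push X A base (loop_homotopy (Conf X A n) base `` {config (half_twist i)})"
      using real[OF gen_carrier[OF i]] by (simp add: g_def gen_def)
  qed
  let ?G = "BijGroup (topspace X)"
  have mult: "\<sigma> (x \<otimes>\<^bsub>B\<^esub> y) = \<sigma> x \<otimes>\<^bsub>?G\<^esub> \<sigma> y" if "x \<in> carrier B" "y \<in> carrier B" for x y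
    using hom_mult[OF hom that] by (simp add: Diff_marked_group_def)
  have mult2: "\<sigma> (gen i \<otimes>\<^bsub>B\<^esub> gen j) = g i \<otimes>\<^bsub>?G\<^esub> g j" if "i < 4" "j < 4" for i j
    using mult[OF gen_carrier gen_carrier] that by (simp add: g_def)
  have gg: "gen i \<otimes>\<^bsub>B\<^esub> gen j \<in> carrier B" if "i < 4" "j < 4" for i j
    unfolding gen_mult2[OF that] unfolding surface_braid_group_def
    by (rule fundamental_group_class[OF config_loop[OF braid_path_word2[OF that(2,1)]]])
  have mult3: "\<sigma> (gen i \<otimes>\<^bsub>B\<^esub> gen j \<otimes>\<^bsub>B\<^esub> gen i) = g i \<otimes>\<^bsub>?G\<^esub> g j \<otimes>\<^bsub>?G\<^esub> g i" if "i < 4" "j < 4" for i j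
    using mult[OF gg[OF that] gen_carrier[OF that(1)]] mult2[OF that] by (simp add: g_def)
  have br: "g i \<otimes>\<^bsub>?G\<^esub> g (Suc i) \<otimes>\<^bsub>?G\<^esub> g i = g (Suc i) \<otimes>\<^bsub>?G\<^esub> g i \<otimes>\<^bsub>?G\<^esub> g (Suc i)" if "i + 2 < 5" for i
    using mult3[of i "Suc i"] mult3[of "Suc i" i] gen_braid[OF that] that by simp
  have co: "g i \<otimes>\<^bsub>?G\<^esub> g j = g j \<otimes>\<^bsub>?G\<^esub> g i" if "i + 2 \<le> j" "j < 4" for i j
    using mult2[of i j] mult2[of j i] gen_commute[OF that] that by simp
  have zX: "z \<in> topspace X" using z R(2) interior_subset surface_boundary_subset by blast
  \<comment> \<open>For a marked point outside the disc this comes from the permutation, for a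
    boundary point from membership in \<open>Diff_rel\<close>.\<close>
  have gz: "g i z = z" if i: "i < 4" for i
  proof (cases "z \<in> R")
    case True
    then show ?thesis using perm[OF i, of z] F(4)[OF i, of 1 z] by (simp add: base_def)
  next
    case False
    then show ?thesis using z gM[OF i] by (simp add: Diff_marked_def Diff_rel_def)
  qed
  have "g 0 = g (Suc 0)"
  proof (rule braid_action_trivial[of "g 0" "g (Suc 0)" "g 2" "g 3" z])
    show "g 0 \<in> Diff X A" "g (Suc 0) \<in> Diff X A" "g 2 \<in> Diff X A" "g 3 \<in> Diff X A" by (simp_all add: gD)
    show "g 0 \<otimes>\<^bsub>?G\<^esub> g (Suc 0) \<otimes>\<^bsub>?G\<^esub> g 0 = g (Suc 0) \<otimes>\<^bsub>?G\<^esub> g 0 \<otimes>\<^bsub>?G\<^esub> g (Suc 0)" by (rule br) simp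
    show "g (Suc 0) \<otimes>\<^bsub>?G\<^esub> g 2 \<otimes>\<^bsub>?G\<^esub> g (Suc 0) = g 2 \<otimes>\<^bsub>?G\<^esub> g (Suc 0) \<otimes>\<^bsub>?G\<^esub> g 2"
      using br[of "Suc 0"] by (simp add: numeral_2_eq_2)
    show "g 2 \<otimes>\<^bsub>?G\<^esub> g 3 \<otimes>\<^bsub>?G\<^esub> g 2 = g 3 \<otimes>\<^bsub>?G\<^esub> g 2 \<otimes>\<^bsub>?G\<^esub> g 3"
      using br[of 2] by (simp add: numeral_3_eq_3 numeral_2_eq_2)
    show "g 0 \<otimes>\<^bsub>?G\<^esub> g 2 = g 2 \<otimes>\<^bsub>?G\<^esub> g 0" "g 0 \<otimes>\<^bsub>?G\<^esub> g 3 = g 3 \<otimes>\<^bsub>?G\<^esub> g 0"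
      "g (Suc 0) \<otimes>\<^bsub>?G\<^esub> g 3 = g 3 \<otimes>\<^bsub>?G\<^esub> g (Suc 0)" by (rule co; simp)+
  qed (use zX gz in simp_all)
  moreover have "\<iota> (point 0) \<in> base" by (auto simp: base_def)
  ultimately have "F 0 1 (\<iota> (point 0)) = F (Suc 0) 1 (\<iota> (point 0))"
    using perm[of 0 "\<iota> (point 0)"] perm[of "Suc 0" "\<iota> (point 0)"] by simp
  \<comment> \<open>The half twist 0 carries the point 0 to the point 1, whereas the half twist 1
    leaves it in place.\<close>
  then have "\<iota> (point (Suc 0)) = \<iota> (point 0)"
    using F(3)[of 0 1 0] F(3)[of "Suc 0" 1 0] by (simp add: half_twist_1 swap_def)
  then have "point (Suc 0) = point 0"
    by (rule inj_onD[OF embed_inj]) (simp_all add: point_in_braid_box)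
  then show False using inj_onD[OF inj_point, of "Suc 0" 0 UNIV] by simp
qed

end

section \<open>Construction of a disc around five marked points, with lifts of the half
  twists\<close>

context oriented_surface
begin

text \<open>If \<open>f p\<close> lay on the boundary it would be fixed by \<open>f\<close>, and
  injectivity would give \<open>f p = p\<close>.\<close>

lemma Diff_rel_interior:
  assumes f: "f \<in> Diff_rel X A" and p: "p \<in> surface_interior X A"
  shows "f p \<in> surface_interior X A"
proof -
  have b: "f \<in> Bij (topspace X)" using f by (simp add: Diff_rel_def Diff_Bij)
  have pX: "p \<in> topspace X" using p interior_subset by blast
  have fp: "f p \<in> topspace X" by (rule Bij_apply[OF b pX])
  have "f p \<notin> surface_boundary X A"
  proof
    assume bd: "f p \<in> surface_boundary X A"
    then have "f (f p) = f p" using f by (simp add: Diff_rel_def)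
    then have "f p = p" using Bij_inv(1)[OF b fp] Bij_inv(1)[OF b pX] by simp
    then show False using bd p by (simp add: surface_interior_def)
  qed
  then show ?thesis using fp by (simp add: surface_interior_def)
qed

text \<open>A standard configuration is placed in a small chart disc free of marked points. A
  diffeomorphism \<open>\<Phi>\<close> takes five marked points there and fixes the rest; disc and
  twists are pulled back by it.\<close>

lemma exists_marked_disc:
  assumes P: "finite P" "P \<subseteq> surface_interior X A" and x: "inj_on x {..<5::nat}" "x ` {..<5} \<subseteq> P"
  defines "R \<equiv> P - x ` {..<5}"
  obtains \<iota> F where "marked_disc X A (card P) \<iota> R" "P = \<iota> ` point ` {..<5} \<union> R"
    "\<And>i. i < 4 \<Longrightarrow> pathin (subtopology (C1_topology X A) (Diff_rel X A)) (F i)"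
    "\<And>i. i < 4 \<Longrightarrow> F i 0 = (\<lambda>x\<in>topspace X. x)"
    "\<And>i t k. i < 4 \<Longrightarrow> t \<in> {0..1} \<Longrightarrow> k < 5 \<Longrightarrow> F i t (\<iota> (point k)) = \<iota> (half_twist i t k)"
    "\<And>i t q. i < 4 \<Longrightarrow> t \<in> {0..1} \<Longrightarrow> q \<in> R \<Longrightarrow> F i t q = q"
proof -
  have PX: "P \<subseteq> topspace X" using P interior_subset by blast
  \<comment> \<open>Working off \<open>P\<close> makes the target points disjoint from the given
    ones, as \<open>move_points\<close> demands, and keeps \<open>R\<close> outside the
    disc.\<close>
  define W where "W = surface_interior X A - P"
  have W: "openin X W"
    unfolding W_def by (rule openin_diff[OF interior_open closedin_Hausdorff_finite[OF Hausdorff PX P(1)]])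
  obtain q where q: "q \<in> W"
  proof -
    have "x 0 \<in> x ` {..<5}" by (rule imageI) simp
    then have x0: "x 0 \<in> surface_interior X A" using x(2) P(2) by blast
    obtain c \<rho> where c: "c \<in> A" "0 < \<rho>" "cball (snd c (x 0)) \<rho> \<subseteq> snd c ` (fst c \<inter> surface_interior X A)"
      by (rule interior_disc[OF x0 interior_open x0]) (rule that)
    have "infinite (cball (snd c (x 0)) \<rho>)" using uncountable_cball[OF c(2)] by (rule uncountable_infinite)
    then have "\<not> cball (snd c (x 0)) \<rho> \<subseteq> snd c ` P" using P(1) finite_subset by blast
    then obtain v where "v \<in> cball (snd c (x 0)) \<rho>" "v \<notin> snd c ` P" by blast
    then obtain q where "q \<in> surface_interior X A" "q \<notin> P" using c(3) by blast
    then show thesis using that by (simp add: W_def)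
  qed
  have qi: "q \<in> surface_interior X A" using q by (simp add: W_def)
  obtain c \<rho>' where c: "c \<in> A" "q \<in> fst c" "0 < \<rho>'" and disc: "cball (snd c q) \<rho>' \<subseteq> snd c ` (fst c \<inter> W)"
    and pos: "\<And>v. v \<in> cball (snd c q) \<rho>' \<Longrightarrow> 0 < v $ 2"
    by (rule interior_disc[OF qi W q]) (rule that)
  note ch = atlas_chart[OF c(1)]
  \<comment> \<open>Every point of \<open>braid_box\<close> lies within 3 of its centre
    \<open>point 2\<close>, so scaling by \<open>r\<close> fits it into the disc of radius
    \<open>\<rho>'\<close>.\<close>
  define r where "r = \<rho>' / 3"
  have r: "0 < r" "3 * r = \<rho>'" using c(3) by (simp_all add: r_def)
  define o' where "o' = snd c q"
  define m where "m v = o' + r *\<^sub>R (v - point 2)" for v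
  have norm_le: "norm v \<le> \<bar>v $ 1\<bar> + \<bar>v $ 2\<bar>" for v :: "real^2"
    using norm_le_l1_cart[of v] by (simp add: sum_2)
  have m_disc: "m v \<in> cball o' \<rho>'" if "v \<in> braid_box" for v
  proof -
    have "norm (v - point 2) \<le> 3" using norm_le[of "v - point 2"] that by (simp add: braid_box_def) linarith
    then have "r * norm (v - point 2) \<le> 3 * r" using r(1) by simp
    then show ?thesis using r by (simp add: m_def dist_norm)
  qed
  define j where "j v = inv_into (fst c) (snd c) (m v)" for v
  have jc: "j v \<in> fst c" "snd c (j v) = m v" "j v \<in> W" if v: "v \<in> braid_box" for v
  proof -
    obtain p where p: "p \<in> fst c" "p \<in> W" "m v = snd c p" using disc m_disc[OF v] unfolding o'_def by blast
    then have "j v = p" using chart_inv[OF ch] by (simp add: j_def)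
    then show "j v \<in> fst c" "snd c (j v) = m v" "j v \<in> W" using p by simp_all
  qed
  have j_inj: "v = w" if "v \<in> braid_box" "w \<in> braid_box" "j v = j w" for v w
  proof -
    have "m v = m w" using jc(2) that by metis
    then show ?thesis using r(1) by (simp add: m_def)
  qed
  have j_cont: "continuous_map (top_of_set braid_box) X j"
  proof -
    have "continuous_on braid_box m" unfolding m_def by (intro continuous_intros)
    moreover have "m ` braid_box \<subseteq> snd c ` fst c" using jc(1,2) by (metis image_eqI image_subsetI)
    ultimately have "continuous_map (top_of_set braid_box) (top_of_set (snd c ` fst c)) m"
      by (auto simp: continuous_map_in_subtopology)
    from continuous_map_compose[OF this chart_inv_continuous[OF ch]]
    show ?thesis by (simp add: j_def[abs_def] comp_def)
  qed
  have pt: "point k \<in> braid_box" if "k < 5" for k using point_in_braid_box[OF that] .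
  have "\<exists>\<Phi>\<in>Diff_rel X A. (\<forall>k<5. \<Phi> (x k) = j (point k)) \<and> (\<forall>q\<in>R. \<Phi> q = q)"
  proof (rule move_points)
    show "inj_on (\<lambda>k. j (point k)) {..<5}"
      by (rule inj_onI) (use j_inj pt inj_onD[OF inj_point[of UNIV]] in blast)
    have jW: "(\<lambda>k. j (point k)) ` {..<5} \<subseteq> W" using jc(3) pt by auto
    then show "(\<lambda>k. j (point k)) ` {..<5} \<subseteq> surface_interior X A" by (auto simp: W_def)
    show "(\<lambda>k. j (point k)) ` {..<5} \<inter> R = {}" "x ` {..<5} \<inter> (\<lambda>k. j (point k)) ` {..<5} = {}"
      using jW x(2) by (auto simp: W_def R_def)
  qed (use P PX x in \<open>auto simp: R_def\<close>)
  then obtain \<Phi> where \<Phi>: "\<Phi> \<in> Diff_rel X A" "\<And>k. k < 5 \<Longrightarrow> \<Phi> (x k) = j (point k)" "\<And>q. q \<in> R \<Longrightarrow> \<Phi> q = q"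
    by blast
  have \<Phi>D: "\<Phi> \<in> Diff X A" using \<Phi>(1) by (simp add: Diff_rel_def)
  note b = Diff_Bij[OF \<Phi>D]
  define \<Psi> where "\<Psi> = restrict (inv_into (topspace X) \<Phi>) (topspace X)"
  have \<Psi>: "\<Psi> \<in> Diff_rel X A" unfolding \<Psi>_def by (rule Diff_rel_inverse[OF \<Phi>(1)])
  have \<Psi>D: "\<Psi> \<in> Diff X A" using \<Psi> by (simp add: Diff_rel_def)
  have \<Psi>\<Phi>: "\<Psi> (\<Phi> p) = p" "\<Phi> (\<Psi> p) = p" if "p \<in> topspace X" for p
    using Bij_inv[OF b that] Bij_apply[OF b that] that by (simp_all add: \<Psi>_def)
  have jX: "j v \<in> topspace X" if "v \<in> braid_box" for v using jc(3)[OF that] openin_subset[OF W] by blast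
  define \<iota> where "\<iota> v = \<Psi> (j v)" for v
  have \<iota>x: "\<iota> (point k) = x k" if "k < 5" for k
  proof -
    have "x k \<in> topspace X" using x(2) PX that by auto
    then show ?thesis using \<Psi>\<Phi>(1)[of "x k"] \<Phi>(2)[OF that] by (simp add: \<iota>_def)
  qed
  have md: "marked_disc X A (card P) \<iota> R"
  proof
    show "continuous_map (top_of_set braid_box) X \<iota>"
      using continuous_map_compose[OF j_cont Diff_continuous[OF \<Psi>D]] by (simp add: \<iota>_def[abs_def] comp_def)
    show "inj_on \<iota> braid_box"
    proof (rule inj_onI)
      fix v w assume vw: "v \<in> braid_box" "w \<in> braid_box" "\<iota> v = \<iota> w"
      then have "j v = j w" using \<Psi>\<Phi>(2)[OF jX] unfolding \<iota>_def by metis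
      then show "v = w" using j_inj vw by blast
    qed
    show "\<iota> ` braid_box \<subseteq> surface_interior X A"
      using Diff_rel_interior[OF \<Psi>] jc(3) by (auto simp: \<iota>_def W_def)
    show "finite R" "R \<subseteq> surface_interior X A" using P by (auto simp: R_def)
    show "R \<inter> \<iota> ` braid_box = {}"
    proof (rule ccontr)
      assume "R \<inter> \<iota> ` braid_box \<noteq> {}"
      then obtain v where v: "v \<in> braid_box" "\<iota> v \<in> R" by blast
      then have "j v = \<iota> v" using \<Psi>\<Phi>(2)[OF jX[OF v(1)]] \<Phi>(3)[OF v(2)] by (simp add: \<iota>_def)
      then show False using jc(3)[OF v(1)] v(2) by (simp add: W_def R_def)
    qed
    have "card R = card P - 5"
      unfolding R_def using card_Diff_subset[of "x ` {..<5}" P] x card_image[OF x(1)] by simp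
    moreover have "5 \<le> card P" using card_mono[OF P(1) x(2)] card_image[OF x(1)] by simp
    ultimately show "card P = card R + 5" by simp
  qed
  have Peq: "P = \<iota> ` point ` {..<5} \<union> R"
  proof -
    have "\<iota> ` point ` {..<5} = x ` {..<5}" unfolding image_image by (rule image_cong) (simp_all add: \<iota>x)
    then show ?thesis using x(2) by (auto simp: R_def)
  qed
  \<comment> \<open>The midpoint of the twisted pair. In units of \<open>r\<close>, the pair is at
    distance 1/2, the other points at distance at least 1, and the twist is supported in radius 3/4.
    The centre is at most 3/2 from \<open>o'\<close>, and 3/2 + 3/4 is less than 3.\<close>
  define ctr where "ctr i = o' + r *\<^sub>R (vector [real i + 1/2, 0] - point 2)" for i :: nat
  have tw: "twist_disc X A c (ctr i) (3/4 * r)" if i: "i < 4" for i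
  proof
    show "c \<in> A" "0 < 3/4 * r" using c r by simp_all
    have sub: "cball (ctr i) (3/4 * r) \<subseteq> cball o' \<rho>'"
    proof
      fix v assume v: "v \<in> cball (ctr i) (3/4 * r)"
      have "norm (vector [real i + 1/2, 0] - point 2) \<le> 3/2"
        using norm_le[of "vector [real i + 1/2, 0] - point 2"] i by (simp add: abs_le_iff)
      then have "r * norm (vector [real i + 1/2, 0] - point 2) \<le> r * (3/2)" using r(1) by simp
      then have "dist o' (ctr i) \<le> 3/2 * r" using r(1) by (simp add: ctr_def dist_norm)
      then have "dist o' v \<le> 3/2 * r + 3/4 * r" using v dist_triangle[of o' v "ctr i"] by simp
      then show "v \<in> cball o' \<rho>'" using r by simp
    qed
    then show "cball (ctr i) (3/4 * r) \<subseteq> snd c ` fst c" using disc unfolding o'_def by blast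
    show "0 < v $ 2" if "v \<in> cball (ctr i) (3/4 * r)" for v using pos sub that unfolding o'_def by blast
  qed
  define H where "H i \<theta> = twist_disc.chart_twist X c (ctr i) (3/4 * r) (1/2 * r) \<theta>" for i \<theta>
  \<comment> \<open>The twist conjugated by \<open>\<Phi>\<close>, with the angle growing from 0 to
    a half turn.\<close>
  define F where "F i t = compose (topspace X) \<Psi> (compose (topspace X) (H i (pi * t)) \<Phi>)" for i t
  have H: "C1_family X A (H i)" "H i \<theta> \<in> Diff_rel X A" "H i 0 = restrict id (topspace X)" if "i < 4" for i \<theta>
    unfolding H_def[abs_def]
    using twist_disc.chart_twist_family[OF tw[OF that]] twist_disc.chart_twist_Diff_rel[OF tw[OF that]]
      twist_disc.chart_twist_0[OF tw[OF that]] by simp_all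
  have H_twist: "H i \<theta> (j v) = inv_into (fst c) (snd c) (twist (ctr i) (3/4 * r) (1/2 * r) \<theta> (m v))"
    if "i < 4" "v \<in> braid_box" for i \<theta> v
    using twist_disc.chart_twist_def[OF tw[OF that(1)]] jc[OF that(2)] by (simp add: H_def)
  have H_points: "H i (pi * t) (j (point k)) = j (half_twist i t k)" if i: "i < 4" and k: "k < 5" for i k t
  proof -
    have pd: "m (point k) - ctr i = r *\<^sub>R (point k - vector [real i + 1/2, 0])"
      by (simp add: m_def ctr_def algebra_simps)
    have "twist (ctr i) (3/4 * r) (1/2 * r) (pi * t) (m (point k)) = m (half_twist i t k)"
    proof (cases "k = i \<or> k = Suc i")
      case True
      have "norm (point k - vector [real i + 1/2, 0]) = 1/2"
      proof -
        have "(norm (point k - vector [real i + 1/2, 0]))\<^sup>2 = (1/2)\<^sup>2"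
          unfolding norm_square_2 using True by (auto simp: power2_eq_square)
        then show ?thesis by (simp only: power2_eq_iff_nonneg norm_ge_zero)
      qed
      then have "norm (m (point k) - ctr i) = 1/2 * r" unfolding pd using r(1) by simp
      then have "twist (ctr i) (3/4 * r) (1/2 * r) (pi * t) (m (point k)) = ctr i + rot (pi * t) (m (point k) - ctr i)"
        by (intro twist_on_circle) (use r(1) in simp_all)
      also have "\<dots> = m (half_twist i t k)"
        unfolding pd using True
        by (elim disjE) (simp_all add: vec_eq_iff forall_2 ctr_def m_def half_twist_def algebra_simps)
      finally show ?thesis .
    next
      case False
      have "1 \<le> \<bar>(point k - vector [real i + 1/2, 0]) $ 1\<bar>"
      proof -
        have "real k + 1 \<le> real i \<or> real i + 2 \<le> real k" using False by linarith
        moreover have "(point k - vector [real i + 1/2, 0]) $ 1 = real k - (real i + 1/2)" by simp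
        ultimately show ?thesis by linarith
      qed
      also have "\<dots> \<le> norm (point k - vector [real i + 1/2, 0])" by (rule component_le_norm_cart)
      finally have "r * 1 \<le> r * norm (point k - vector [real i + 1/2, 0])" using r(1) by simp
      then have "3/4 * r \<le> norm (m (point k) - ctr i)" unfolding pd using r(1) by simp
      then have "twist (ctr i) (3/4 * r) (1/2 * r) (pi * t) (m (point k)) = m (point k)"
        by (intro twist_outside) (use r(1) in simp_all)
      then show ?thesis using False by (simp add: half_twist_outside)
    qed
    then show ?thesis using H_twist[OF i pt[OF k]] by (simp add: j_def)
  qed
  have H_rest: "H i \<theta> q = q" if i: "i < 4" and q: "q \<in> R" for i \<theta> q
    unfolding H_def
  proof (rule twist_disc.chart_twist_off_disc[OF tw[OF i]])
    show "q \<in> topspace X" using q PX by (auto simp: R_def)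
    show "q \<notin> twist_disc.disc_set c (ctr i) (3/4 * r)"
    proof
      assume "q \<in> twist_disc.disc_set c (ctr i) (3/4 * r)"
      then have qc: "q \<in> fst c" "snd c q \<in> cball (ctr i) (3/4 * r)"
        using twist_disc.disc_set_subset[OF tw[OF i]] twist_disc.disc_set_iff[OF tw[OF i]] by blast+
      have "dist o' (ctr i) \<le> 3/2 * r"
      proof -
        have "norm (vector [real i + 1/2, 0] - point 2) \<le> 3/2"
          using norm_le[of "vector [real i + 1/2, 0] - point 2"] i by (simp add: abs_le_iff)
        then have "r * norm (vector [real i + 1/2, 0] - point 2) \<le> r * (3/2)" using r(1) by simp
        then show ?thesis using r(1) by (simp add: ctr_def dist_norm)
      qed
      then have "dist o' (snd c q) \<le> 3/2 * r + 3/4 * r" using qc(2) dist_triangle[of o' "snd c q" "ctr i"] by simp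
      then have "snd c q \<in> cball o' \<rho>'" using r by simp
      then obtain q' where "q' \<in> fst c" "q' \<in> W" "snd c q = snd c q'" using disc unfolding o'_def by blast
      then have "q \<in> W" using inj_onD[OF chart_inj[OF ch]] qc(1) by metis
      then show False using q by (simp add: W_def R_def)
    qed
  qed
  have F_apply: "F i t p = \<Psi> (H i (pi * t) (\<Phi> p))" if "p \<in> topspace X" for i t p
    using that by (simp add: F_def compose_def)
  show thesis
  proof (rule that[OF md Peq])
    fix i :: nat assume i: "i < 4"
    have FD: "compose (topspace X) \<Psi> (compose (topspace X) (H i \<theta>) \<Phi>) \<in> Diff_rel X A" for \<theta>
      by (intro Diff_rel_compose \<Phi>(1) \<Psi> H(2) i)
    \<comment> \<open>Composition with constant families preserves joint regularity in the angle,
      which gives the path in the topology of diffeomorphisms.\<close>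
    have "C1_family X A (\<lambda>\<theta>. \<Psi> \<circ> (H i \<theta> \<circ> \<Phi>))"
      by (rule C1_family_compose[OF C1_family_compose[OF Diff_family[OF \<Phi>D] H(1)[OF i]] Diff_family[OF \<Psi>D]])
    then have "C1_family X A (\<lambda>\<theta>. compose (topspace X) \<Psi> (compose (topspace X) (H i \<theta>) \<Phi>))"
      by (rule C1_family_cong) (simp add: compose_def)
    then have "continuous_map euclideanreal (C1_topology X A) (\<lambda>\<theta>. compose (topspace X) \<Psi> (compose (topspace X) (H i \<theta>) \<Phi>))"
      by (rule C1_family_continuous_path) (use FD qi interior_subset in \<open>auto simp: Diff_rel_def\<close>)
    moreover have "continuous_map (top_of_set {0..1}) euclideanreal (\<lambda>t. pi * t)" by (simp add: continuous_intros)
    ultimately have "continuous_map (top_of_set {0..1}) (C1_topology X A)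
      ((\<lambda>\<theta>. compose (topspace X) \<Psi> (compose (topspace X) (H i \<theta>) \<Phi>)) \<circ> (\<lambda>t. pi * t))"
      by (intro continuous_map_compose)
    then show "pathin (subtopology (C1_topology X A) (Diff_rel X A)) (F i)"
      using FD by (simp add: pathin_def continuous_map_in_subtopology F_def[abs_def] comp_def)
    show "F i 0 = (\<lambda>x\<in>topspace X. x)"
    proof
      fix p
      show "F i 0 p = (\<lambda>x\<in>topspace X. x) p"
      proof (cases "p \<in> topspace X")
        case True
        then show ?thesis using F_apply[OF True, of i 0] H(3)[OF i] Bij_apply[OF b True] \<Psi>\<Phi>(1)[OF True] by simp
      next
        case False
        then show ?thesis by (simp add: F_def compose_def)
      qed
    qed
    show "F i t (\<iota> (point k)) = \<iota> (half_twist i t k)" if "t \<in> {0..1}" "k < 5" for t k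
    proof -
      have "\<iota> (point k) \<in> topspace X" using Bij_apply[OF Diff_Bij[OF \<Psi>D] jX[OF pt[OF that(2)]]] by (simp add: \<iota>_def)
      then have "F i t (\<iota> (point k)) = \<Psi> (H i (pi * t) (j (point k)))"
        using F_apply \<Psi>\<Phi>(2)[OF jX[OF pt[OF that(2)]]] by (simp add: \<iota>_def)
      then show ?thesis using H_points[OF i that(2)] by (simp add: \<iota>_def)
    qed
    show "F i t q = q" if "t \<in> {0..1}" "q \<in> R" for t q
    proof -
      have "q \<in> topspace X" using that PX by (auto simp: R_def)
      then show ?thesis using F_apply[of q i t] \<Phi>(3)[OF that(2)] H_rest[OF i that(2)] \<Psi>\<Phi>(1)[of q] by simp
    qed
  qed
qed

end

theorem theorem1p1:
  fixes X :: "'a topology" and A :: "'a chart set" and P :: "'a set" and n :: nat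
  assumes "compact_connected_oriented_surface X A"
    and "P \<subseteq> surface_interior X A" and "finite P" and "card P = n"
  shows "(surface_boundary X A = {} \<longrightarrow> 6 \<le> n \<longrightarrow> \<not> realized_by_C1_diffeos X A n P) \<and>
         (surface_boundary X A \<noteq> {} \<longrightarrow> 5 \<le> n \<longrightarrow> \<not> realized_by_C1_diffeos X A n P)"
proof -
  interpret oriented_surface X A by unfold_locales (rule assms(1))
  have main: "\<not> realized_by_C1_diffeos X A n P"
    if n: "5 \<le> n" and fixed: "6 \<le> n \<or> surface_boundary X A \<noteq> {}"
  proof -
    obtain x where x: "bij_betw x {..<n} P"
      using finite_same_card_bij[of "{..<n}" P] assms(3,4) by auto
    have x5: "inj_on x {..<5}" "x ` {..<5} \<subseteq> P"
      using x n by (auto simp: bij_betw_def intro: inj_on_subset)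
    define R where "R = P - x ` {..<5}"
    \<comment> \<open>The two ranges of \<open>n\<close> differ only here: without boundary, the
      sixth marked point \<open>x 5\<close> provides the fixed point.\<close>
    have "\<exists>z. z \<in> R \<or> z \<in> surface_boundary X A"
    proof (cases "6 \<le> n")
      case True
      have "x 5 \<notin> x ` {..<5}"
      proof
        assume "x 5 \<in> x ` {..<5}"
        then obtain k where "k < 5" "x 5 = x k" by auto
        then show False using inj_onD[OF bij_betw_imp_inj_on[OF x], of 5 k] True by simp
      qed
      moreover have "x 5 \<in> P" using bij_betwE[OF x] True by simp
      ultimately show ?thesis by (auto simp: R_def)
    qed (use fixed in blast)
    then obtain z where z: "z \<in> R \<or> z \<in> surface_boundary X A" by blast
    obtain \<iota> F where md: "marked_disc X A (card P) \<iota> R" "P = \<iota> ` point ` {..<5} \<union> R"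
      and F: "\<And>i. i < 4 \<Longrightarrow> pathin (subtopology (C1_topology X A) (Diff_rel X A)) (F i)"
        "\<And>i. i < 4 \<Longrightarrow> F i 0 = (\<lambda>x\<in>topspace X. x)"
        "\<And>i t k. i < 4 \<Longrightarrow> t \<in> {0..1} \<Longrightarrow> k < 5 \<Longrightarrow> F i t (\<iota> (point k)) = \<iota> (half_twist i t k)"
        "\<And>i t q. i < 4 \<Longrightarrow> t \<in> {0..1} \<Longrightarrow> q \<in> R \<Longrightarrow> F i t q = q"
      by (rule exists_marked_disc[OF assms(3,2) x5, folded R_def]) (rule that)
    interpret marked_disc X A "card P" \<iota> R by (rule md(1))
    have "base = P" using md(2) by (simp add: base_def)
    then show ?thesis using not_realized[OF F z] assms(4) by simp
  qed
  show ?thesis using main by auto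
qed

end
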